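(* Let $I\subseteq S_\kappa$ be a homogeneous ideal such that $S_\kappa/I^{\mathrm{sat}}$ is one-dimensional and Gorenstein, and let $a$ be the largest index such that $H_{S_\kappa/I^{\mathrm{sat}}}(a)\ne H_{S_\kappa/I^{\mathrm{sat}}}(a+1)$. Then $$\operatorname{Ext}^1_{S_\kappa}\left(\frac{I^{\mathrm{sat}}}{I},\ \frac{S_\kappa}{I^{\mathrm{sat}}}\right)_0\simeq\operatorname{Hom}_\kappa\left(\left(\frac{I^{\mathrm{sat}}}{I+(I^{\mathrm{sat}})^2}\right)_a,\ \kappa\right).$$
   Context: $\kappa$ is a field and $S_\kappa$ is a standard $\mathbb N$-graded polynomial ring over $\kappa$, with irrelevant ideal $(S_\kappa)_+$; $I^{\mathrm{sat}}=\bigcup_i(I:(S_\kappa)_+^i)$. $H_{S_\kappa/I^{\mathrm{sat}}}(e)=\dim_\kappa(S_\kappa/I^{\mathrm{sat}})_e$ for $e\in\mathbb Z$ (so it is zero for $e<0$). Subscripts denote graded pieces; the group on the left is the degree zero part of Ext. *)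

theory Defs
  imports "HOL-Algebra.Algebra" "HOL-Algebra.Algebraic_Closure_Type" "HOL-Library.Poly_Mapping" "HOL-Library.Extended_Nat"
begin

section \<open>Modules\<close>

text \<open>
  Of the record of a module only carrier, addition, zero and scalar multiplication are
  meaningful; the inherited fields for multiplication and one are ignored.
\<close>

definition self_module :: "('r, 'c) ring_scheme \<Rightarrow> ('r, 'r) module" where
  "self_module R = \<lparr>carrier = carrier R, monoid.mult = monoid.mult R, one = one R,
     ring.zero = ring.zero R, add = add R, module.smult = monoid.mult R\<rparr>"

text \<open>Cosets are added and scaled representative by representative, as in \<^const>\<open>FactRing\<close>.\<close>

definition quot_module :: "('r, 'm, 'c) module_scheme \<Rightarrow> 'm set \<Rightarrow> ('r, 'm set) module" where
  "quot_module M N = \<lparr>carrier = a_rcosets\<^bsub>M\<^esub> N, monoid.mult = undefined, one = undefined,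
     ring.zero = N, add = set_add M, module.smult = (\<lambda>r C. \<Union>x\<in>C. N +>\<^bsub>M\<^esub> (r \<odot>\<^bsub>M\<^esub> x))\<rparr>"

definition mod_hom ::
  "('r, 'c) ring_scheme \<Rightarrow> ('r, 'm, 'd) module_scheme \<Rightarrow> ('r, 'n, 'e) module_scheme \<Rightarrow> ('m \<Rightarrow> 'n) set"
where
  "mod_hom R M N = {f \<in> carrier M \<rightarrow> carrier N.
     (\<forall>x\<in>carrier M. \<forall>y\<in>carrier M. f (x \<oplus>\<^bsub>M\<^esub> y) = f x \<oplus>\<^bsub>N\<^esub> f y) \<and>
     (\<forall>r\<in>carrier R. \<forall>x\<in>carrier M. f (r \<odot>\<^bsub>M\<^esub> x) = r \<odot>\<^bsub>N\<^esub> f x)}"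

definition modules_isomorphic ::
  "('r, 'c) ring_scheme \<Rightarrow> ('r, 'm, 'd) module_scheme \<Rightarrow> ('r, 'n, 'e) module_scheme \<Rightarrow> bool"
where
  "modules_isomorphic R M N \<longleftrightarrow>
     (\<exists>f \<in> mod_hom R M N. bij_betw f (carrier M) (carrier N))"

text \<open>Restricting to extensional functions makes equality of homomorphisms plain equality.\<close>

definition Hom_module ::
  "('r, 'c) ring_scheme \<Rightarrow> ('r, 'm, 'd) module_scheme \<Rightarrow> ('r, 'n, 'e) module_scheme \<Rightarrow> ('r, 'm \<Rightarrow> 'n) module"
where
  "Hom_module R M N = \<lparr>carrier = mod_hom R M N \<inter> extensional (carrier M),
     monoid.mult = undefined, one = undefined,
     ring.zero = (\<lambda>x\<in>carrier M. \<zero>\<^bsub>N\<^esub>),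
     add = (\<lambda>f g. \<lambda>x\<in>carrier M. f x \<oplus>\<^bsub>N\<^esub> g x),
     module.smult = (\<lambda>r f. \<lambda>x\<in>carrier M. r \<odot>\<^bsub>N\<^esub> f x)\<rparr>"


section \<open>Krull dimension, localization, Gorenstein rings\<close>

definition krull_dim :: "('r, 'c) ring_scheme \<Rightarrow> enat" where
  "krull_dim R = Sup {enat n | n. \<exists>P :: nat \<Rightarrow> 'r set.
     (\<forall>i\<le>n. primeideal (P i) R) \<and> (\<forall>i<n. P i \<subset> P (Suc i))}"

definition frac_rel :: "('r, 'c) ring_scheme \<Rightarrow> 'r set \<Rightarrow> (('r \<times> 'r) \<times> ('r \<times> 'r)) set" where
  "frac_rel R T = {((r, s), (r', s')). r \<in> carrier R \<and> s \<in> T \<and> r' \<in> carrier R \<and> s' \<in> T \<and>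
     (\<exists>u\<in>T. u \<otimes>\<^bsub>R\<^esub> (r \<otimes>\<^bsub>R\<^esub> s') = u \<otimes>\<^bsub>R\<^esub> (r' \<otimes>\<^bsub>R\<^esub> s))}"

definition fraction :: "('r, 'c) ring_scheme \<Rightarrow> 'r set \<Rightarrow> 'r \<Rightarrow> 'r \<Rightarrow> ('r \<times> 'r) set" where
  "fraction R T r s = frac_rel R T `` {(r, s)}"

definition localization :: "('r, 'c) ring_scheme \<Rightarrow> 'r set \<Rightarrow> ('r \<times> 'r) set ring" where
  "localization R T = \<lparr>carrier = (carrier R \<times> T) // frac_rel R T,
     monoid.mult = (\<lambda>A B. \<Union>(r, s)\<in>A. \<Union>(r', s')\<in>B. fraction R T (r \<otimes>\<^bsub>R\<^esub> r') (s \<otimes>\<^bsub>R\<^esub> s')),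
     one = fraction R T \<one>\<^bsub>R\<^esub> \<one>\<^bsub>R\<^esub>,
     ring.zero = fraction R T \<zero>\<^bsub>R\<^esub> \<one>\<^bsub>R\<^esub>,
     add = (\<lambda>A B. \<Union>(r, s)\<in>A. \<Union>(r', s')\<in>B.
       fraction R T ((r \<otimes>\<^bsub>R\<^esub> s') \<oplus>\<^bsub>R\<^esub> (r' \<otimes>\<^bsub>R\<^esub> s)) (s \<otimes>\<^bsub>R\<^esub> s'))\<rparr>"

text \<open>
  The lifting property is tested on modules whose elements are taken from the type of the
  ring elements.  These include the inclusions of ideals into the ring, so by Baer's criterion
  nothing is lost compared with testing on modules over arbitrary types.
\<close>

definition injective_module :: "('r, 'c) ring_scheme \<Rightarrow> ('r, 'e, 'd) module_scheme \<Rightarrow> bool" where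
  "injective_module R E \<longleftrightarrow> module R E \<and>
     (\<forall>(A :: ('r, 'r) module) (B :: ('r, 'r) module) f g.
        module R A \<and> module R B \<and> f \<in> mod_hom R A B \<and> inj_on f (carrier A) \<and>
        g \<in> mod_hom R A E \<longrightarrow>
        (\<exists>h \<in> mod_hom R B E. \<forall>x\<in>carrier A. h (f x) = g x))"

text \<open>
  A finite injective resolution \<open>0 \<rightarrow> M \<rightarrow> E 0 \<rightarrow> E 1 \<rightarrow> \<dots> \<rightarrow> E n \<rightarrow> 0\<close>.  HOL cannot quantify over types
  inside a definition, so the type \<open>'e\<close> from which the elements of the injective modules are taken
  is a parameter.  A theorem that has such a hypothesis for an arbitrary \<open>'e\<close> therefore applies
  as soon as a finite injective resolution exists over some type.
\<close>

definition finite_injective_dimension ::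
  "'e itself \<Rightarrow> ('r, 'c) ring_scheme \<Rightarrow> ('r, 'm, 'd) module_scheme \<Rightarrow> bool"
where
  "finite_injective_dimension TYPE('e) R M \<longleftrightarrow>
     (\<exists>(n :: nat) (E :: nat \<Rightarrow> ('r, 'e) module) \<eta> d.
        (\<forall>i. injective_module R (E i)) \<and>
        (\<forall>i>n. carrier (E i) = {\<zero>\<^bsub>E i\<^esub>}) \<and>
        \<eta> \<in> mod_hom R M (E 0) \<and> inj_on \<eta> (carrier M) \<and>
        (\<forall>i. d i \<in> mod_hom R (E i) (E (Suc i))) \<and>
        \<eta> ` carrier M = {x \<in> carrier (E 0). d 0 x = \<zero>\<^bsub>E 1\<^esub>} \<and>
        (\<forall>i. d i ` carrier (E i) =
               {x \<in> carrier (E (Suc i)). d (Suc i) x = \<zero>\<^bsub>E (Suc (Suc i))\<^esub>}))"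

text \<open>
  A Noetherian ring is Gorenstein if its localization at every maximal ideal has finite injective
  dimension as a module over itself.
\<close>

definition gorenstein_ring :: "'e itself \<Rightarrow> ('r, 'c) ring_scheme \<Rightarrow> bool" where
  "gorenstein_ring TYPE('e) R \<longleftrightarrow> cring R \<and> noetherian_ring R \<and>
     (\<forall>P. maximalideal P R \<longrightarrow>
        finite_injective_dimension TYPE('e) (localization R (carrier R - P))
          (self_module (localization R (carrier R - P))))"


section \<open>The polynomial ring and its homogeneous ideals\<close>

text \<open>
  The polynomial ring over the field \<open>'k\<close> whose variables are the elements of the finite
  (and, like all types, nonempty) type \<open>'x\<close>.
\<close>

type_synonym ('x, 'k) mpoly = "('x \<Rightarrow>\<^sub>0 nat) \<Rightarrow>\<^sub>0 'k"

abbreviation polyring :: "('x::finite, 'k::field) mpoly ring" where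
  "polyring \<equiv> ring_of_type_algebra"

definition poly_piece :: "int \<Rightarrow> ('x::finite, 'k::field) mpoly set" where
  "poly_piece e = {p. \<forall>m \<in> Poly_Mapping.keys p. int (\<Sum>x\<in>UNIV. Poly_Mapping.lookup m x) = e}"

definition irrelevant_ideal :: "('x::finite, 'k::field) mpoly set" where
  "irrelevant_ideal = genideal polyring (\<Union>e\<in>{1..}. poly_piece e)"

definition homogeneous_ideal :: "('x::finite, 'k::field) mpoly set \<Rightarrow> bool" where
  "homogeneous_ideal I \<longleftrightarrow> (\<exists>A \<subseteq> (\<Union>e. poly_piece e). I = genideal polyring A)"

definition colon_ideal :: "('r, 'c) ring_scheme \<Rightarrow> 'r set \<Rightarrow> 'r set \<Rightarrow> 'r set" where
  "colon_ideal R I J = {x \<in> carrier R. \<forall>y\<in>J. x \<otimes>\<^bsub>R\<^esub> y \<in> I}"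

text \<open>The powers are those of the multiplicative monoid of ideals.\<close>

definition saturation :: "('x::finite, 'k::field) mpoly set \<Rightarrow> ('x, 'k) mpoly set" where
  "saturation I =
     (\<Union>i::nat. colon_ideal polyring I (irrelevant_ideal [^]\<^bsub>ideals_set polyring\<^esub> i))"

abbreviation const_poly :: "'k::field \<Rightarrow> ('x::finite, 'k) mpoly" where
  "const_poly \<equiv> Poly_Mapping.single 0"


section \<open>Graded modules over the polynomial ring\<close>

text \<open>A grading is a family of subsets \<open>G e\<close> of the module, the pieces of degree \<open>e\<close>.\<close>

definition graded_module ::
  "(('x::finite, 'k::field) mpoly, 'm, 'c) module_scheme \<Rightarrow> (int \<Rightarrow> 'm set) \<Rightarrow> bool"
where
  "graded_module M G \<longleftrightarrow> module polyring M \<and>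
     (\<forall>e. subgroup (G e) (add_monoid M)) \<and>
     (\<forall>d e. \<forall>s \<in> poly_piece d. \<forall>x \<in> G e. s \<odot>\<^bsub>M\<^esub> x \<in> G (d + e)) \<and>
     (\<forall>x \<in> carrier M. \<exists>!c. (\<forall>e. c e \<in> G e) \<and> finite {e. c e \<noteq> \<zero>\<^bsub>M\<^esub>} \<and>
        x = finsum M c {e. c e \<noteq> \<zero>\<^bsub>M\<^esub>})"

definition quot_grading ::
  "('r, 'm, 'c) module_scheme \<Rightarrow> 'm set \<Rightarrow> (int \<Rightarrow> 'm set) \<Rightarrow> int \<Rightarrow> 'm set set"
where
  "quot_grading M N G e = (\<lambda>x. N +>\<^bsub>M\<^esub> x) ` G e"

text \<open>For ideals \<open>I \<subseteq> J\<close>, the module \<open>J / I\<close>; for homogeneous ideals, its pieces.\<close>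

definition ideal_quot ::
  "('x::finite, 'k::field) mpoly set \<Rightarrow> ('x, 'k) mpoly set \<Rightarrow> (('x, 'k) mpoly, ('x, 'k) mpoly set) module"
where
  "ideal_quot J I = quot_module ((self_module polyring)\<lparr>carrier := J\<rparr>) I"

definition ideal_quot_piece ::
  "('x::finite, 'k::field) mpoly set \<Rightarrow> ('x, 'k) mpoly set \<Rightarrow> int \<Rightarrow> ('x, 'k) mpoly set set"
where
  "ideal_quot_piece J I =
     quot_grading ((self_module polyring)\<lparr>carrier := J\<rparr>) I (\<lambda>e. J \<inter> poly_piece e)"

text \<open>A subset \<open>V\<close> of an \<open>S\<close>-module, such as a graded piece, as a vector space over the field.\<close>

definition vector_space_on ::
  "(('x::finite, 'k::field) mpoly, 'm, 'c) module_scheme \<Rightarrow> 'm set \<Rightarrow> ('k, 'm) module"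
where
  "vector_space_on M V = \<lparr>carrier = V, monoid.mult = undefined, one = undefined,
     ring.zero = ring.zero M, add = add M, module.smult = (\<lambda>c v. const_poly c \<odot>\<^bsub>M\<^esub> v)\<rparr>"

text \<open>
  The Hilbert function of \<open>S / J\<close>: \<^const>\<open>ring.dim\<close> is the dimension of a subspace of a ring
  over a subfield, here the image of the constants in \<open>S / J\<close>.
\<close>

definition hilbert_function :: "('x::finite, 'k::field) mpoly set \<Rightarrow> int \<Rightarrow> nat" where
  "hilbert_function J e = ring.dim (polyring Quot J)
     (range (\<lambda>c. J +>\<^bsub>polyring\<^esub> const_poly c)) (ideal_quot_piece UNIV J e)"

definition homogeneous_hom ::
  "(('x::finite, 'k::field) mpoly, 'm, 'c) module_scheme \<Rightarrow> (int \<Rightarrow> 'm set) \<Rightarrow>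
   (('x, 'k) mpoly, 'n, 'd) module_scheme \<Rightarrow> (int \<Rightarrow> 'n set) \<Rightarrow> int \<Rightarrow> ('m \<Rightarrow> 'n) set"
where
  "homogeneous_hom M GM N GN e = {f \<in> mod_hom polyring M N. \<forall>j. f ` GM j \<subseteq> GN (j + e)}"


section \<open>Ext\<close>

definition graded_free_module ::
  "(('x::finite, 'k::field) mpoly, 'f, 'c) module_scheme \<Rightarrow> (int \<Rightarrow> 'f set) \<Rightarrow> bool"
where
  "graded_free_module F G \<longleftrightarrow> graded_module F G \<and>
     (\<exists>(n :: nat) b (deg :: nat \<Rightarrow> int). (\<forall>j<n. b j \<in> G (deg j)) \<and>
        (\<forall>x \<in> carrier F. \<exists>!s. s \<in> {..<n} \<rightarrow>\<^sub>E carrier polyring \<and>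
           x = finsum F (\<lambda>j. s j \<odot>\<^bsub>F\<^esub> b j) {..<n}))"

text \<open>
  A graded resolution \<open>\<dots> \<rightarrow> F 2 \<rightarrow> F 1 \<rightarrow> F 0 \<rightarrow> M \<rightarrow> 0\<close> by graded free modules of finite rank, with maps
  \<open>d i : F (i + 1) \<rightarrow> F i\<close> and \<open>\<epsilon> : F 0 \<rightarrow> M\<close> of degree zero.
\<close>

definition graded_free_resolution ::
  "(('x::finite, 'k::field) mpoly, 'm, 'c) module_scheme \<Rightarrow> (int \<Rightarrow> 'm set) \<Rightarrow>
   (nat \<Rightarrow> (('x, 'k) mpoly, 'f) module) \<Rightarrow> (nat \<Rightarrow> int \<Rightarrow> 'f set) \<Rightarrow>
   (nat \<Rightarrow> 'f \<Rightarrow> 'f) \<Rightarrow> ('f \<Rightarrow> 'm) \<Rightarrow> bool"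
where
  "graded_free_resolution M GM F GF d \<epsilon> \<longleftrightarrow>
     (\<forall>i. graded_free_module (F i) (GF i)) \<and>
     \<epsilon> \<in> homogeneous_hom (F 0) (GF 0) M GM 0 \<and>
     (\<forall>i. d i \<in> homogeneous_hom (F (Suc i)) (GF (Suc i)) (F i) (GF i) 0) \<and>
     \<epsilon> ` carrier (F 0) = carrier M \<and>
     d 0 ` carrier (F 1) = {x \<in> carrier (F 0). \<epsilon> x = \<zero>\<^bsub>M\<^esub>} \<and>
     (\<forall>i. d (Suc i) ` carrier (F (Suc (Suc i))) =
            {x \<in> carrier (F (Suc i)). d i x = \<zero>\<^bsub>F i\<^esub>})"

definition cocycles ::
  "('r, 'c) ring_scheme \<Rightarrow> (nat \<Rightarrow> ('r, 'f) module) \<Rightarrow> (nat \<Rightarrow> 'f \<Rightarrow> 'f) \<Rightarrow>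
   ('r, 'n, 'd) module_scheme \<Rightarrow> nat \<Rightarrow> ('f \<Rightarrow> 'n) set"
where
  "cocycles R F d N i = {f \<in> carrier (Hom_module R (F i) N).
     \<forall>x \<in> carrier (F (Suc i)). f (d i x) = \<zero>\<^bsub>N\<^esub>}"

fun coboundaries ::
  "('r, 'c) ring_scheme \<Rightarrow> (nat \<Rightarrow> ('r, 'f) module) \<Rightarrow> (nat \<Rightarrow> 'f \<Rightarrow> 'f) \<Rightarrow>
   ('r, 'n, 'd) module_scheme \<Rightarrow> nat \<Rightarrow> ('f \<Rightarrow> 'n) set"
where
  "coboundaries R F d N 0 = {\<zero>\<^bsub>Hom_module R (F 0) N\<^esub>}"
| "coboundaries R F d N (Suc i) =
     (\<lambda>g. \<lambda>x\<in>carrier (F (Suc i)). g (d i x)) ` carrier (Hom_module R (F i) N)"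

text \<open>
  The module \<open>Ext\<^sup>i(M, N)\<close>, computed from a resolution of \<open>M\<close>, and its part of degree \<open>e\<close>: the
  classes of the cocycles that are homogeneous of degree \<open>e\<close>.
\<close>

definition Ext_module ::
  "('r, 'c) ring_scheme \<Rightarrow> (nat \<Rightarrow> ('r, 'f) module) \<Rightarrow> (nat \<Rightarrow> 'f \<Rightarrow> 'f) \<Rightarrow>
   ('r, 'n, 'd) module_scheme \<Rightarrow> nat \<Rightarrow> ('r, ('f \<Rightarrow> 'n) set) module"
where
  "Ext_module R F d N i =
     quot_module ((Hom_module R (F i) N)\<lparr>carrier := cocycles R F d N i\<rparr>) (coboundaries R F d N i)"

definition Ext_piece ::
  "(nat \<Rightarrow> (('x::finite, 'k::field) mpoly, 'f) module) \<Rightarrow> (nat \<Rightarrow> int \<Rightarrow> 'f set) \<Rightarrow>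
   (nat \<Rightarrow> 'f \<Rightarrow> 'f) \<Rightarrow> (('x, 'k) mpoly, 'n, 'd) module_scheme \<Rightarrow> (int \<Rightarrow> 'n set) \<Rightarrow>
   nat \<Rightarrow> int \<Rightarrow> ('f \<Rightarrow> 'n) set set"
where
  "Ext_piece F GF d N GN i =
     quot_grading ((Hom_module polyring (F i) N)\<lparr>carrier := cocycles polyring F d N i\<rparr>)
       (coboundaries polyring F d N i)
       (\<lambda>e. cocycles polyring F d N i \<inter> homogeneous_hom (F i) (GF i) N GN e)"

end

theory Submission
  imports Defs
begin

text \<open>
  Let \<open>J\<close> be the saturation of \<open>I\<close> and \<open>R = S / J\<close>.  As \<open>R\<close> has positive depth and an eventually constant Hilbert
  function, there is a homogeneous nonzerodivisor \<open>f\<close> on \<open>R\<close> of some degree \<open>t > 0\<close>, which may be chosen to kill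
  \<open>J / I\<close>; then \<open>R / f R\<close> has finite length and top degree \<open>a + t\<close>.  The connecting map for
  multiplication by \<open>f\<close> on \<open>R\<close> identifies \<open>Ext\<^sup>1(J / I, R)\<close> in degree \<open>0\<close> with \<open>Hom(J / I, R / f R)\<close> in
  degree \<open>t\<close>.  Since \<open>R\<close> is Gorenstein, the socle of \<open>R / f R\<close> is one-dimensional, and a linear functional \<open>\<tau>\<close> that
  is nonzero on it makes \<open>R / f R\<close> self-dual.  Composition with \<open>\<tau>\<close> therefore turns these homomorphisms, which all kill
  \<open>J\<^sup>2\<close>, into arbitrary functionals on the piece of degree \<open>a\<close> of \<open>J / (I + J\<^sup>2)\<close>.
\<close>

section \<open>Ideals and homogeneous components\<close>

text \<open>Over a finite field no linear form need be regular on \<open>S / J\<close>, so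
  \<open>f\<close> is found without associated primes: an element with minimal annihilator is
  constructed, and counting dimensions against the constant value of the Hilbert function, together
  with saturation, makes it regular. The top degree is \<open>a + t\<close> because
  \<open>S / (J + (f))\<close> has dimension \<open>H(b + t) - H(b)\<close> in degree
  \<open>b + t\<close>: zero for \<open>b > a\<close>, and nonzero for \<open>b = a\<close>, the
  last jump of \<open>H\<close>. The Gorenstein hypothesis provides injective resolutions of
  localizations, while Ext is computed from a free resolution of \<open>J / I\<close>; the two are
  never compared. The injective side serves only to bound the socle. There a homomorphism from
  \<open>S / b\<close> is an element killed by \<open>b\<close>, so exact sequences of Ext become
  corrections of elements. The free side evaluates the connecting map directly: \<open>f y\<close>
  lifts to \<open>F 1\<close> for every \<open>y\<close> in \<open>F 0\<close>, and a cocycle is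
  applied to the lift. The degrees match because a map of degree \<open>t\<close> from
  \<open>J / I\<close> followed by a functional living in degree \<open>a + t\<close> is a
  functional living in degree \<open>a\<close>.\<close>

definition is_ideal :: "'r::comm_ring_1 set \<Rightarrow> bool" where
  "is_ideal A \<longleftrightarrow> 0 \<in> A \<and> (\<forall>x\<in>A. \<forall>y\<in>A. x + y \<in> A) \<and> (\<forall>r. \<forall>x\<in>A. r * x \<in> A)"

lemma is_idealI:
  assumes "0 \<in> A" "\<And>x y. x \<in> A \<Longrightarrow> y \<in> A \<Longrightarrow> x + y \<in> A" "\<And>r x. x \<in> A \<Longrightarrow> r * x \<in> A"
  shows "is_ideal A"
  using assms by (auto simp: is_ideal_def)

lemma is_ideal_0: "is_ideal A \<Longrightarrow> 0 \<in> A"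
  by (simp add: is_ideal_def)

lemma is_ideal_add: "is_ideal A \<Longrightarrow> x \<in> A \<Longrightarrow> y \<in> A \<Longrightarrow> x + y \<in> A"
  by (simp add: is_ideal_def)

lemma is_ideal_mult: "is_ideal A \<Longrightarrow> x \<in> A \<Longrightarrow> r * x \<in> A"
  by (simp add: is_ideal_def)

lemma is_ideal_mult2: "is_ideal A \<Longrightarrow> x \<in> A \<Longrightarrow> x * r \<in> A"
  by (simp add: is_ideal_def mult.commute)

lemma is_ideal_minus: "is_ideal A \<Longrightarrow> x \<in> A \<Longrightarrow> - x \<in> A"
  using is_ideal_mult[of A x "-1"] by simp

lemma is_ideal_diff: "is_ideal A \<Longrightarrow> x \<in> A \<Longrightarrow> y \<in> A \<Longrightarrow> x - y \<in> A"
  using is_ideal_add[of A x "-y"] is_ideal_minus[of A y] by simp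

lemma is_ideal_sum: "is_ideal A \<Longrightarrow> (\<And>i. i \<in> Y \<Longrightarrow> g i \<in> A) \<Longrightarrow> sum g Y \<in> A"
  by (induction Y rule: infinite_finite_induct) (auto simp: is_ideal_0 is_ideal_add)

lemma is_ideal_diff_cancel: "is_ideal A \<Longrightarrow> x - y \<in> A \<Longrightarrow> y \<in> A \<Longrightarrow> x \<in> A"
  using is_ideal_add[of A "x - y" y] by simp

lemma is_ideal_diff_sym: "is_ideal A \<Longrightarrow> x - y \<in> A \<Longrightarrow> y - x \<in> A"
  using is_ideal_minus[of A "x - y"] by simp

lemma is_ideal_colon: "is_ideal A \<Longrightarrow> is_ideal {r. r * s \<in> A}"
  by (rule is_idealI) (auto simp: is_ideal_0 distrib_right is_ideal_add mult.assoc is_ideal_mult)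

definition adjoin :: "'r::comm_ring_1 set \<Rightarrow> 'r \<Rightarrow> 'r set" where
  "adjoin A s = {x + r * s | x r. x \<in> A}"

lemma adjoin_ideal: "is_ideal A \<Longrightarrow> is_ideal (adjoin A s)"
proof (rule is_idealI)
  assume A: "is_ideal A"
  show "0 \<in> adjoin A s"
    unfolding adjoin_def using is_ideal_0[OF A] by (intro CollectI exI[of _ 0]) auto
  fix x y r assume "x \<in> adjoin A s"
  then obtain u p where u: "u \<in> A" "x = u + p * s" by (auto simp: adjoin_def)
  have "r * x = r * u + (r * p) * s" using u by (simp add: algebra_simps)
  then show "r * x \<in> adjoin A s" using is_ideal_mult[OF A u(1)] unfolding adjoin_def by blast
  assume "y \<in> adjoin A s"
  then obtain v q where v: "v \<in> A" "y = v + q * s" by (auto simp: adjoin_def)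
  have "x + y = (u + v) + (p + q) * s" using u v by (simp add: algebra_simps)
  then show "x + y \<in> adjoin A s" using is_ideal_add[OF A u(1) v(1)] unfolding adjoin_def by blast
qed

lemma adjoin_base: "x \<in> A \<Longrightarrow> x \<in> adjoin A s"
  unfolding adjoin_def by (intro CollectI exI[of _ x] exI[of _ 0]) auto

lemma adjoin_gen: "is_ideal A \<Longrightarrow> r * s \<in> adjoin A s"
  unfolding adjoin_def using is_ideal_0[of A] by (intro CollectI exI[of _ 0] exI[of _ r]) auto

lemma adjoin_gen1: "is_ideal A \<Longrightarrow> s \<in> adjoin A s"
  using adjoin_gen[of A 1 s] by simp

section \<open>Ideals of the ring carried by a type class\<close>

lemma carrier_rta [simp]: "carrier ring_of_type_algebra = UNIV"
  and mult_rta [simp]: "monoid.mult ring_of_type_algebra = (*)"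
  and add_rta [simp]: "add ring_of_type_algebra = (+)"
  and zero_rta [simp]: "ring.zero ring_of_type_algebra = 0"
  and one_rta [simp]: "one ring_of_type_algebra = 1"
  by (auto simp: ring_of_type_algebra_def fun_eq_iff)

lemma cring_rta: "cring (ring_of_type_algebra :: 'r::comm_ring_1 ring)"
  by (rule cring_from_type_algebra)

lemma a_inv_rta [simp]: "a_inv (ring_of_type_algebra :: 'r::comm_ring_1 ring) x = - x"
proof -
  interpret cring "ring_of_type_algebra :: 'r ring" by (rule cring_rta)
  show ?thesis by (rule minus_equality) auto
qed

text \<open>Through this equivalence ideals can be handled with plain \<open>+\<close> and
  \<open>*\<close> on polynomials, and results about records are imported only where needed.\<close>

lemma ideal_rta_iff: "ideal A (ring_of_type_algebra :: 'r::comm_ring_1 ring) \<longleftrightarrow> is_ideal A"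
proof
  assume "ideal A (ring_of_type_algebra :: 'r ring)"
  then interpret ideal A "ring_of_type_algebra :: 'r ring" .
  show "is_ideal A"
    by (rule is_idealI) (use additive_subgroup.a_closed[OF is_additive_subgroup] I_l_closed additive_subgroup.zero_closed[OF is_additive_subgroup] in auto)
next
  assume A: "is_ideal A"
  interpret cring "ring_of_type_algebra :: 'r ring" by (rule cring_rta)
  show "ideal A (ring_of_type_algebra :: 'r ring)"
  proof (rule idealI)
    show "subgroup A (add_monoid (ring_of_type_algebra :: 'r ring))"
    proof (rule add.subgroupI)
      fix a assume "a \<in> A"
      then show "\<ominus>\<^bsub>ring_of_type_algebra\<^esub> a \<in> A" using is_ideal_minus[OF A] by simp
    qed (use A in \<open>auto simp: is_ideal_add dest: is_ideal_0\<close>)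
  qed (use A in \<open>auto simp: ring_axioms is_ideal_mult is_ideal_mult2\<close>)
qed

lemma genideal_rta:
  fixes A :: "'r::comm_ring_1 set"
  shows "is_ideal (genideal ring_of_type_algebra A)" "A \<subseteq> genideal ring_of_type_algebra A"
    "is_ideal B \<Longrightarrow> A \<subseteq> B \<Longrightarrow> genideal ring_of_type_algebra A \<subseteq> B"
proof -
  interpret cring "ring_of_type_algebra :: 'r ring" by (rule cring_rta)
  show "is_ideal (genideal ring_of_type_algebra A)" 
    using genideal_ideal[of A] by (simp add: ideal_rta_iff)
  show "A \<subseteq> genideal ring_of_type_algebra A" using genideal_self[of A] by simp
  show "is_ideal B \<Longrightarrow> A \<subseteq> B \<Longrightarrow> genideal ring_of_type_algebra A \<subseteq> B"
    using genideal_minimal[of B A] by (simp add: ideal_rta_iff)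
qed

lemma adjoin_iff: "x \<in> adjoin A s \<longleftrightarrow> (\<exists>r. x - r * s \<in> A)"
proof
  assume "\<exists>r. x - r * s \<in> A"
  then obtain r where r: "x - r * s \<in> A" by blast
  have "x = (x - r * s) + r * s" by simp
  then show "x \<in> adjoin A s" unfolding adjoin_def using r by blast
next
  assume "x \<in> adjoin A s"
  then obtain p r where "x = p + r * s" "p \<in> A" by (auto simp: adjoin_def)
  then have "x - r * s \<in> A" by simp
  then show "\<exists>r. x - r * s \<in> A" by blast
qed

section \<open>Monomials and homogeneous components\<close>

definition mdeg :: "('x::finite \<Rightarrow>\<^sub>0 nat) \<Rightarrow> nat" where
  "mdeg m = (\<Sum>x\<in>UNIV. Poly_Mapping.lookup m x)"

lemma mdeg_add: "mdeg (m + n) = mdeg m + mdeg n"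
  by (simp add: mdeg_def lookup_add sum.distrib)

lemma mdeg_single [simp]: "mdeg (Poly_Mapping.single x n) = n"
  by (simp add: mdeg_def lookup_single when_def)

lemma mdeg_0 [simp]: "mdeg 0 = 0"
  by (simp add: mdeg_def)

lemma mdeg_eq_0_iff: "mdeg m = 0 \<longleftrightarrow> m = 0"
  by (simp add: mdeg_def poly_mapping_eq_iff fun_eq_iff)

lemma poly_piece_iff: "p \<in> poly_piece e \<longleftrightarrow> (\<forall>m\<in>Poly_Mapping.keys p. int (mdeg m) = e)"
  by (simp add: poly_piece_def mdeg_def)

lemma finite_mdeg_le: "finite {m :: 'x::finite \<Rightarrow>\<^sub>0 nat. mdeg m \<le> N}"
proof -
  have "Poly_Mapping.lookup m x \<le> N" if "mdeg m \<le> N" for m :: "'x \<Rightarrow>\<^sub>0 nat" and x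
    using member_le_sum[of x UNIV "Poly_Mapping.lookup m"] that by (simp add: mdeg_def)
  then have "Poly_Mapping.lookup ` {m :: 'x \<Rightarrow>\<^sub>0 nat. mdeg m \<le> N} \<subseteq> (UNIV :: 'x set) \<rightarrow>\<^sub>E {..N}"
    by auto
  then have "finite (Poly_Mapping.lookup ` {m :: 'x \<Rightarrow>\<^sub>0 nat. mdeg m \<le> N})"
    by (rule finite_subset) (auto intro: finite_PiE)
  then show ?thesis
    by (rule finite_imageD) (auto intro!: inj_onI poly_mapping_eqI)
qed

abbreviation mon :: "('x \<Rightarrow>\<^sub>0 nat) \<Rightarrow> ('x::finite, 'k::field) mpoly" where
  "mon m \<equiv> Poly_Mapping.single m 1"

lemma mon_add: "mon (m + n) = (mon m * mon n :: ('x::finite, 'k::field) mpoly)"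
  by (simp add: mult_single)

lemma const_mult_mon: "const_poly c * mon m = Poly_Mapping.single m c"
  by (simp add: mult_single)

lemma mpoly_expand:
  fixes p :: "('x::finite, 'k::field) mpoly"
  assumes "finite D" "Poly_Mapping.keys p \<subseteq> D"
  shows "p = (\<Sum>m\<in>D. const_poly (Poly_Mapping.lookup p m) * mon m)"
proof (rule poly_mapping_eqI)
  fix m
  have "Poly_Mapping.lookup (\<Sum>m\<in>D. const_poly (Poly_Mapping.lookup p m) * mon m) m =
    (\<Sum>n\<in>D. if n = m then Poly_Mapping.lookup p n else 0)"
    by (simp add: lookup_sum const_mult_mon lookup_single when_def eq_commute)
  also have "\<dots> = Poly_Mapping.lookup p m"
    using assms by (auto simp: in_keys_iff)
  finally show "Poly_Mapping.lookup p m =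
    Poly_Mapping.lookup (\<Sum>m\<in>D. const_poly (Poly_Mapping.lookup p m) * mon m) m" by simp
qed

lemma const_poly_add: "const_poly (c + c') = (const_poly c + const_poly c' :: ('x::finite,'k::field) mpoly)"
  by (simp add: single_add)

lemma const_poly_mult: "const_poly (c * c') = (const_poly c * const_poly c' :: ('x::finite,'k::field) mpoly)"
  by (simp add: mult_single)

lemma lookup_const_mult [simp]: "Poly_Mapping.lookup (const_poly c * p) m = c * Poly_Mapping.lookup p m"
  for p :: "('x::finite, 'k::field) mpoly"
  by (simp add: mult_map_scale_conv_mult[symmetric] Poly_Mapping.map.rep_eq when_def)

definition hcomp :: "int \<Rightarrow> ('x::finite, 'k::field) mpoly \<Rightarrow> ('x, 'k) mpoly" where
  "hcomp e p = (\<Sum>m\<in>{m \<in> Poly_Mapping.keys p. int (mdeg m) = e}. Poly_Mapping.single m (Poly_Mapping.lookup p m))"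

lemma lookup_hcomp: "Poly_Mapping.lookup (hcomp e p) m = (if int (mdeg m) = e then Poly_Mapping.lookup p m else 0)"
proof -
  have "Poly_Mapping.lookup (hcomp e p) m =
    (\<Sum>n\<in>{m \<in> Poly_Mapping.keys p. int (mdeg m) = e}. if n = m then Poly_Mapping.lookup p n else 0)"
    by (simp add: hcomp_def lookup_sum lookup_single when_def eq_commute)
  then show ?thesis by (auto simp: in_keys_iff)
qed

lemma hcomp_in_piece: "hcomp e p \<in> poly_piece e"
  by (auto simp: poly_piece_iff in_keys_iff lookup_hcomp split: if_splits)

lemma hcomp_add: "hcomp e (p + q) = hcomp e p + hcomp e q"
  by (rule poly_mapping_eqI) (simp add: lookup_hcomp lookup_add)

lemma hcomp_diff: "hcomp e (p - q) = hcomp e p - hcomp e q"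
  by (rule poly_mapping_eqI) (simp add: lookup_hcomp lookup_minus)

lemma hcomp_0 [simp]: "hcomp e 0 = 0"
  by (rule poly_mapping_eqI) (simp add: lookup_hcomp)

lemma hcomp_sum: "hcomp e (sum g Y) = (\<Sum>x\<in>Y. hcomp e (g x))"
  by (induction Y rule: infinite_finite_induct) (auto simp: hcomp_add)

lemma hcomp_const: "hcomp e (const_poly c * p) = const_poly c * hcomp e p"
  by (rule poly_mapping_eqI) (simp add: lookup_hcomp)

lemma hcomp_piece: "p \<in> poly_piece e \<Longrightarrow> hcomp e' p = (if e' = e then p else 0)"
  by (rule poly_mapping_eqI) (auto simp: lookup_hcomp poly_piece_iff in_keys_iff)

lemma poly_piece_iff_hcomp: "p \<in> poly_piece e \<longleftrightarrow> hcomp e p = p"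
  using hcomp_in_piece hcomp_piece by metis

lemma poly_piece_0 [simp]: "0 \<in> poly_piece e"
  by (simp add: poly_piece_iff)

lemma poly_piece_add: "p \<in> poly_piece e \<Longrightarrow> q \<in> poly_piece e \<Longrightarrow> p + q \<in> poly_piece e"
  by (simp add: poly_piece_iff_hcomp hcomp_add)

lemma poly_piece_diff: "p \<in> poly_piece e \<Longrightarrow> q \<in> poly_piece e \<Longrightarrow> p - q \<in> poly_piece e"
  by (simp add: poly_piece_iff_hcomp hcomp_diff)

lemma poly_piece_sum: "(\<And>i. i \<in> Y \<Longrightarrow> g i \<in> poly_piece e) \<Longrightarrow> sum g Y \<in> poly_piece e"
  by (induction Y rule: infinite_finite_induct) (auto simp: poly_piece_add)

lemma poly_piece_const: "p \<in> poly_piece e \<Longrightarrow> const_poly c * p \<in> poly_piece e"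
  by (simp add: poly_piece_iff_hcomp hcomp_const)

lemma poly_piece_mult: "p \<in> poly_piece d \<Longrightarrow> q \<in> poly_piece e \<Longrightarrow> p * q \<in> poly_piece (d + e)"
  unfolding poly_piece_iff using keys_mult[of p q] by (fastforce simp: mdeg_add)

lemma mon_piece: "mon m \<in> poly_piece (int (mdeg m))"
  by (simp add: poly_piece_iff)

lemma one_piece: "1 \<in> poly_piece 0"
  by (simp add: poly_piece_iff)

lemma poly_piece_power: "p \<in> poly_piece d \<Longrightarrow> p ^ n \<in> poly_piece (int n * d)"
  by (induction n) (auto simp: one_piece algebra_simps dest: poly_piece_mult[of p d])

lemma hcomp_neg: "e < 0 \<Longrightarrow> hcomp e p = 0"
  by (rule poly_mapping_eqI) (auto simp: lookup_hcomp)

lemma poly_piece_neg: "p \<in> poly_piece e \<Longrightarrow> e < 0 \<Longrightarrow> p = 0"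
  by (metis hcomp_neg poly_piece_iff_hcomp)

definition degs :: "('x::finite, 'k::field) mpoly \<Rightarrow> int set" where
  "degs p = (\<lambda>m. int (mdeg m)) ` Poly_Mapping.keys p"

lemma finite_degs [simp]: "finite (degs p)"
  by (simp add: degs_def)

lemma hcomp_decomp: "finite D \<Longrightarrow> degs p \<subseteq> D \<Longrightarrow> p = (\<Sum>e\<in>D. hcomp e p)"
proof (rule poly_mapping_eqI)
  fix m assume D: "finite D" "degs p \<subseteq> D"
  have "Poly_Mapping.lookup (\<Sum>e\<in>D. hcomp e p) m = (\<Sum>e\<in>D. if e = int (mdeg m) then Poly_Mapping.lookup p m else 0)"
    by (simp add: lookup_sum lookup_hcomp eq_commute)
  then show "Poly_Mapping.lookup p m = Poly_Mapping.lookup (\<Sum>e\<in>D. hcomp e p) m"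
    using D by (auto simp: degs_def in_keys_iff image_subset_iff)
qed

lemma hcomp_mult_piece: "q \<in> poly_piece c \<Longrightarrow> hcomp e (q * p) = q * hcomp (e - c) p"
proof -
  assume q: "q \<in> poly_piece c"
  \<comment> \<open>The degree \<open>e - c\<close> is adjoined so that the sum below collapses to
    that index even if \<open>p\<close> has no component there.\<close>
  let ?D = "insert (e - c) (degs p)"
  have "q * p = (\<Sum>i\<in>?D. q * hcomp i p)"
    using arg_cong[OF hcomp_decomp[of ?D p], of "\<lambda>u. q * u"] by (simp add: sum_distrib_left subset_insertI)
  then have "hcomp e (q * p) = (\<Sum>i\<in>?D. hcomp e (q * hcomp i p))"
    by (simp only: hcomp_sum)
  also have "\<dots> = (\<Sum>i\<in>?D. if i = e - c then q * hcomp i p else 0)"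
    by (rule sum.cong) (auto simp: hcomp_piece[OF poly_piece_mult[OF q hcomp_in_piece]])
  finally show ?thesis by simp
qed

definition hideal :: "('x::finite, 'k::field) mpoly set \<Rightarrow> bool" where
  "hideal A \<longleftrightarrow> is_ideal A \<and> (\<forall>p\<in>A. \<forall>e. hcomp e p \<in> A)"

lemma hideal_ideal: "hideal A \<Longrightarrow> is_ideal A" by (simp add: hideal_def)
lemma hideal_hcomp: "hideal A \<Longrightarrow> p \<in> A \<Longrightarrow> hcomp e p \<in> A" by (simp add: hideal_def)

lemma hideal_iff: "hideal A \<Longrightarrow> p \<in> A \<longleftrightarrow> (\<forall>e. hcomp e p \<in> A)"
  by (metis finite_degs hcomp_decomp hideal_def is_ideal_sum subset_refl)

text \<open>The polynomials all of whose components lie in the ideal form an ideal themselves, and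
  this ideal contains the homogeneous generators.\<close>

lemma hideal_if_generated:
  fixes A :: "('x::finite, 'k::field) mpoly set"
  assumes "A \<subseteq> (\<Union>e. poly_piece e)"
  shows "hideal (genideal polyring A)"
proof -
  let ?I = "genideal polyring A"
  note I = genideal_rta(1)[of A]
  let ?B = "{p. \<forall>e. hcomp e p \<in> ?I}"
  have "is_ideal ?B"
  proof (rule is_idealI)
    fix r x :: "('x, 'k) mpoly" assume x: "x \<in> ?B"
    have "r * x = (\<Sum>i\<in>degs r. hcomp i r * x)"
      using arg_cong[OF hcomp_decomp[of "degs r" r], of "\<lambda>u. u * x"] by (simp add: sum_distrib_right)
    then have "hcomp e (r * x) = (\<Sum>i\<in>degs r. hcomp i r * hcomp (e - i) x)" for e
      by (simp only: hcomp_sum hcomp_mult_piece[OF hcomp_in_piece])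
    then show "r * x \<in> ?B" using x by (auto intro!: is_ideal_sum[OF I] is_ideal_mult[OF I])
  next
    show "0 \<in> ?B" using is_ideal_0[OF I] by simp
    show "x + y \<in> ?B" if "x \<in> ?B" "y \<in> ?B" for x y
      using that is_ideal_add[OF I] by (simp add: hcomp_add)
  qed
  moreover have "A \<subseteq> ?B"
  proof clarify
    fix x e assume x: "x \<in> A"
    then obtain d where "x \<in> poly_piece d" using assms by auto
    then have "hcomp e x = x \<or> hcomp e x = 0" by (simp add: hcomp_piece)
    then show "hcomp e x \<in> ?I" using x genideal_rta(2)[of A] is_ideal_0[OF I] by auto
  qed
  ultimately have "?I \<subseteq> ?B" by (rule genideal_rta(3))
  then show ?thesis using I by (auto simp: hideal_def)
qed

lemma homogeneous_ideal_hideal: "homogeneous_ideal I \<Longrightarrow> hideal I"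
  using hideal_if_generated by (auto simp: homogeneous_ideal_def)

section \<open>Powers of the irrelevant ideal and saturation\<close>

definition high :: "nat \<Rightarrow> ('x::finite, 'k::field) mpoly set" where
  "high i = {p. \<forall>m\<in>Poly_Mapping.keys p. i \<le> mdeg m}"

lemma high_ideal: "is_ideal (high i)"
proof (rule is_idealI)
  fix r x :: "('x::finite, 'k::field) mpoly" assume x: "x \<in> high i"
  show "r * x \<in> high i"
    unfolding high_def
  proof clarify
    fix m assume "m \<in> Poly_Mapping.keys (r * x)"
    then obtain a b where "m = a + b" "b \<in> Poly_Mapping.keys x" using keys_mult[of r x] by auto
    then show "i \<le> mdeg m" using x by (auto simp: high_def mdeg_add intro: trans_le_add2)
  qed
next
  fix x y :: "('x::finite, 'k::field) mpoly" assume "x \<in> high i" "y \<in> high i"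
  then show "x + y \<in> high i"
    using Poly_Mapping.keys_add[of x y] by (auto simp: high_def)
qed (simp add: high_def)

lemma high_min:
  fixes A :: "('x::finite, 'k::field) mpoly set"
  assumes "is_ideal A" "\<And>m. mdeg m \<ge> i \<Longrightarrow> mon m \<in> A"
  shows "high i \<subseteq> A"
proof
  fix p :: "('x, 'k) mpoly" assume p: "p \<in> high i"
  then show "p \<in> A"
    using mpoly_expand[OF finite_keys order_refl, of p]
    by (metis (no_types, lifting) assms high_def is_ideal_mult is_ideal_sum mem_Collect_eq)
qed

lemma high_mult_mem:
  fixes A :: "('x::finite, 'k::field) mpoly set"
  assumes "is_ideal A" "\<And>m. i \<le> mdeg m \<Longrightarrow> mon m * s \<in> A" "q \<in> high i"
  shows "q * s \<in> A"
  using high_min[OF is_ideal_colon[OF assms(1), of s], of i] assms(2,3) by blast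

lemma high_mon: "mon m \<in> high i \<longleftrightarrow> i \<le> mdeg m"
  by (simp add: high_def)

lemma high_subset_if_pieces:
  fixes A :: "('x::finite, 'k::field) mpoly set"
  assumes "is_ideal A" "\<And>e. e > w \<Longrightarrow> poly_piece e \<subseteq> A"
  shows "high (nat (w + 1)) \<subseteq> A"
proof (rule high_min[OF assms(1)])
  fix m :: "'x \<Rightarrow>\<^sub>0 nat" assume "nat (w + 1) \<le> mdeg m"
  then have "w < int (mdeg m)" by (simp add: nat_le_iff)
  then show "mon m \<in> A" using assms(2) mon_piece by blast
qed

text \<open>Multiplication by a positive degree leads from degree \<open>w\<close> into degrees
  where everything lies in \<open>A\<close>.\<close>

lemma top_piece_socle:
  fixes A :: "('x::finite, 'k::field) mpoly set"
  assumes "is_ideal A" "\<And>e. e > w \<Longrightarrow> poly_piece e \<subseteq> A" "p \<in> poly_piece w" "q \<in> high 1"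
  shows "q * p \<in> A"
proof (rule high_mult_mem[OF assms(1) _ assms(4)])
  fix m :: "'x \<Rightarrow>\<^sub>0 nat" assume "1 \<le> mdeg m"
  then show "mon m * p \<in> A"
    using assms(2)[of "int (mdeg m) + w"] poly_piece_mult[OF mon_piece assms(3), of m] by auto
qed

lemma high_1: "high 1 = {p. Poly_Mapping.lookup p 0 = 0}"
proof -
  have "p \<in> high 1 \<longleftrightarrow> Poly_Mapping.lookup p 0 = 0" for p :: "('x::finite, 'k::field) mpoly"
  proof
    assume "p \<in> high 1"
    then have "0 \<notin> Poly_Mapping.keys p" by (force simp: high_def)
    then show "Poly_Mapping.lookup p 0 = 0" by (simp add: in_keys_iff)
  next
    assume *: "Poly_Mapping.lookup p 0 = 0"
    have "1 \<le> mdeg m" if "m \<in> Poly_Mapping.keys p" for m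
    proof -
      have "m \<noteq> 0" using * that by (metis in_keys_iff)
      then show ?thesis using mdeg_eq_0_iff[of m] by linarith
    qed
    then show "p \<in> high 1" by (simp add: high_def)
  qed
  then show ?thesis by auto
qed

lemma irrelevant_ideal_eq: "irrelevant_ideal = high 1"
proof
  show "irrelevant_ideal \<subseteq> (high 1 :: ('x::finite, 'k::field) mpoly set)"
    unfolding irrelevant_ideal_def
    by (rule genideal_rta(3)[OF high_ideal]) (fastforce simp: high_def poly_piece_iff)
  show "(high 1 :: ('x::finite, 'k::field) mpoly set) \<subseteq> irrelevant_ideal"
    unfolding irrelevant_ideal_def
    by (rule high_min[OF genideal_rta(1)], rule subsetD[OF genideal_rta(2)])
       (use mon_piece in force)
qed

lemma mono_split:
  assumes "mdeg m > 0"
  obtains x n where "m = Poly_Mapping.single x 1 + n" "mdeg m = Suc (mdeg n)"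
proof -
  have "\<exists>x. Poly_Mapping.lookup m x \<noteq> 0"
    using assms unfolding mdeg_def by (metis less_irrefl sum.neutral)
  then obtain x where x: "Poly_Mapping.lookup m x \<noteq> 0" by blast
  define n where "n = m - Poly_Mapping.single x 1"
  have m: "m = Poly_Mapping.single x 1 + n"
    unfolding n_def using x
    by (intro poly_mapping_eqI) (auto simp: lookup_add lookup_minus lookup_single when_def)
  then show ?thesis using that[OF m] by (simp add: mdeg_add)
qed

text \<open>Identifies \<open>high i\<close> with \<open>(S_+)^i\<close>. The nontrivial inclusion
  peels one variable off each monomial, \<open>high i\<close> being spanned by its
  monomials.\<close>

lemma irrelevant_power:
  "irrelevant_ideal [^]\<^bsub>ideals_set polyring\<^esub> i = (high i :: ('x::finite, 'k::field) mpoly set)"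
proof (induction i)
  case 0
  show ?case by (simp add: nat_pow_def ideals_set_def high_def)
next
  case (Suc i)
  have "irrelevant_ideal [^]\<^bsub>ideals_set polyring\<^esub> Suc i =
    (high i \<cdot>\<^bsub>polyring\<^esub> high 1 :: ('x, 'k) mpoly set)"
    using Suc by (simp add: nat_pow_def irrelevant_ideal_eq) (simp add: ideals_set_def)
  also have "\<dots> = high (Suc i)"
  proof
    show "high i \<cdot>\<^bsub>polyring\<^esub> high 1 \<subseteq> (high (Suc i) :: ('x, 'k) mpoly set)"
    proof
      fix p :: "('x, 'k) mpoly" assume "p \<in> high i \<cdot>\<^bsub>polyring\<^esub> high 1"
      then show "p \<in> high (Suc i)"
      proof induction
        case (prod a b)
        then show ?case
          using keys_mult[of a b] by (fastforce simp: high_def mdeg_add)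
      next
        case (sum a b)
        then show ?case using is_ideal_add[OF high_ideal] by simp
      qed
    qed
    have "is_ideal (high i \<cdot>\<^bsub>polyring\<^esub> high 1 :: ('x, 'k) mpoly set)"
      using ring.ideal_prod_is_ideal[OF cring.axioms(1)[OF cring_rta], of "high i" "high 1 :: ('x, 'k) mpoly set"]
      by (simp add: ideal_rta_iff high_ideal)
    then show "(high (Suc i) :: ('x, 'k) mpoly set) \<subseteq> high i \<cdot>\<^bsub>polyring\<^esub> high 1"
    proof (rule high_min)
      fix m :: "'x \<Rightarrow>\<^sub>0 nat" assume m: "Suc i \<le> mdeg m"
      then obtain x n where n: "m = Poly_Mapping.single x 1 + n" "mdeg m = Suc (mdeg n)"
        using mono_split[of m] by auto
      have "(mon n * mon (Poly_Mapping.single x 1) :: ('x, 'k) mpoly) \<in> high i \<cdot>\<^bsub>polyring\<^esub> high 1"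
        using ideal_prod.prod[of "mon n :: ('x, 'k) mpoly" "high i" "mon (Poly_Mapping.single x 1)" "high 1" polyring]
          m n by (simp add: high_mon)
      then show "(mon m :: ('x, 'k) mpoly) \<in> high i \<cdot>\<^bsub>polyring\<^esub> high 1"
        by (simp add: n(1) mon_add mult.commute)
    qed
  qed
  finally show ?case .
qed

text \<open>Only monomials have to be tested, because they generate the powers of the irrelevant
  ideal.\<close>

lemma saturation_iff:
  fixes I :: "('x::finite, 'k::field) mpoly set"
  assumes "is_ideal I"
  shows "x \<in> saturation I \<longleftrightarrow> (\<exists>N. \<forall>m. N \<le> mdeg m \<longrightarrow> mon m * x \<in> I)"
proof -
  have "(\<forall>y\<in>high i. x * y \<in> I) \<longleftrightarrow> (\<forall>m. i \<le> mdeg m \<longrightarrow> mon m * x \<in> I)" for i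
    using high_mult_mem[OF assms, of i x] by (auto simp: high_mon mult.commute)
  then show ?thesis
    by (auto simp: saturation_def colon_ideal_def irrelevant_power)
qed

lemma saturation_hideal:
  assumes "hideal I"
  shows "hideal (saturation I)"
proof -
  note I = hideal_ideal[OF assms]
  show ?thesis
    unfolding hideal_def
  proof (intro conjI ballI allI is_idealI)
    fix r x y assume "x \<in> saturation I"
    then obtain N where N: "\<And>m. N \<le> mdeg m \<Longrightarrow> mon m * x \<in> I"
      using saturation_iff[OF I] by auto
    have "mon m * (r * x) \<in> I" if "N \<le> mdeg m" for m
      using is_ideal_mult[OF I N[OF that], of r] by (simp add: mult.left_commute)
    then show "r * x \<in> saturation I" using saturation_iff[OF I] by blast
    have "mon m * hcomp e x \<in> I" if "N \<le> mdeg m" for m e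
      using hideal_hcomp[OF assms N[OF that], of "e + int (mdeg m)"]
      by (simp add: hcomp_mult_piece[OF mon_piece])
    then show "hcomp e x \<in> saturation I" for e using saturation_iff[OF I] by blast
    assume "y \<in> saturation I"
    then obtain N' where N': "\<And>m. N' \<le> mdeg m \<Longrightarrow> mon m * y \<in> I"
      using saturation_iff[OF I] by auto
    have "mon m * (x + y) \<in> I" if "max N N' \<le> mdeg m" for m
      using is_ideal_add[OF I N N'] that by (simp add: distrib_left)
    then show "x + y \<in> saturation I" using saturation_iff[OF I] by blast
  qed (simp add: saturation_iff[OF I] is_ideal_0[OF I])
qed

lemma saturation_subset: "is_ideal I \<Longrightarrow> I \<subseteq> saturation I"
  using saturation_iff by (auto intro: is_ideal_mult)

text \<open>Positive depth in terms of elements: no nonzero class of \<open>S / J\<close> is killed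
  by a power of the irrelevant ideal.\<close>

definition saturated :: "('x::finite, 'k::field) mpoly set \<Rightarrow> bool" where
  "saturated J \<longleftrightarrow> (\<forall>x N. (\<forall>m. N \<le> mdeg m \<longrightarrow> mon m * x \<in> J) \<longrightarrow> x \<in> J)"

text \<open>Each of the finitely many monomials of degree \<open>N\<close> moves \<open>x\<close> to
  an element needing some exponent \<open>L n\<close>. With \<open>B\<close> bounding these
  exponents, a monomial of degree at least \<open>N + B\<close> splits off one of degree
  \<open>N\<close>, and the cofactor is large enough for it.\<close>

lemma saturation_saturated:
  fixes I :: "('x::finite, 'k::field) mpoly set"
  assumes "is_ideal I"
  shows "saturated (saturation I)"
  unfolding saturated_def
proof (intro allI impI)
  fix x :: "('x, 'k) mpoly" and N
  assume *: "\<forall>m. N \<le> mdeg m \<longrightarrow> mon m * x \<in> saturation I"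
  let ?F = "{m :: 'x \<Rightarrow>\<^sub>0 nat. mdeg m \<le> N}"
  have "\<forall>n. \<exists>L. N \<le> mdeg n \<longrightarrow> (\<forall>m. L \<le> mdeg m \<longrightarrow> mon m * (mon n * x) \<in> I)"
    using * saturation_iff[OF assms] by blast
  then obtain L where L: "\<And>n m. N \<le> mdeg n \<Longrightarrow> L n \<le> mdeg m \<Longrightarrow> mon m * (mon n * x) \<in> I"
    by metis
  define B where "B = Max (L ` ?F)"
  have split: "\<exists>n k. m = n + k \<and> mdeg n = i" if "i \<le> mdeg m" for m :: "'x \<Rightarrow>\<^sub>0 nat" and i
    using that
  proof (induction i)
    case (Suc i)
    then obtain n k where nk: "m = n + k" "mdeg n = i" by force
    then have "mdeg k > 0" using Suc.prems by (auto simp: mdeg_add)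
    then obtain y l where l: "k = Poly_Mapping.single y 1 + l" using mono_split by blast
    have "m = (n + Poly_Mapping.single y 1) + l" "mdeg (n + Poly_Mapping.single y 1) = Suc i"
      using nk l by (auto simp: mdeg_add add.assoc)
    then show ?case by blast
  qed (rule exI[of _ 0], auto)
  have "mon m * x \<in> I" if m: "N + B \<le> mdeg m" for m
  proof -
    obtain n k where nk: "m = n + k" "mdeg n = N" using split[of N m] m by auto
    have "L n \<le> B" unfolding B_def using nk(2) by (intro Max_ge) (auto intro: finite_mdeg_le)
    then have "L n \<le> mdeg k" using nk m by (auto simp: mdeg_add)
    then have "mon k * (mon n * x) \<in> I" using L nk(2) by simp
    then show ?thesis by (simp add: nk(1) mon_add mult_ac)
  qed
  then show "x \<in> saturation I" using saturation_iff[OF assms] by blast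
qed

section \<open>Relative dimension and the Hilbert function\<close>

locale relative_dimension = vector_space scale for scale :: "'a::field \<Rightarrow> 'b::ab_group_add \<Rightarrow> 'b"
begin

definition line :: "'b set \<Rightarrow> 'b \<Rightarrow> 'b set" where
  "line V v = {x + scale c v | x c. x \<in> V}"

text \<open>The dimension of \<open>V / U\<close>, expressed by a flag from \<open>U\<close> to
  \<open>V\<close> with one-dimensional steps, so that no quotient space is formed. The flag has the
  shape of the rules that generate \<open>dimension\<close> for rings, which makes the comparison
  with \<open>ring.dim\<close> an induction.\<close>

inductive reldim :: "nat \<Rightarrow> 'b set \<Rightarrow> 'b set \<Rightarrow> bool" where
  reldim_0: "reldim 0 U U"
| reldim_Suc: "reldim n U V \<Longrightarrow> v \<notin> V \<Longrightarrow> reldim (Suc n) U (line V v)"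

lemma line_base: "x \<in> V \<Longrightarrow> x \<in> line V v"
  unfolding line_def by (intro CollectI exI[of _ x] exI[of _ 0]) simp

lemma line_gen: "subspace V \<Longrightarrow> scale c v \<in> line V v"
  unfolding line_def by (intro CollectI exI[of _ 0] exI[of _ c]) (simp add: subspace_0)

lemma line_gen1: "subspace V \<Longrightarrow> v \<in> line V v"
  using line_gen[of V 1 v] by simp

lemma line_subspace: "subspace V \<Longrightarrow> subspace (line V v)"
proof (rule subspaceI)
  assume V: "subspace V"
  show "0 \<in> line V v" by (rule line_base) (rule subspace_0[OF V])
  fix x y c assume "x \<in> line V v"
  then obtain x' a where x: "x = x' + scale a v" "x' \<in> V" by (auto simp: line_def)
  have "scale c x = scale c x' + scale (c * a) v" by (simp add: x scale_right_distrib)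
  then show "scale c x \<in> line V v"
    unfolding line_def using subspace_scale[OF V x(2)] by blast
  assume "y \<in> line V v"
  then obtain y' b where y: "y = y' + scale b v" "y' \<in> V" by (auto simp: line_def)
  have "x + y = (x' + y') + scale (a + b) v" by (simp add: x y scale_left_distrib algebra_simps)
  then show "x + y \<in> line V v"
    unfolding line_def using subspace_add[OF V x(2) y(2)] by blast
qed

lemma line_min: "subspace W \<Longrightarrow> V \<subseteq> W \<Longrightarrow> v \<in> W \<Longrightarrow> line V v \<subseteq> W"
  by (auto simp: line_def intro!: subspace_add subspace_scale)

lemma line_exchange:
  assumes V: "subspace V" and x: "x \<in> line V v" "x \<notin> V"
  shows "v \<in> line V x"
proof -
  obtain w c where w: "x = w + scale c v" "w \<in> V" using x by (auto simp: line_def)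
  have c: "c \<noteq> 0" using w x by auto
  have "scale (inverse c) x = scale (inverse c) w + v"
    using c by (simp add: w(1) scale_right_distrib)
  then have "v = scale (- inverse c) w + scale (inverse c) x" by simp
  then show ?thesis unfolding line_def using subspace_scale[OF V w(2)] by blast
qed

lemma line_commute: "line (line V v) x = line (line V x) v"
  unfolding line_def by (auto simp: algebra_simps) (metis add.assoc add.commute)+

lemma reldim_subspace: "reldim n U V \<Longrightarrow> subspace U \<Longrightarrow> subspace V \<and> U \<subseteq> V"
  by (induction rule: reldim.induct) (auto simp: line_subspace intro: line_base)

lemma reldim_trans: "reldim n V W \<Longrightarrow> reldim m U V \<Longrightarrow> reldim (m + n) U W"
  by (induction rule: reldim.induct) (auto intro: reldim.intros)

text \<open>The flag stays strict after adding \<open>x\<close> throughout: by exchange,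
  \<open>v\<close> in \<open>line V x\<close> would put \<open>x\<close> into
  \<open>line V v\<close>, which lies inside the top of the flag.\<close>

lemma reldim_shift:
  "reldim n A B \<Longrightarrow> x \<notin> B \<Longrightarrow> subspace A \<Longrightarrow> reldim n (line A x) (line B x)"
proof (induction rule: reldim.induct)
  case (reldim_Suc n U V v)
  have V: "subspace V" using reldim_subspace reldim_Suc by blast
  have "x \<notin> V" using reldim_Suc.prems(1) line_base by blast
  then have "reldim n (line U x) (line V x)" using reldim_Suc by blast
  moreover have "v \<notin> line V x" using line_exchange[OF V, of v x] reldim_Suc by blast
  ultimately show ?case by (metis line_commute reldim.reldim_Suc)
qed (rule reldim_0)

text \<open>Additivity of dimension. The flag is intersected with \<open>X'\<close>: its last step
  belongs to the upper part if \<open>X'\<close> lies in the last but one space. Otherwise it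
  belongs to the lower part, with some \<open>x\<close> in \<open>X'\<close> in place of
  \<open>v\<close>, and the upper flag is shifted by \<open>x\<close>.\<close>

lemma reldim_split:
  "reldim n U V \<Longrightarrow> subspace U \<Longrightarrow> subspace X' \<Longrightarrow> U \<subseteq> X' \<Longrightarrow> X' \<subseteq> V \<Longrightarrow>
    \<exists>m\<le>n. reldim m U X' \<and> reldim (n - m) X' V"
proof (induction arbitrary: X' rule: reldim.induct)
  case (reldim_0 U)
  then have "X' = U" by blast
  then show ?case using reldim.reldim_0 by auto
next
  case (reldim_Suc n U V v X')
  have V: "subspace V" "U \<subseteq> V" using reldim_subspace reldim_Suc by blast+
  have "\<exists>m\<le>n. reldim m U (X' \<inter> V) \<and> reldim (n - m) (X' \<inter> V) V"
    using reldim_Suc V by (intro reldim_Suc.IH) (auto intro: subspace_inter)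
  then obtain m where m: "m \<le> n" "reldim m U (X' \<inter> V)" "reldim (n - m) (X' \<inter> V) V" by blast
  show ?case
  proof (cases "X' \<subseteq> V")
    case True
    then have "X' \<inter> V = X'" by blast
    then have "reldim m U X' \<and> reldim (Suc (n - m)) X' (line V v)"
      using m reldim.reldim_Suc[OF m(3) reldim_Suc.hyps(2)] by simp
    then show ?thesis using m(1) by (metis Suc_diff_le le_SucI)
  next
    case False
    then obtain x where x: "x \<in> X'" "x \<notin> V" by blast
    have vx: "v \<in> line V x" using line_exchange[OF V(1), of x v] x reldim_Suc by blast
    have eq1: "line V v = line V x"
    proof
      show "line V v \<subseteq> line V x"
        by (rule line_min) (auto simp: line_subspace V vx line_base)
      show "line V x \<subseteq> line V v"
        using x reldim_Suc by (intro line_min) (auto simp: line_subspace V line_base)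
    qed
    have "X' = line (X' \<inter> V) x"
    proof
      show "line (X' \<inter> V) x \<subseteq> X'" using x reldim_Suc by (intro line_min) auto
      show "X' \<subseteq> line (X' \<inter> V) x"
      proof
        fix y assume y: "y \<in> X'"
        then have "y \<in> line V x" using reldim_Suc eq1 by blast
        then obtain w c where w: "y = w + scale c x" "w \<in> V" by (auto simp: line_def)
        then have "w = y - scale c x" by simp
        then have "w \<in> X'" using reldim_Suc.prems(2) x(1) y by (simp add: subspace_diff subspace_scale)
        then show "y \<in> line (X' \<inter> V) x" using w by (auto simp: line_def)
      qed
    qed
    then have "reldim (Suc m) U X'" "reldim (n - m) X' (line V v)"
      using m reldim.reldim_Suc[OF m(2), of x] reldim_shift[OF m(3) x(2)] x eq1 V reldim_Suc.prems
      by (auto simp: subspace_inter)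
    then show ?thesis using m(1) by (metis Suc_le_mono diff_Suc_Suc)
  qed
qed

text \<open>The hypotheses say that \<open>f\<close> induces an injective map from
  \<open>V / U\<close> into a quotient by \<open>U'\<close>, and the flag is carried along.\<close>

lemma reldim_image:
  assumes f_add: "\<And>x y. f (x + y) = f x + f y" and f_scale: "\<And>c x. f (scale c x) = scale c (f x)"
  shows "reldim n U V \<Longrightarrow> subspace U \<Longrightarrow> subspace U' \<Longrightarrow> f ` U \<subseteq> U' \<Longrightarrow> (\<And>v. v \<in> V \<Longrightarrow> f v \<in> U' \<Longrightarrow> v \<in> U)
    \<Longrightarrow> reldim n U' {u + f v | u v. u \<in> U' \<and> v \<in> V}"
proof -
  have f_0: "f 0 = 0" using f_scale[of 0 0] by simp
  have f_diff: "f (x - y) = f x - f y" for x y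
    using f_add[of "x - y" y] by (simp add: algebra_simps)
  show "reldim n U V \<Longrightarrow> subspace U \<Longrightarrow> subspace U' \<Longrightarrow> f ` U \<subseteq> U' \<Longrightarrow>
    (\<And>v. v \<in> V \<Longrightarrow> f v \<in> U' \<Longrightarrow> v \<in> U) \<Longrightarrow>
    reldim n U' {u + f v | u v. u \<in> U' \<and> v \<in> V}"
proof (induction rule: reldim.induct)
  case (reldim_0 U)
  have "{u + f v | u v. u \<in> U' \<and> v \<in> U} = U'"
  proof
    show "{u + f v | u v. u \<in> U' \<and> v \<in> U} \<subseteq> U'" using reldim_0 by (auto intro!: subspace_add)
    show "U' \<subseteq> {u + f v | u v. u \<in> U' \<and> v \<in> U}"
    proof
      fix u assume "u \<in> U'"
      then show "u \<in> {u + f v | u v. u \<in> U' \<and> v \<in> U}"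
        using subspace_0[OF reldim_0(1)] f_0 by (intro CollectI exI[of _ u] exI[of _ 0]) auto
    qed
  qed
  then show ?case using reldim.reldim_0 by metis
next
  case (reldim_Suc n U V v)
  let ?W = "{u + f v | u v. u \<in> U' \<and> v \<in> V}"
  have V: "subspace V" "U \<subseteq> V" using reldim_subspace reldim_Suc by blast+
  have "reldim n U' ?W" using reldim_Suc.prems line_base[of _ V v] by (intro reldim_Suc.IH) auto
  moreover have "f v \<notin> ?W"
  proof
    assume "f v \<in> ?W"
    then obtain u w where u: "f v = u + f w" "u \<in> U'" "w \<in> V" by auto
    then have "f (v - w) \<in> U'" by (simp add: f_diff)
    moreover have "v - w \<in> line V v"
      using V u line_gen1[of V v] line_base[of w V v] line_subspace[of V v] subspace_diff by blast
    ultimately have "v - w \<in> V" using reldim_Suc.prems V by blast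
    then have "v \<in> V" using u(3) V(1) by (metis diff_add_cancel subspace_add)
    then show False using reldim_Suc by blast
  qed
  ultimately have "reldim (Suc n) U' (line ?W (f v))" by (rule reldim.reldim_Suc)
  moreover have "line ?W (f v) = {u + f w | u w. u \<in> U' \<and> w \<in> line V v}"
  proof (intro Set.set_eqI iffI)
    fix y assume "y \<in> line ?W (f v)"
    then obtain u w c where "y = (u + f w) + scale c (f v)" "u \<in> U'" "w \<in> V" by (auto simp: line_def)
    then have "y = u + f (w + scale c v)" "w + scale c v \<in> line V v"
      by (auto simp: f_add f_scale add.assoc line_def)
    then show "y \<in> {u + f w | u w. u \<in> U' \<and> w \<in> line V v}" using \<open>u \<in> U'\<close> by blast
  next
    fix y assume "y \<in> {u + f w | u w. u \<in> U' \<and> w \<in> line V v}"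
    then obtain u w c where "y = u + f (w + scale c v)" "u \<in> U'" "w \<in> V" by (auto simp: line_def)
    then have "y = (u + f w) + scale c (f v)" "u + f w \<in> ?W"
      by (auto simp: f_add f_scale add.assoc)
    then show "y \<in> line ?W (f v)" unfolding line_def[of ?W] by blast
  qed
  ultimately show ?case by simp
qed
qed

lemma reldim_trivial: "reldim n U V \<Longrightarrow> subspace U \<Longrightarrow> V \<subseteq> U \<Longrightarrow> n = 0"
proof (induction rule: reldim.induct)
  case (reldim_Suc n U V v)
  have V: "subspace V" "U \<subseteq> V" using reldim_subspace reldim_Suc by blast+
  then show ?case using line_gen1[of V v] reldim_Suc by blast
qed simp

lemma reldim_0_eq: "reldim 0 U V \<Longrightarrow> V = U"
  by (erule reldim.cases) auto

lemma reldim_line: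
  assumes "reldim k V (line V v)" "v \<notin> V" "subspace V"
  shows "k = 1"
  using assms(1)
proof (cases rule: reldim.cases)
  case reldim_0
  then show ?thesis using assms line_gen1 by blast
next
  case (reldim_Suc k' W w)
  have W: "subspace W" "V \<subseteq> W" using reldim_subspace reldim_Suc assms by blast+
  have "W \<subseteq> V"
  proof
    fix x assume x: "x \<in> W"
    show "x \<in> V"
    proof (rule ccontr)
      assume "x \<notin> V"
      moreover have "x \<in> line V v" using x reldim_Suc line_base by auto
      ultimately have "v \<in> line V x" using line_exchange assms by blast
      then have "v \<in> W" using line_min[of W V x] W x by blast
      then have "line V v \<subseteq> W" using line_min W by blast
      then show False using reldim_Suc line_gen1[of W w] W by blast
    qed
  qed
  then have "k' = 0" using reldim_trivial[of k' V W] reldim_Suc assms by blast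
  then show ?thesis using reldim_Suc by simp
qed

text \<open>The second flag is split at the last but one space of the first, and a single line has
  length one.\<close>

lemma reldim_unique: "reldim n U V \<Longrightarrow> subspace U \<Longrightarrow> reldim m U V \<Longrightarrow> n = m"
proof (induction arbitrary: m rule: reldim.induct)
  case (reldim_0 U)
  then show ?case using reldim_trivial by blast
next
  case (reldim_Suc n U V v)
  have V: "subspace V" "U \<subseteq> V" using reldim_subspace reldim_Suc by blast+
  have "V \<subseteq> line V v" using line_base by blast
  then obtain j where j: "j \<le> m" "reldim j U V" "reldim (m - j) V (line V v)"
    using reldim_split[OF reldim_Suc.prems(2,1) V] by blast
  then show ?case using reldim_Suc reldim_line[OF j(3) _ V(1)] by auto
qed

lemma reldim_span: "finite B \<Longrightarrow> \<exists>n. reldim n {0} (span B)"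
proof (induction rule: finite_induct)
  case empty
  then show ?case using reldim_0 by auto
next
  case (insert b B)
  have "span (insert b B) = line (span B) b"
    unfolding line_def span_insert by (auto simp: algebra_simps) (metis add_diff_cancel_left' diff_add_cancel)+
  moreover have "span (insert b B) = span B" if "b \<in> span B" using that by (simp add: span_redundant)
  ultimately show ?case using insert.IH reldim_Suc[of _ "{0}" "span B" b] by metis
qed

end

section \<open>The Hilbert function as a relative dimension\<close>

definition pscale :: "'k::field \<Rightarrow> ('x::finite, 'k) mpoly \<Rightarrow> ('x, 'k) mpoly" where
  "pscale c p = const_poly c * p"

interpretation pvs: relative_dimension "pscale :: 'k::field \<Rightarrow> ('x::finite, 'k) mpoly \<Rightarrow> ('x, 'k) mpoly"
  by unfold_locales (auto simp: pscale_def algebra_simps const_poly_add const_poly_mult)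

lemma ideal_pvs_subspace: "is_ideal A \<Longrightarrow> pvs.subspace A"
  by (auto simp: pvs.subspace_def pscale_def is_ideal_def)

lemma piece_pvs_subspace: "pvs.subspace (poly_piece e)"
  by (auto simp: pvs.subspace_def pscale_def poly_piece_add poly_piece_const)

lemma piece_reldim: "\<exists>n. pvs.reldim n {0} (poly_piece e :: ('x::finite, 'k::field) mpoly set)"
proof -
  let ?B = "{mon m :: ('x::finite, 'k::field) mpoly | m. mdeg m \<le> nat e}"
  have "finite ?B" using finite_mdeg_le[where 'x='x, of "nat e"] by simp
  then obtain n where n: "pvs.reldim n {0} (pvs.span ?B)" using pvs.reldim_span by blast
  have "poly_piece e \<subseteq> pvs.span ?B"
  proof
    fix p :: "('x, 'k) mpoly" assume p: "p \<in> poly_piece e"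
    have "pscale (Poly_Mapping.lookup p m) (mon m) \<in> pvs.span ?B" if "m \<in> Poly_Mapping.keys p" for m
      using that p by (intro pvs.span_scale pvs.span_base) (auto simp: poly_piece_iff intro!: exI[of _ m])
    then have "(\<Sum>m\<in>Poly_Mapping.keys p. pscale (Poly_Mapping.lookup p m) (mon m)) \<in> pvs.span ?B"
      by (rule pvs.span_sum)
    then show "p \<in> pvs.span ?B"
      using mpoly_expand[OF finite_keys order_refl, of p] by (simp add: pscale_def)
  qed
  then show ?thesis
    using pvs.reldim_split[OF n _ piece_pvs_subspace] by (auto simp: pvs.subspace_def)
qed

lemma hf_reldim_exists:
  fixes J :: "('x::finite, 'k::field) mpoly set"
  assumes "is_ideal J"
  shows "\<exists>n. pvs.reldim n (J \<inter> poly_piece e) (poly_piece e)"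
proof -
  obtain n where "pvs.reldim n {0} (poly_piece e :: ('x, 'k) mpoly set)" using piece_reldim by blast
  moreover have "pvs.subspace (J \<inter> poly_piece e)"
    using assms by (intro pvs.subspace_inter ideal_pvs_subspace piece_pvs_subspace)
  ultimately show ?thesis
    using pvs.reldim_split[of n "{0}" "poly_piece e" "J \<inter> poly_piece e"] is_ideal_0[OF assms]
      pvs.subspace_single_0 by auto
qed

text \<open>The set underlying a coset, freed from any record, so that the same rules serve the
  quotient ring and all quotient modules.\<close>

definition cs :: "'r::comm_ring_1 set \<Rightarrow> 'r \<Rightarrow> 'r set" where
  "cs I x = (\<lambda>i. i + x) ` I"

lemma a_r_coset_cs: "add M = (+) \<Longrightarrow> a_r_coset M I x = cs I x"
  by (auto simp: a_r_coset_def r_coset_def cs_def)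

lemma cs_eq_iff: "is_ideal I \<Longrightarrow> cs I x = cs I y \<longleftrightarrow> x - y \<in> I"
proof
  assume I: "is_ideal I"
  { assume "cs I x = cs I y"
    moreover have "x \<in> cs I x" using is_ideal_0[OF I] by (force simp: cs_def)
    ultimately obtain i where "x = i + y" "i \<in> I" by (auto simp: cs_def)
    then show "x - y \<in> I" by simp }
  assume xy: "x - y \<in> I"
  have *: "cs I x \<subseteq> cs I y" if "x - y \<in> I" for x y
  proof
    fix z assume "z \<in> cs I x"
    then obtain i where i: "z = i + x" "i \<in> I" by (auto simp: cs_def)
    then have "z = (i + (x - y)) + y" by simp
    then show "z \<in> cs I y" unfolding cs_def using is_ideal_add[OF I i(2) that] by blast
  qed
  show "cs I x = cs I y" using *[OF xy] *[OF is_ideal_diff_sym[OF I xy]] by blast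
qed

lemma cs_self: "is_ideal I \<Longrightarrow> x \<in> cs I x"
  using is_ideal_0[of I] by (force simp: cs_def)

lemma cs_mem: "y \<in> cs I x \<longleftrightarrow> y - x \<in> I"
  by (force simp: cs_def)

lemma cs_0: "cs I 0 = I"
  by (simp add: cs_def)

lemma cs_set_add:
  assumes "is_ideal I" "add M = (+)"
  shows "set_add M (cs I x) (cs I y) = cs I (x + y)"
proof -
  have "set_add M (cs I x) (cs I y) = (\<Union>a\<in>cs I x. \<Union>b\<in>cs I y. {a + b})"
    using assms(2) by (auto simp: set_add_def set_mult_def)
  also have "\<dots> = cs I (x + y)"
  proof (intro Set.set_eqI iffI)
    fix z assume "z \<in> (\<Union>a\<in>cs I x. \<Union>b\<in>cs I y. {a + b})"
    then obtain a b where "a - x \<in> I" "b - y \<in> I" "z = a + b" by (auto simp: cs_mem)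
    then show "z \<in> cs I (x + y)"
      using is_ideal_add[OF assms(1), of "a - x" "b - y"] by (simp add: cs_mem algebra_simps)
  next
    fix z assume "z \<in> cs I (x + y)"
    then have "z - y \<in> cs I x" by (simp add: cs_mem algebra_simps)
    then show "z \<in> (\<Union>a\<in>cs I x. \<Union>b\<in>cs I y. {a + b})"
      using cs_self[OF assms(1), of y] by force
  qed
  finally show ?thesis .
qed

lemma quot_ring_simps:
  fixes J :: "'r::comm_ring_1 set"
  assumes "is_ideal J"
  shows "carrier (ring_of_type_algebra Quot J) = range (cs J)"
    "ring.zero (ring_of_type_algebra Quot J) = J"
    "one (ring_of_type_algebra Quot J) = cs J 1"
    "monoid.mult (ring_of_type_algebra Quot J) (cs J x) (cs J y) = cs J (x * y)"
    "add (ring_of_type_algebra Quot J) (cs J x) (cs J y) = cs J (x + y)"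
    "a_r_coset ring_of_type_algebra J x = cs J x"
    "cring (ring_of_type_algebra Quot J)"
proof -
  interpret cring "ring_of_type_algebra :: 'r ring" by (rule cring_rta)
  interpret ideal J "ring_of_type_algebra :: 'r ring" using assms by (simp add: ideal_rta_iff)
  have 1: "a_r_coset ring_of_type_algebra J x = cs J x" for x
    by (rule a_r_coset_cs) simp
  then show "a_r_coset ring_of_type_algebra J x = cs J x" .
  show "carrier (ring_of_type_algebra Quot J) = range (cs J)"
    by (auto simp: FactRing_def A_RCOSETS_def' 1)
  show "ring.zero (ring_of_type_algebra Quot J) = J" by (simp add: FactRing_def)
  show "one (ring_of_type_algebra Quot J) = cs J 1" by (simp add: FactRing_def 1)
  show "monoid.mult (ring_of_type_algebra Quot J) (cs J x) (cs J y) = cs J (x * y)"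
    using rcoset_mult_add[of x y] by (simp add: FactRing_def 1)
  show "add (ring_of_type_algebra Quot J) (cs J x) (cs J y) = cs J (x + y)"
    using cs_set_add[OF assms, of ring_of_type_algebra x y] by (simp add: FactRing_def)
  show "cring (ring_of_type_algebra Quot J)" by (rule quotient_is_cring[OF cring_rta])
qed

text \<open>The flag from \<open>J\<close> in degree \<open>e\<close> up to the whole piece maps to
  a flag in \<open>S / J\<close>. It stays strict because \<open>v - w\<close> in \<open>J\<close>
  already lies in the bottom space. Properness of \<open>J\<close> makes the image of the constants
  a subfield.\<close>

lemma hilbert_function_eq:
  fixes J :: "('x::finite, 'k::field) mpoly set"
  assumes J: "is_ideal J" "1 \<notin> J" and n: "pvs.reldim n (J \<inter> poly_piece e) (poly_piece e)"
  shows "hilbert_function J e = n"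
proof -
  note q = quot_ring_simps[OF J(1)]
  let ?Q = "polyring Quot J" and ?K = "range (\<lambda>c. cs J (const_poly c))"
  interpret Q: cring ?Q by (rule q(7))
  have sub: "subfield ?K ?Q"
  proof -
    interpret k: field "ring_of_type_algebra :: 'k ring" by (rule field_from_type_algebra)
    have "ring_hom_ring (ring_of_type_algebra :: 'k ring) ?Q (\<lambda>c. cs J (const_poly c))"
      by (intro ring_hom_ringI2 k.ring_axioms Q.ring_axioms ring_hom_memI)
        (auto simp: q const_poly_add const_poly_mult single_one)
    from ring_hom_ring.img_is_subfield[OF this k.carrier_is_subfield]
    show ?thesis using J by (simp add: q) (metis J(1) cs_0 cs_eq_iff diff_zero)
  qed
  have piece: "ideal_quot_piece UNIV J e = cs J ` poly_piece e"
    unfolding ideal_quot_piece_def quot_grading_def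
    by (simp add: self_module_def a_r_coset_cs)
  have "V \<subseteq> poly_piece e \<Longrightarrow> Q.dimension m ?K (cs J ` V)"
    if "pvs.reldim m U V" "U = J \<inter> poly_piece e" for U V m
    using that
  proof (induction rule: pvs.reldim.induct)
    case (reldim_0 U)
    have "cs J ` U = {J}"
    proof -
      have "cs J x = J" if "x \<in> U" for x
        using that reldim_0 cs_eq_iff[OF J(1), of x 0] by (simp add: cs_0)
      moreover have "0 \<in> U" using reldim_0 is_ideal_0[OF J(1)] by simp
      ultimately show ?thesis by auto
    qed
    then show ?case using Q.zero_dim[of ?K] by (simp add: q)
  next
    case (reldim_Suc n U V v)
    have U: "pvs.subspace U"
      using reldim_Suc ideal_pvs_subspace[OF J(1)] piece_pvs_subspace pvs.subspace_inter by blast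
    have V: "pvs.subspace V" "U \<subseteq> V" using pvs.reldim_subspace[OF reldim_Suc.hyps(1) U] by auto
    have Ve: "V \<subseteq> poly_piece e" "v \<in> poly_piece e"
      using reldim_Suc pvs.line_base pvs.line_gen1[OF V(1)] by blast+
    have "cs J v \<notin> cs J ` V"
    proof
      assume "cs J v \<in> cs J ` V"
      then obtain w where w: "w \<in> V" "v - w \<in> J" using cs_eq_iff[OF J(1)] by auto
      then have "v - w \<in> V" using V reldim_Suc Ve poly_piece_diff[of v e w] by auto
      from pvs.subspace_add[OF V(1) this w(1)] have "v \<in> V" by simp
      then show False using reldim_Suc by blast
    qed
    moreover have "Q.dimension n ?K (cs J ` V)" using reldim_Suc Ve by blast
    ultimately have "Q.dimension (Suc n) ?K (Q.line_extension ?K (cs J v) (cs J ` V))"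
      by (intro Q.Suc_dim) (auto simp: q)
    moreover have "Q.line_extension ?K (cs J v) (cs J ` V) = cs J ` pvs.line V v"
    proof (intro Set.set_eqI iffI)
      fix u assume "u \<in> Q.line_extension ?K (cs J v) (cs J ` V)"
      then obtain c x where "x \<in> V" "u = cs J (const_poly c * v + x)"
        unfolding Q.line_extension_mem_iff by (auto simp: q)
      then show "u \<in> cs J ` pvs.line V v"
        by (auto simp: pvs.line_def pscale_def add.commute)
    next
      fix u assume "u \<in> cs J ` pvs.line V v"
      then obtain c x where "x \<in> V" "u = cs J (x + const_poly c * v)"
        by (auto simp: pvs.line_def pscale_def)
      then have "u = cs J (const_poly c) \<otimes>\<^bsub>?Q\<^esub> cs J v \<oplus>\<^bsub>?Q\<^esub> cs J x"
        by (simp add: q add.commute)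
      then show "u \<in> Q.line_extension ?K (cs J v) (cs J ` V)"
        unfolding Q.line_extension_mem_iff using \<open>x \<in> V\<close> by blast
    qed
    ultimately show ?case by simp
  qed
  from this[OF n refl] have "Q.dimension n ?K (ideal_quot_piece UNIV J e)" by (simp add: piece)
  from Q.dimI[OF sub this] show ?thesis
    by (simp add: hilbert_function_def over_def q)
qed

section \<open>Homogeneous nonzerodivisors\<close>

lemma quot_ideal_image:
  fixes J :: "'r::comm_ring_1 set"
  assumes J: "is_ideal J" and A: "is_ideal A"
  shows "ideal (cs J ` A) (ring_of_type_algebra Quot J)"
proof -
  note q = quot_ring_simps[OF J]
  let ?Q = "ring_of_type_algebra Quot J"
  interpret Q: cring ?Q by (rule q(7))
  show ?thesis
  proof (rule idealI)
    show "subgroup (cs J ` A) (add_monoid ?Q)"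
    proof (rule Q.add.subgroupI)
      fix u assume "u \<in> cs J ` A"
      then obtain x where x: "x \<in> A" "u = cs J x" by auto
      have "\<ominus>\<^bsub>?Q\<^esub> u = cs J (- x)"
        by (rule Q.minus_equality) (auto simp: x q cs_0)
      then show "\<ominus>\<^bsub>?Q\<^esub> u \<in> cs J ` A" using is_ideal_minus[OF A x(1)] by simp
      fix v assume "v \<in> cs J ` A"
      then show "u \<oplus>\<^bsub>?Q\<^esub> v \<in> cs J ` A" using is_ideal_add[OF A x(1)] by (auto simp: x q)
    qed (use is_ideal_0[OF A] in \<open>auto simp: q\<close>)
  qed (use A in \<open>auto simp: q Q.ring_axioms is_ideal_mult is_ideal_mult2\<close>)
qed

text \<open>Zorn's lemma turns the chain condition in \<open>S / J\<close> into maximal elements,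
  and passing to images in \<open>S / J\<close> reflects inclusions between ideals containing
  \<open>J\<close>.\<close>

lemma noetherian_quot_maximal:
  fixes J :: "'r::comm_ring_1 set"
  assumes N: "noetherian_ring (ring_of_type_algebra Quot J)" and J: "is_ideal J"
    and F: "\<F> \<noteq> {}" "\<And>A. A \<in> \<F> \<Longrightarrow> is_ideal A \<and> J \<subseteq> A"
  shows "\<exists>A\<in>\<F>. \<forall>B\<in>\<F>. A \<subseteq> B \<longrightarrow> B = A"
proof -
  note q = quot_ring_simps[OF J]
  let ?Q = "ring_of_type_algebra Quot J"
  interpret Q: cring ?Q by (rule q(7))
  interpret N: noetherian_ring ?Q by (rule N)
  have inj: "A \<subseteq> B" if "cs J ` A \<subseteq> cs J ` B" "is_ideal B" "J \<subseteq> B" for A B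
  proof
    fix x assume "x \<in> A"
    then have "cs J x \<in> cs J ` B" using that(1) by blast
    then obtain y where "cs J x = cs J y" "y \<in> B" by (rule imageE)
    then show "x \<in> B" using cs_eq_iff[OF J, of x y] is_ideal_diff_cancel[OF that(2), of x y] that(3) by auto
  qed
  have "\<exists>M\<in>(`) (cs J) ` \<F>. \<forall>Y\<in>(`) (cs J) ` \<F>. M \<subseteq> Y \<longrightarrow> Y = M"
  proof (rule subset_Zorn_nonempty)
    fix C assume C: "C \<noteq> {}" "subset.chain ((`) (cs J) ` \<F>) C"
    then have "subset.chain {I. ideal I ?Q} C"
      using F(2) quot_ideal_image[OF J] by (force simp: pred_on.chain_def)
    then have "\<Union>C \<in> C" by (rule N.ideal_chain_is_trivial[OF C(1)])
    then show "\<Union>C \<in> (`) (cs J) ` \<F>" using C(2) by (auto simp: pred_on.chain_def)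
  qed (use F in auto)
  then obtain A where A: "A \<in> \<F>" "\<forall>B\<in>\<F>. cs J ` A \<subseteq> cs J ` B \<longrightarrow> cs J ` B = cs J ` A" by auto
  have "B = A" if "B \<in> \<F>" "A \<subseteq> B" for B
  proof
    have "cs J ` B = cs J ` A" using A(2) that by (simp add: image_mono)
    then show "B \<subseteq> A" using inj[of B A] F(2)[OF A(1)] by simp
  qed (rule that(2))
  then show ?thesis using A(1) by blast
qed

lemma is_ideal_power_cong: "is_ideal A \<Longrightarrow> u - v \<in> A \<Longrightarrow> u ^ l - v ^ l \<in> A"
proof (induction l)
  case (Suc l)
  have "u ^ Suc l - v ^ Suc l = u * (u ^ l - v ^ l) + v ^ l * (u - v)" by (simp add: algebra_simps)
  then show ?case using Suc by (metis is_ideal_add is_ideal_mult)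
qed (simp add: is_ideal_0)

section \<open>Annihilators modulo \<open>J\<close>\<close>

definition ann :: "'r::comm_ring_1 set \<Rightarrow> 'r \<Rightarrow> 'r set" where
  "ann J f = {p. f * p \<in> J}"

text \<open>The annihilator of the annihilator. It reverses inclusions and determines
  \<open>ann\<close> by \<open>ann_ann2\<close>, so a maximal \<open>ann2\<close>, which the
  ascending chain condition provides, is a minimal \<open>ann\<close>.\<close>

definition ann2 :: "'r::comm_ring_1 set \<Rightarrow> 'r \<Rightarrow> 'r set" where
  "ann2 J f = {p. \<forall>x\<in>ann J f. p * x \<in> J}"

lemma ann_ideal: "is_ideal J \<Longrightarrow> is_ideal (ann J f)"
  by (rule is_idealI) (auto simp: ann_def is_ideal_0 distrib_left is_ideal_add mult.left_commute is_ideal_mult)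

lemma ann2_ideal: "is_ideal J \<Longrightarrow> is_ideal (ann2 J f)"
  by (rule is_idealI) (auto simp: ann2_def is_ideal_0 distrib_right is_ideal_add mult.assoc is_ideal_mult)

lemma ann_superset: "is_ideal J \<Longrightarrow> J \<subseteq> ann J f"
  by (auto simp: ann_def is_ideal_mult)

lemma ann2_superset: "is_ideal J \<Longrightarrow> J \<subseteq> ann2 J f"
  by (auto simp: ann2_def is_ideal_mult2)

lemma ann_ann2: "ann J f = {p. \<forall>x\<in>ann2 J f. p * x \<in> J}"
  by (auto simp: ann_def ann2_def mult.commute)

lemma decreasing_nat_eventually_constant:
  fixes s :: "nat \<Rightarrow> nat"
  assumes "\<And>l. s (Suc l) \<le> s l"
  shows "\<exists>l0. \<forall>l\<ge>l0. s (Suc l) = s l"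
proof -
  define m where "m = (LEAST n. n \<in> range s)"
  have "m \<in> range s" unfolding m_def by (rule LeastI[of _ "s 0"]) auto
  then obtain l0 where l0: "m = s l0" by auto
  have "s l = m" if "l \<ge> l0" for l
  proof (rule antisym)
    show "s l \<le> m" unfolding l0 using lift_Suc_antimono_le[of s l0 l] assms that by blast
    show "m \<le> s l" unfolding m_def by (rule Least_le) auto
  qed
  then show ?thesis by (metis le_SucI)
qed

text \<open>The number \<open>c\<close> is the eventual value of the Hilbert function and
  \<open>a\<close> the last degree before it is reached for good; \<open>acc\<close> is the
  Noetherian property of \<open>S / J\<close>.\<close>

locale stable_hilbert =
  fixes J :: "('x::finite, 'k::field) mpoly set" and a :: int and c :: nat
  assumes hom: "hideal J" and sat: "saturated J"
    and acc: "\<And>\<F>. \<F> \<noteq> {} \<Longrightarrow> (\<And>A. A \<in> \<F> \<Longrightarrow> is_ideal A \<and> J \<subseteq> A) \<Longrightarrow> \<exists>A\<in>\<F>. \<forall>B\<in>\<F>. A \<subseteq> B \<longrightarrow> B = A"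
    and hf_large: "\<And>b. b > a \<Longrightarrow> pvs.reldim c (J \<inter> poly_piece b) (poly_piece b)"
    and hf_a: "\<not> pvs.reldim c (J \<inter> poly_piece a) (poly_piece a)"
begin

lemmas idl = hideal_ideal[OF hom]

text \<open>Image and kernel of multiplication by \<open>f\<close> from degree \<open>b\<close> to
  degree \<open>b + t\<close> of \<open>S / J\<close>, both taken as preimages in
  \<open>S\<close>.\<close>

definition imgf :: "('x, 'k) mpoly \<Rightarrow> int \<Rightarrow> int \<Rightarrow> ('x, 'k) mpoly set" where
  "imgf f t b = {u + f * v | u v. u \<in> J \<inter> poly_piece (b + t) \<and> v \<in> poly_piece b}"

definition kerf :: "('x, 'k) mpoly \<Rightarrow> int \<Rightarrow> ('x, 'k) mpoly set" where
  "kerf f b = {p \<in> poly_piece b. f * p \<in> J}"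

lemma J_piece_subspace: "pvs.subspace (J \<inter> poly_piece e)"
  by (intro pvs.subspace_inter ideal_pvs_subspace piece_pvs_subspace idl)

lemma kerf_eq: "kerf f b = ann J f \<inter> poly_piece b"
  by (auto simp: kerf_def ann_def)

lemma kerf_subspace: "pvs.subspace (kerf f b)"
  unfolding kerf_eq by (intro pvs.subspace_inter ideal_pvs_subspace ann_ideal piece_pvs_subspace idl)

lemma pscale_mult: "f * pscale r p = pscale r (f * p)"
  by (simp add: pscale_def algebra_simps)

lemma imgf_subset: "f \<in> poly_piece t \<Longrightarrow> imgf f t b \<subseteq> poly_piece (b + t)"
  using poly_piece_mult[of f t _ b] by (auto simp: imgf_def add.commute intro!: poly_piece_add)

lemma rank_nullity:
  assumes "pvs.reldim n (J \<inter> poly_piece b) (poly_piece b)" "f \<in> poly_piece t"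
  obtains k where "k \<le> n" "pvs.reldim k (J \<inter> poly_piece b) (kerf f b)"
    "pvs.reldim (n - k) (J \<inter> poly_piece (b + t)) (imgf f t b)"
proof -
  have "J \<inter> poly_piece b \<subseteq> kerf f b" "kerf f b \<subseteq> poly_piece b"
    using is_ideal_mult[OF idl] by (auto simp: kerf_def)
  from pvs.reldim_split[OF assms(1) J_piece_subspace kerf_subspace this]
  obtain k where k: "k \<le> n" "pvs.reldim k (J \<inter> poly_piece b) (kerf f b)"
    "pvs.reldim (n - k) (kerf f b) (poly_piece b)" by blast
  have "pvs.reldim (n - k) (J \<inter> poly_piece (b + t)) (imgf f t b)"
    unfolding imgf_def
  proof (rule pvs.reldim_image[OF _ _ k(3) kerf_subspace J_piece_subspace])
    show "(*) f ` kerf f b \<subseteq> J \<inter> poly_piece (b + t)"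
      using poly_piece_mult[OF assms(2), of _ b] by (auto simp: kerf_def add.commute)
  qed (auto simp: distrib_left pscale_mult kerf_def)
  with k show ?thesis using that by blast
qed

text \<open>Let \<open>k b\<close> be the dimension of the kernel of \<open>f\<close> in degree
  \<open>b\<close>. Because \<open>f\<close> and its square have the same annihilator, image and
  kernel in degree \<open>b + t\<close> meet only in \<open>J\<close>, so their sum has dimension
  \<open>c - k b + k (b + t)\<close>, at most \<open>c\<close>. Thus \<open>k\<close> does not
  increase along steps of \<open>t\<close>; where it has become constant, the sum is the whole
  piece.\<close>

lemma piece_decomposition:
  assumes f: "f \<in> poly_piece (int t)" "t \<ge> 1" and stable: "\<And>p. f * (f * p) \<in> J \<Longrightarrow> f * p \<in> J"
  shows "\<exists>l0. \<forall>l\<ge>l0. \<forall>p\<in>poly_piece (int (l * t)). \<exists>q\<in>poly_piece (int (l * t)). \<exists>r. f * q \<in> J \<and> p - (q + f * r) \<in> J"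
proof -
  have "\<forall>b. \<exists>k. b > a \<longrightarrow> k \<le> c \<and> pvs.reldim k (J \<inter> poly_piece b) (kerf f b) \<and>
      pvs.reldim (c - k) (J \<inter> poly_piece (b + int t)) (imgf f (int t) b)"
    using rank_nullity[OF hf_large f(1)] by metis
  then obtain k where k: "\<And>b. b > a \<Longrightarrow> k b \<le> c"
    "\<And>b. b > a \<Longrightarrow> pvs.reldim (k b) (J \<inter> poly_piece b) (kerf f b)"
    "\<And>b. b > a \<Longrightarrow> pvs.reldim (c - k b) (J \<inter> poly_piece (b + int t)) (imgf f (int t) b)"
    by metis
  define Z where "Z b = {u + v | u v. u \<in> imgf f (int t) b \<and> v \<in> kerf f (b + int t)}" for b
  have step: "pvs.reldim (c - k b + k (b + int t)) (J \<inter> poly_piece (b + int t)) (Z b)"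
    if b: "b > a" for b
  proof (rule pvs.reldim_trans[OF _ k(3)[OF b]])
    have W: "pvs.subspace (imgf f (int t) b)" "J \<inter> poly_piece (b + int t) \<subseteq> imgf f (int t) b"
      using pvs.reldim_subspace[OF k(3)[OF b] J_piece_subspace] by auto
    have bt: "b + int t > a" using b f(2) by simp
    show "pvs.reldim (k (b + int t)) (imgf f (int t) b) (Z b)"
      unfolding Z_def
    proof (rule pvs.reldim_image[OF _ _ k(2)[OF bt] J_piece_subspace W(1)])
      fix v assume v: "v \<in> kerf f (b + int t)" "v \<in> imgf f (int t) b"
      then obtain u w where u: "v = u + f * w" "u \<in> J" by (auto simp: imgf_def)
      have "f * v - f * u \<in> J"
        using v u is_ideal_mult[OF idl, of u f] is_ideal_diff[OF idl] by (auto simp: kerf_def)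
      then have "f * (f * w) \<in> J" using u by (simp add: distrib_left)
      then have "f * w \<in> J" by (rule stable)
      then show "v \<in> J \<inter> poly_piece (b + int t)"
        using u v is_ideal_add[OF idl u(2)] by (auto simp: kerf_def)
    qed (use W in auto)
  qed
  have Z: "Z b \<subseteq> poly_piece (b + int t)" for b
    using imgf_subset[OF f(1)] by (auto simp: Z_def kerf_def intro!: poly_piece_add)
  have le: "k (b + int t) \<le> k b \<and> (k (b + int t) = k b \<longrightarrow> Z b = poly_piece (b + int t))" if b: "b > a" for b
  proof -
    have bt: "b + int t > a" using b f(2) by simp
    have "pvs.subspace (Z b)" "J \<inter> poly_piece (b + int t) \<subseteq> Z b"
      using pvs.reldim_subspace[OF step[OF b] J_piece_subspace] by auto
    from pvs.reldim_split[OF hf_large[OF bt] J_piece_subspace this Z]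
    obtain m where m: "m \<le> c" "pvs.reldim m (J \<inter> poly_piece (b + int t)) (Z b)"
      "pvs.reldim (c - m) (Z b) (poly_piece (b + int t))" by blast
    have meq: "m = c - k b + k (b + int t)"
      by (rule pvs.reldim_unique[OF m(2) J_piece_subspace step[OF b]])
    moreover have "Z b = poly_piece (b + int t)" if "k (b + int t) = k b"
    proof -
      have "c - m = 0" using meq k(1)[OF b] that by simp
      then show ?thesis using m(3) pvs.reldim_0_eq by metis
    qed
    ultimately show ?thesis using m(1) k(1)[OF b] by auto
  qed
  \<comment> \<open>Beyond \<open>L\<close> steps all multiples of \<open>t\<close> exceed
    \<open>a\<close>, since \<open>t \<ge> 1\<close>; \<open>nat\<close> covers a negative
    \<open>a\<close>.\<close>
  define L where "L = nat a + 1"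
  define s where "s l = k (int ((L + l) * t))" for l
  have big: "int ((L + l) * t) > a" for l
  proof -
    have "L + l \<le> (L + l) * t" using f(2) by simp
    moreover have "int (L + l) > a" unfolding L_def by simp
    ultimately show ?thesis by linarith
  qed
  have eq: "int ((L + Suc l) * t) = int ((L + l) * t) + int t" for l by (simp add: algebra_simps)
  obtain l0 where l0: "\<forall>l\<ge>l0. s (Suc l) = s l"
    using decreasing_nat_eventually_constant[of s] le[OF big] unfolding s_def eq by blast
  show ?thesis
  \<comment> \<open>One more than \<open>L + l0\<close>, because comparing two consecutive degrees
    decomposes the piece of the upper one.\<close>
  proof (intro exI[of _ "Suc (L + l0)"] allI impI ballI)
    fix l and p :: "('x, 'k) mpoly" assume l: "l \<ge> Suc (L + l0)" and p: "p \<in> poly_piece (int (l * t))"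
    define i where "i = l - Suc L"
    have i: "l = L + Suc i" "i \<ge> l0" using l by (auto simp: i_def)
    have "Z (int ((L + i) * t)) = poly_piece (int ((L + Suc i) * t))"
      using le[OF big[of i]] l0 i(2) unfolding s_def eq by auto
    then have "p \<in> Z (int ((L + i) * t))" using p i by simp
    then obtain u v w where u: "p = (u + f * v) + w" "u \<in> J" "w \<in> kerf f (int ((L + i) * t) + int t)"
      by (auto simp: Z_def imgf_def)
    have "p - (w + f * v) = u" using u by simp
    then show "\<exists>q\<in>poly_piece (int (l * t)). \<exists>r. f * q \<in> J \<and> p - (q + f * r) \<in> J"
      using u(2,3) unfolding i(1) eq[of i] by (intro bexI[of _ w] exI[of _ v]) (auto simp: kerf_def)
  qed
qed

lemma stable_power: "\<exists>l\<ge>1. \<forall>p. g ^ l * (g ^ l * p) \<in> J \<longrightarrow> g ^ l * p \<in> J"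
proof -
  obtain A where A: "A \<in> {ann J (g ^ n) | n. n \<ge> 1}" "\<forall>B\<in>{ann J (g ^ n) | n. n \<ge> 1}. A \<subseteq> B \<longrightarrow> B = A"
    using acc[of "{ann J (g ^ n) | n. n \<ge> 1}"] ann_ideal[OF idl] ann_superset[OF idl] by blast
  then obtain l where l: "A = ann J (g ^ l)" "l \<ge> 1" by blast
  have "ann J (g ^ l) \<subseteq> ann J (g ^ (l + l))"
    using is_ideal_mult[OF idl] by (auto simp: ann_def power_add mult.assoc)
  then have "ann J (g ^ (l + l)) = ann J (g ^ l)"
    using A(2) l by (metis (mono_tags, lifting) le_add2 le_trans mem_Collect_eq)
  then show ?thesis using l(2) by (auto simp: ann_def power_add mult.assoc)
qed

text \<open>
  Take \<open>f\<close> with \<open>ann f = ann f\<^sup>2\<close> minimal; chains of double annihilators are stationary.  If some homogeneous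
  \<open>q \<in> ann f\<close> were not nilpotent, a power of \<open>f\<^sup>d + q\<^sup>t\<close> would have a smaller annihilator.  As \<open>S / J\<close> is
  \<open>ann f + (f)\<close> in large degrees, every homogeneous element of positive degree is then nilpotent modulo \<open>f\<close>.
\<close>

lemma exists_parameter:
  "\<exists>f t. t \<ge> 1 \<and> f \<in> poly_piece (int t) \<and>
    (\<forall>h s. s \<ge> 1 \<longrightarrow> h \<in> poly_piece (int s) \<longrightarrow> (\<exists>n. h ^ n \<in> adjoin J f))"
proof -
  define good where "good f t \<longleftrightarrow> t \<ge> 1 \<and> f \<in> poly_piece (int t) \<and> (\<forall>p. f * (f * p) \<in> J \<longrightarrow> f * p \<in> J)"
    for f :: "('x, 'k) mpoly" and t :: nat
  \<comment> \<open>Zero lies in every piece, so the family to be minimised over is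
    nonempty.\<close>
  have "good 0 1" by (simp add: good_def is_ideal_0[OF idl])
  then have "{ann2 J f | f t. good f t} \<noteq> {}" by blast
  then obtain A where A: "A \<in> {ann2 J f | f t. good f t}" "\<forall>B\<in>{ann2 J f | f t. good f t}. A \<subseteq> B \<longrightarrow> B = A"
    using acc[of "{ann2 J f | f t. good f t}"] ann2_ideal[OF idl] ann2_superset[OF idl] by blast
  then obtain f t where ft: "A = ann2 J f" "good f t" by blast
  have max: "ann J g = ann J f" if "good g s" "ann J g \<subseteq> ann J f" for g s
  proof -
    have "ann2 J f \<subseteq> ann2 J g" using that(2) by (auto simp: ann2_def)
    then have "ann2 J g = ann2 J f" using A(2) ft(1) that(1) by blast
    then show ?thesis using ann_ann2[of J g] ann_ann2[of J f] by simp
  qed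
  have t: "t \<ge> 1" "f \<in> poly_piece (int t)" and st: "\<And>p. f * (f * p) \<in> J \<Longrightarrow> f * p \<in> J"
    using ft(2) by (auto simp: good_def)
  have stn: "f * p \<in> J" if "f ^ n * p \<in> J" for n p
    using that
  proof (induction n arbitrary: p)
    case 0
    then show ?case using is_ideal_mult[OF idl] by simp
  next
    case (Suc n)
    then have "f ^ n * (f * p) \<in> J" by (simp add: mult_ac)
    then show ?case using Suc.IH st by blast
  qed
  have nil: "\<exists>n. q ^ n \<in> J" if q: "q \<in> poly_piece (int d)" "d \<ge> 1" "f * q \<in> J" for q d
  proof (rule ccontr)
    assume nn: "\<nexists>n. q ^ n \<in> J"
    \<comment> \<open>Both summands have degree \<open>d * t\<close>. Since \<open>f * q\<close>
      lies in \<open>J\<close>, the mixed products disappear: modulo \<open>J\<close>,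
      \<open>f * g\<close> is \<open>f ^ Suc d\<close> and \<open>q * g\<close> is
      \<open>q ^ Suc t\<close>.\<close>
    define g where "g = f ^ d + q ^ t"
    obtain l where l: "l \<ge> 1" "\<forall>p. g ^ l * (g ^ l * p) \<in> J \<longrightarrow> g ^ l * p \<in> J"
      using stable_power by blast
    have "g \<in> poly_piece (int (d * t))"
      using poly_piece_power[OF t(2), of d] poly_piece_power[OF q(1), of t]
      unfolding g_def by (intro poly_piece_add) (auto simp: mult.commute)
    from poly_piece_power[OF this, of l] have "g ^ l \<in> poly_piece (int (l * (d * t)))" by simp
    then have good: "good (g ^ l) (l * (d * t))"
      unfolding good_def using l t q by simp
    have fq: "f * q ^ i \<in> J" if "i \<ge> 1" for i
      using is_ideal_mult2[OF idl q(3), of "q ^ (i - 1)"] that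
      by (simp add: mult.assoc power_eq_if)
    have qf: "q * f ^ i \<in> J" if "i \<ge> 1" for i
      using is_ideal_mult2[OF idl q(3), of "f ^ (i - 1)"] that
      by (simp add: mult_ac power_eq_if)
    have fg: "(f * g) ^ l - (f ^ Suc d) ^ l \<in> J"
      by (rule is_ideal_power_cong[OF idl]) (use fq[OF t(1)] in \<open>simp add: g_def algebra_simps\<close>)
    have qg: "(q * g) ^ l - (q ^ Suc t) ^ l \<in> J"
      by (rule is_ideal_power_cong[OF idl]) (use qf[OF q(2)] in \<open>simp add: g_def algebra_simps\<close>)
    have "ann J (g ^ l) \<subseteq> ann J f"
    proof
      fix x assume "x \<in> ann J (g ^ l)"
      then have "(f * g) ^ l * x \<in> J"
        using is_ideal_mult[OF idl, of "g ^ l * x" "f ^ l"] by (simp add: ann_def power_mult_distrib mult_ac)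
      then have "(f * g) ^ l * x - ((f * g) ^ l - (f ^ Suc d) ^ l) * x \<in> J"
        using is_ideal_diff[OF idl] is_ideal_mult2[OF idl fg] by blast
      then have "f ^ (Suc d * l) * x \<in> J" by (simp only: power_mult) (simp add: algebra_simps)
      then show "x \<in> ann J f" using stn by (simp add: ann_def)
    qed
    \<comment> \<open>By minimality the two annihilators agree, and \<open>q\<close>, which kills
      \<open>f\<close>, also kills \<open>g ^ l\<close>; this makes a power of \<open>q\<close>
      vanish.\<close>
    from max[OF good this] have "q \<in> ann J (g ^ l)" using q(3) by (simp add: ann_def)
    then have "(q * g) ^ l * q \<in> J"
      using is_ideal_mult[OF idl, of "g ^ l * q" "q ^ l"] by (simp add: ann_def power_mult_distrib mult_ac)
    then have "(q * g) ^ l * q - ((q * g) ^ l - (q ^ Suc t) ^ l) * q \<in> J"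
      using is_ideal_diff[OF idl] is_ideal_mult2[OF idl qg] by blast
    then have "q ^ (Suc t * l) * q \<in> J" by (simp only: power_mult) (simp add: algebra_simps)
    then have "q ^ Suc (Suc t * l) \<in> J" by (simp only: power_Suc2)
    then show False using nn by blast
  qed
  obtain l0 where l0: "\<And>l p. l \<ge> l0 \<Longrightarrow> p \<in> poly_piece (int (l * t)) \<Longrightarrow>
      \<exists>q\<in>poly_piece (int (l * t)). \<exists>r. f * q \<in> J \<and> p - (q + f * r) \<in> J"
    using piece_decomposition[OF t(2,1) st] by blast
  have "\<exists>n. h ^ n \<in> adjoin J f" if s: "s \<ge> 1" and h: "h \<in> poly_piece (int s)" for h s
  proof -
    \<comment> \<open>The power \<open>h ^ (Suc l0 * t)\<close> has degree \<open>?l * t\<close>, a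
      multiple of \<open>t\<close> in the range of the decomposition.\<close>
    let ?l = "Suc l0 * s"
    have "l0 \<le> ?l" using s by (metis Suc_leD le_refl mult.right_neutral mult_le_mono)
    moreover have "h ^ (Suc l0 * t) \<in> poly_piece (int (?l * t))"
      using poly_piece_power[OF h, of "Suc l0 * t"] by (simp add: algebra_simps)
    ultimately obtain q r where q: "q \<in> poly_piece (int (?l * t))" "f * q \<in> J" "h ^ (Suc l0 * t) - (q + f * r) \<in> J"
      using l0 by blast
    obtain n where n: "q ^ n \<in> J" using nil[OF q(1) _ q(2)] s t(1) by (auto simp: Suc_le_eq)
    have A: "is_ideal (adjoin J f)" by (rule adjoin_ideal[OF idl])
    have "h ^ (Suc l0 * t) - (q + f * r) + r * f \<in> adjoin J f"
      using is_ideal_add[OF A adjoin_base[OF q(3)] adjoin_gen[OF idl]] .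
    then have "h ^ (Suc l0 * t) - q \<in> adjoin J f" by (simp add: algebra_simps)
    from is_ideal_power_cong[OF A this, of n]
    have "(h ^ (Suc l0 * t)) ^ n \<in> adjoin J f"
      by (rule is_ideal_diff_cancel[OF A]) (rule adjoin_base[OF n])
    then show ?thesis by (metis power_mult)
  qed
  then show ?thesis using t by blast
qed

lemma power_mon: "(mon (Poly_Mapping.single x 1) :: ('x, 'k) mpoly) ^ n = mon (Poly_Mapping.single x n)"
  by (induction n) (auto simp: mult_single single_one single_add[symmetric])

lemma adjoin_piece:
  assumes "f \<in> poly_piece t" "p \<in> poly_piece (b + t)" "p \<in> adjoin J f"
  shows "p \<in> imgf f t b"
proof -
  obtain j r where p: "p = j + r * f" "j \<in> J" using assms(3) by (auto simp: adjoin_def)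
  have "p = hcomp (b + t) p" using assms(2) by (simp add: poly_piece_iff_hcomp)
  also have "\<dots> = hcomp (b + t) j + f * hcomp b r"
    using hcomp_mult_piece[OF assms(1), of "b + t" r] by (simp add: p hcomp_add mult.commute)
  finally show ?thesis
    unfolding imgf_def using hideal_hcomp[OF hom p(2)] hcomp_in_piece by blast
qed

lemma imgf_adjoin: "imgf f t b \<subseteq> adjoin J f"
  by (auto simp: imgf_def adjoin_def mult.commute)

text \<open>
  Multiplication by a parameter is onto in large degrees, hence injective there because the Hilbert
  function is constant; so its kernel is killed by a power of the irrelevant ideal.
\<close>

lemma exists_nzd: "\<exists>f t. t \<ge> 1 \<and> f \<in> poly_piece (int t) \<and> (\<forall>p. f * p \<in> J \<longrightarrow> p \<in> J)"
proof -
  obtain f t where t: "t \<ge> 1" "f \<in> poly_piece (int t)"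
    and nil: "\<And>h s. s \<ge> 1 \<Longrightarrow> h \<in> poly_piece (int s) \<Longrightarrow> \<exists>n. h ^ n \<in> adjoin J f"
    using exists_parameter by blast
  have A: "is_ideal (adjoin J f)" by (rule adjoin_ideal[OF idl])
  have "\<exists>n. (mon (Poly_Mapping.single x n) :: ('x, 'k) mpoly) \<in> adjoin J f" for x :: 'x
    using nil[of 1 "mon (Poly_Mapping.single x 1)"] mon_piece[of "Poly_Mapping.single x 1"]
    by (simp add: power_mon del: One_nat_def)
  then obtain n where n: "\<And>x :: 'x. (mon (Poly_Mapping.single x (n x)) :: ('x, 'k) mpoly) \<in> adjoin J f" by metis
  \<comment> \<open>Pigeonhole: if every exponent of a monomial were below \<open>n x\<close>, its
    degree would be below the sum of the \<open>n x\<close>.\<close>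
  define N where "N = (\<Sum>x\<in>UNIV. n x)"
  have high: "mon m \<in> adjoin J f" if "N \<le> mdeg m" for m
  proof -
    have "\<exists>x. n x \<le> Poly_Mapping.lookup m x"
    proof (rule ccontr)
      assume "\<nexists>x. n x \<le> Poly_Mapping.lookup m x"
      then have "mdeg m < N"
        unfolding mdeg_def N_def by (intro sum_strict_mono) (auto simp: not_le)
      then show False using that by simp
    qed
    then obtain x where x: "n x \<le> Poly_Mapping.lookup m x" by blast
    have "m = (m - Poly_Mapping.single x (n x)) + Poly_Mapping.single x (n x)"
      using x by (intro poly_mapping_eqI) (auto simp: lookup_add lookup_minus lookup_single when_def)
    then show ?thesis using is_ideal_mult[OF A n] by (metis mon_add)
  qed
  have inj: "p \<in> J" if b: "b > a" "b \<ge> int N" and p: "p \<in> poly_piece b" "f * p \<in> J" for b p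
  proof -
    obtain k where k: "k \<le> c" "pvs.reldim k (J \<inter> poly_piece b) (kerf f b)"
      "pvs.reldim (c - k) (J \<inter> poly_piece (b + int t)) (imgf f (int t) b)"
      using rank_nullity[OF hf_large[OF b(1)] t(2)] .
    have "poly_piece (b + int t) \<subseteq> high N"
      using b by (fastforce simp: high_def poly_piece_iff)
    also have "\<dots> \<subseteq> adjoin J f" by (rule high_min[OF A high])
    finally have "imgf f (int t) b = poly_piece (b + int t)"
      using adjoin_piece[OF t(2)] imgf_subset[OF t(2)] by blast
    then have "c - k = c"
      using pvs.reldim_unique[OF k(3) J_piece_subspace] hf_large[of "b + int t"] b by auto
    then have "k = 0" using k(1) by simp
    then have "kerf f b = J \<inter> poly_piece b" using k(2) pvs.reldim_0_eq by blast
    then show ?thesis using p by (auto simp: kerf_def)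
  qed
  \<comment> \<open>In low degrees \<open>p\<close> is first multiplied by large monomials, where
    injectivity is known; saturation then brings \<open>p\<close> itself into
    \<open>J\<close>.\<close>
  have inj2: "p \<in> J" if p: "p \<in> poly_piece e" "f * p \<in> J" for e p
  proof (cases "e < 0")
    case True
    then show ?thesis using poly_piece_neg[OF p(1)] is_ideal_0[OF idl] by simp
  next
    case False
    have "mon m * p \<in> J" if m: "nat a + 1 + N \<le> mdeg m" for m
    proof (rule inj)
      show "mon m * p \<in> poly_piece (int (mdeg m) + e)" by (rule poly_piece_mult[OF mon_piece p(1)])
      show "f * (mon m * p) \<in> J" using is_ideal_mult[OF idl p(2), of "mon m"] by (simp add: mult_ac)
    qed (use m False in auto)
    then show ?thesis using sat unfolding saturated_def by blast
  qed
  have "p \<in> J" if "f * p \<in> J" for p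
  proof -
    have "f * hcomp e p \<in> J" for e
      using hideal_hcomp[OF hom that, of "e + int t"] hcomp_mult_piece[OF t(2), of "e + int t" p] by simp
    then show ?thesis using inj2[OF hcomp_in_piece] hideal_iff[OF hom] by blast
  qed
  then show ?thesis using t by blast
qed

text \<open>Multiplication by \<open>f\<close> being injective, the image in degree
  \<open>b + t\<close> has the dimension of \<open>S / J\<close> in degree \<open>b\<close>. It
  fills the piece when both values are \<open>c\<close>, and cannot fill it for
  \<open>b = a\<close>, where the value differs from \<open>c\<close>.\<close>

lemma nzd_top:
  assumes t: "t \<ge> 1" "f \<in> poly_piece (int t)" and nzd: "\<And>p. f * p \<in> J \<Longrightarrow> p \<in> J"
  shows "\<And>e. e > a + int t \<Longrightarrow> poly_piece e \<subseteq> adjoin J f"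
    and "\<exists>\<sigma>\<in>poly_piece (a + int t). \<sigma> \<notin> adjoin J f"
proof -
  have img: "pvs.reldim n (J \<inter> poly_piece (b + int t)) (imgf f (int t) b)"
    if n: "pvs.reldim n (J \<inter> poly_piece b) (poly_piece b)" for n b
  proof -
    obtain k where k: "k \<le> n" "pvs.reldim k (J \<inter> poly_piece b) (kerf f b)"
      "pvs.reldim (n - k) (J \<inter> poly_piece (b + int t)) (imgf f (int t) b)"
      using rank_nullity[OF n t(2)] .
    have "kerf f b \<subseteq> J \<inter> poly_piece b" using nzd by (auto simp: kerf_def)
    then have "k = 0" using pvs.reldim_trivial[OF k(2) J_piece_subspace] by blast
    then show ?thesis using k(3) by simp
  qed
  show "poly_piece e \<subseteq> adjoin J f" if e: "e > a + int t" for e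
  proof -
    define b where "b = e - int t"
    have b: "b > a" "e = b + int t" "b + int t > a" using e by (auto simp: b_def)
    note W = img[OF hf_large[OF b(1)]]
    have "pvs.subspace (imgf f (int t) b)" "J \<inter> poly_piece (b + int t) \<subseteq> imgf f (int t) b"
      using pvs.reldim_subspace[OF W J_piece_subspace] by auto
    from pvs.reldim_split[OF hf_large[OF b(3)] J_piece_subspace this imgf_subset[OF t(2)]]
    obtain m where m: "m \<le> c" "pvs.reldim m (J \<inter> poly_piece (b + int t)) (imgf f (int t) b)"
      "pvs.reldim (c - m) (imgf f (int t) b) (poly_piece (b + int t))" by blast
    have "m = c" by (rule pvs.reldim_unique[OF m(2) J_piece_subspace W])
    then have "poly_piece (b + int t) = imgf f (int t) b" using m(3) pvs.reldim_0_eq by force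
    then show ?thesis using imgf_adjoin b(2) by blast
  qed
  show "\<exists>\<sigma>\<in>poly_piece (a + int t). \<sigma> \<notin> adjoin J f"
  proof (rule ccontr)
    assume "\<not> ?thesis"
    then have "imgf f (int t) a = poly_piece (a + int t)"
      using adjoin_piece[OF t(2)] imgf_subset[OF t(2)] by blast
    moreover obtain n where n: "pvs.reldim n (J \<inter> poly_piece a) (poly_piece a)"
      using hf_reldim_exists[OF idl] by blast
    ultimately have "n = c"
      using pvs.reldim_unique[OF img[OF n] J_piece_subspace] hf_large[of "a + int t"] t(1) by auto
    then show False using n hf_a by simp
  qed
qed

end

section \<open>Baer's criterion over the localization\<close>

lemma self_module_simps [simp]:
  "carrier (self_module R) = carrier R" "add (self_module R) = add R" "ring.zero (self_module R) = ring.zero R"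
  "module.smult (self_module R) = monoid.mult R"
  by (simp_all add: self_module_def)

lemma self_module_module:
  assumes "cring R"
  shows "module R (self_module R)"
proof -
  interpret cring R by fact
  show ?thesis
  proof (rule moduleI)
    show "abelian_group (self_module R)"
    proof (rule abelian_groupI)
      fix x assume "x \<in> carrier (self_module R)"
      then show "\<exists>y\<in>carrier (self_module R). y \<oplus>\<^bsub>self_module R\<^esub> x = \<zero>\<^bsub>self_module R\<^esub>"
        by (intro bexI[of _ "\<ominus>\<^bsub>R\<^esub> x"]) (auto simp: l_neg)
    qed (auto simp: a_ac)
  qed (auto simp: l_distr r_distr m_assoc assms)
qed

text \<open>The conditions \<open>m_max\<close> and \<open>one_m\<close> say that
  \<open>S / m\<close> is a field. The localization of \<open>S / J\<close> at \<open>m\<close> is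
  described by fractions of elements of \<open>S\<close>.\<close>

locale quotient_localization =
  fixes J m :: "'r::comm_ring_1 set"
  assumes idl: "is_ideal J" and m_ideal: "is_ideal m" and Jm: "J \<subseteq> m"
    and m_max: "\<And>x. x \<notin> m \<Longrightarrow> \<exists>y. x * y - 1 \<in> m" and one_m: "1 \<notin> m"
begin

lemma prime_m: "x \<notin> m \<Longrightarrow> y \<notin> m \<Longrightarrow> x * y \<notin> m"
proof
  assume x: "x \<notin> m" and y: "y \<notin> m" and xy: "x * y \<in> m"
  obtain z where z: "x * z - 1 \<in> m" using m_max[OF x] by blast
  have "z * (x * y) - y * (x * z - 1) \<in> m"
    by (rule is_ideal_diff[OF m_ideal is_ideal_mult[OF m_ideal xy] is_ideal_mult[OF m_ideal z]])
  then show False using y by (simp add: algebra_simps)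
qed

abbreviation Q where "Q \<equiv> ring_of_type_algebra Quot J"
abbreviation T where "T \<equiv> carrier Q - cs J ` m"
abbreviation L where "L \<equiv> localization Q T"

lemmas q = quot_ring_simps[OF idl]

lemma m_maximal: "maximalideal (cs J ` m) Q"
proof (rule maximalidealI[OF quot_ideal_image[OF idl m_ideal]])
  have mem: "x \<in> m" if csx: "cs J x \<in> cs J ` m" for x
  proof -
    from csx obtain y where "cs J x = cs J y" "y \<in> m" by (rule imageE)
    then show ?thesis using cs_eq_iff[OF idl, of x y] is_ideal_diff_cancel[OF m_ideal, of x y] Jm by auto
  qed
  show "carrier Q \<noteq> cs J ` m" using mem[of 1] one_m by (auto simp: q)
  fix K assume K: "ideal K Q" "cs J ` m \<subseteq> K" "K \<subseteq> carrier Q"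
  interpret K: ideal K Q by fact
  show "K = cs J ` m \<or> K = carrier Q"
  proof (cases "K = cs J ` m")
    case False
    then obtain u where u: "u \<in> K" "u \<notin> cs J ` m" using K by blast
    then obtain x where "u = cs J x" using K(3) by (auto simp: q)
    with u(2) have x: "u = cs J x" "x \<notin> m" by auto
    obtain y where y: "x * y - 1 \<in> m" using m_max[OF x(2)] by blast
    have 1: "cs J (x * y) \<in> K" using K.I_r_closed[OF u(1), of "cs J y"] by (simp add: x q)
    have 2: "cs J (- (x * y - 1)) \<in> K" using is_ideal_minus[OF m_ideal y] K(2) by blast
    have "cs J (x * y) \<oplus>\<^bsub>Q\<^esub> cs J (- (x * y - 1)) \<in> K"
      by (rule additive_subgroup.a_closed[OF K.is_additive_subgroup 1 2])
    then have "\<one>\<^bsub>Q\<^esub> \<in> K" by (simp add: q)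
    then show ?thesis using K.one_imp_carrier by blast
  qed simp
qed

lemma cs_T: "cs J s \<in> T \<longleftrightarrow> s \<notin> m"
proof -
  have "cs J s \<in> cs J ` m \<longleftrightarrow> s \<in> m"
  proof
    assume "cs J s \<in> cs J ` m"
    then obtain y where "cs J s = cs J y" "y \<in> m" by (rule imageE)
    then show "s \<in> m" using cs_eq_iff[OF idl, of s y] is_ideal_diff_cancel[OF m_ideal, of s y] Jm by auto
  qed simp
  then show ?thesis by (auto simp: q)
qed

lemma T_cases: "u \<in> T \<longleftrightarrow> (\<exists>s. u = cs J s \<and> s \<notin> m)"
  using cs_T by (auto simp: q)

definition frc where "frc p s = fraction Q T (cs J p) (cs J s)"

definition fequiv where "fequiv p s p' s' \<longleftrightarrow> (\<exists>u. u \<notin> m \<and> u * (p * s' - p' * s) \<in> J)"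

lemma frac_rel_iff: "((cs J p, cs J s), (cs J p', cs J s')) \<in> frac_rel Q T \<longleftrightarrow> s \<notin> m \<and> s' \<notin> m \<and> fequiv p s p' s'"
proof -
  have "(\<exists>u\<in>T. u \<otimes>\<^bsub>Q\<^esub> (cs J p \<otimes>\<^bsub>Q\<^esub> cs J s') = u \<otimes>\<^bsub>Q\<^esub> (cs J p' \<otimes>\<^bsub>Q\<^esub> cs J s)) \<longleftrightarrow> fequiv p s p' s'"
  proof
    assume "\<exists>u\<in>T. u \<otimes>\<^bsub>Q\<^esub> (cs J p \<otimes>\<^bsub>Q\<^esub> cs J s') = u \<otimes>\<^bsub>Q\<^esub> (cs J p' \<otimes>\<^bsub>Q\<^esub> cs J s)"
    then obtain u where "u \<notin> m" "cs J (u * (p * s')) = cs J (u * (p' * s))"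
      unfolding Bex_def T_cases by (auto simp: q)
    then show "fequiv p s p' s'"
      by (auto simp: fequiv_def cs_eq_iff[OF idl] right_diff_distrib)
  next
    assume "fequiv p s p' s'"
    then obtain u where u: "u \<notin> m" "u * (p * s' - p' * s) \<in> J" by (auto simp: fequiv_def)
    have "cs J (u * (p * s')) = cs J (u * (p' * s))"
      using u(2) by (simp add: cs_eq_iff[OF idl] right_diff_distrib)
    then show "\<exists>u\<in>T. u \<otimes>\<^bsub>Q\<^esub> (cs J p \<otimes>\<^bsub>Q\<^esub> cs J s') = u \<otimes>\<^bsub>Q\<^esub> (cs J p' \<otimes>\<^bsub>Q\<^esub> cs J s)"
      using cs_T u(1) by (intro bexI[of _ "cs J u"]) (auto simp: q)
  qed
  moreover have "cs J p \<in> carrier Q" for p by (simp add: q)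
  ultimately show ?thesis unfolding frac_rel_def by (auto simp: cs_T simp del: Diff_iff)
qed

lemma fequiv_refl: "fequiv p s p s"
  unfolding fequiv_def using one_m by (intro exI[of _ 1]) (simp add: is_ideal_0[OF idl])

lemma fequiv_sym: "fequiv p s p' s' \<Longrightarrow> fequiv p' s' p s"
proof -
  assume "fequiv p s p' s'"
  then obtain u where u: "u \<notin> m" "u * (p * s' - p' * s) \<in> J" by (auto simp: fequiv_def)
  have "u * (p' * s - p * s') \<in> J" using is_ideal_minus[OF idl u(2)] by (simp add: algebra_simps)
  then show ?thesis using u(1) by (auto simp: fequiv_def)
qed

lemma fequiv_trans: "fequiv p s p' s' \<Longrightarrow> fequiv p' s' p'' s'' \<Longrightarrow> s' \<notin> m \<Longrightarrow> fequiv p s p'' s''"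
proof -
  assume "fequiv p s p' s'" "fequiv p' s' p'' s''" and s: "s' \<notin> m"
  then obtain u v where u: "u \<notin> m" "u * (p * s' - p' * s) \<in> J" and v: "v \<notin> m" "v * (p' * s'' - p'' * s') \<in> J"
    by (auto simp: fequiv_def)
  have "(v * s'') * (u * (p * s' - p' * s)) + (u * s) * (v * (p' * s'' - p'' * s')) \<in> J"
    by (rule is_ideal_add[OF idl is_ideal_mult[OF idl u(2)] is_ideal_mult[OF idl v(2)]])
  also have "(v * s'') * (u * (p * s' - p' * s)) + (u * s) * (v * (p' * s'' - p'' * s')) =
    (u * v * s') * (p * s'' - p'' * s)" by (simp add: algebra_simps)
  finally show ?thesis
    unfolding fequiv_def using prime_m[OF prime_m[OF u(1) v(1)] s] by (intro exI[of _ "u * v * s'"] conjI)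
qed

lemma frc_mem: "s \<notin> m \<Longrightarrow> x \<in> frc p s \<longleftrightarrow> (\<exists>p' s'. x = (cs J p', cs J s') \<and> s' \<notin> m \<and> fequiv p s p' s')"
proof
  assume s: "s \<notin> m"
  { assume "x \<in> frc p s"
    then have x: "((cs J p, cs J s), x) \<in> frac_rel Q T" by (simp add: frc_def fraction_def)
    then have "fst x \<in> carrier Q" "snd x \<in> T" by (auto simp: frac_rel_def)
    then obtain p' s' where "x = (cs J p', cs J s')" "s' \<notin> m"
      unfolding T_cases by (cases x) (auto simp: q)
    then show "\<exists>p' s'. x = (cs J p', cs J s') \<and> s' \<notin> m \<and> fequiv p s p' s'"
      using x frac_rel_iff[of p s p' s'] by auto }
  assume "\<exists>p' s'. x = (cs J p', cs J s') \<and> s' \<notin> m \<and> fequiv p s p' s'"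
  then show "x \<in> frc p s" using frac_rel_iff s by (auto simp: frc_def fraction_def)
qed

lemma frc_eq_iff: "s \<notin> m \<Longrightarrow> s' \<notin> m \<Longrightarrow> frc p s = frc p' s' \<longleftrightarrow> fequiv p s p' s'"
proof
  assume s: "s \<notin> m" "s' \<notin> m"
  { assume "frc p s = frc p' s'"
    then have "(cs J p', cs J s') \<in> frc p s" using frc_mem[OF s(2), of _ p'] fequiv_refl s by blast
    then have "((cs J p, cs J s), (cs J p', cs J s')) \<in> frac_rel Q T" by (simp add: frc_def fraction_def)
    then show "fequiv p s p' s'" using frac_rel_iff by blast }
  assume e: "fequiv p s p' s'"
  have "x \<in> frc p s \<longleftrightarrow> x \<in> frc p' s'" for x
    unfolding frc_mem[OF s(1)] frc_mem[OF s(2)] using fequiv_trans[OF e _ s(2)] fequiv_trans[OF fequiv_sym[OF e] _ s(1)] by blast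
  then show "frc p s = frc p' s'" by blast
qed

lemma frc_cancel: "s \<notin> m \<Longrightarrow> u \<notin> m \<Longrightarrow> frc (u * p) (u * s) = frc p s"
  by (subst frc_eq_iff) (auto simp: prime_m fequiv_def algebra_simps is_ideal_0[OF idl] intro: exI[of _ 1] one_m)

lemma L_carrier: "carrier L = {frc p s | p s. s \<notin> m}"
proof -
  have "carrier L = {fraction Q T u v | u v. u \<in> carrier Q \<and> v \<in> T}"
    by (auto simp: localization_def quotient_def fraction_def)
  also have "\<dots> = {frc p s | p s. s \<notin> m}"
    unfolding T_cases frc_def by (auto simp: q)
  finally show ?thesis .
qed

lemma frc_carrier: "s \<notin> m \<Longrightarrow> frc p s \<in> carrier L"
  unfolding L_carrier by blast

text \<open>Operations on the localization are unions over all pairs of representatives; when the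
  result is the same for all of them, the union is that result.\<close>

lemma frc_UNION:
  assumes s: "s \<notin> m" "s' \<notin> m"
    and G: "\<And>a b a' b'. b \<notin> m \<Longrightarrow> b' \<notin> m \<Longrightarrow> fequiv p s a b \<Longrightarrow> fequiv p' s' a' b' \<Longrightarrow>
      G (cs J a) (cs J b) (cs J a') (cs J b') = A"
  shows "(\<Union>(x, y)\<in>frc p s. \<Union>(x', y')\<in>frc p' s'. G x y x' y') = A"
proof
  show "(\<Union>(x, y)\<in>frc p s. \<Union>(x', y')\<in>frc p' s'. G x y x' y') \<subseteq> A"
  proof clarify
    fix z x y x' y' assume xy: "(x, y) \<in> frc p s" "(x', y') \<in> frc p' s'" and z: "z \<in> G x y x' y'"
    obtain a b where a: "x = cs J a" "y = cs J b" "b \<notin> m" "fequiv p s a b"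
      using xy(1) unfolding frc_mem[OF s(1)] by auto
    obtain a' b' where a': "x' = cs J a'" "y' = cs J b'" "b' \<notin> m" "fequiv p' s' a' b'"
      using xy(2) unfolding frc_mem[OF s(2)] by auto
    show "z \<in> A" using G[OF a(3) a'(3) a(4) a'(4)] z by (simp add: a a')
  qed
  have "(cs J p, cs J s) \<in> frc p s" "(cs J p', cs J s') \<in> frc p' s'"
    using s frc_mem fequiv_refl by blast+
  then show "A \<subseteq> (\<Union>(x, y)\<in>frc p s. \<Union>(x', y')\<in>frc p' s'. G x y x' y')"
    using G[OF s fequiv_refl fequiv_refl] by fast
qed

lemma fequivE:
  assumes "fequiv p s p' s'"
  obtains u where "u \<notin> m" "u * (p * s' - p' * s) \<in> J"
  using assms by (auto simp: fequiv_def)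

lemma L_mult: "s \<notin> m \<Longrightarrow> s' \<notin> m \<Longrightarrow> frc p s \<otimes>\<^bsub>L\<^esub> frc p' s' = frc (p * p') (s * s')"
  unfolding localization_def monoid.simps
proof (rule frc_UNION)
  fix a b a' b' assume s: "s \<notin> m" "s' \<notin> m" and b: "b \<notin> m" "b' \<notin> m"
    and e: "fequiv p s a b" "fequiv p' s' a' b'"
  obtain u where u: "u \<notin> m" "u * (p * b - a * s) \<in> J" using fequivE[OF e(1)] .
  obtain u' where u': "u' \<notin> m" "u' * (p' * b' - a' * s') \<in> J" using fequivE[OF e(2)] .
  have "(u' * p' * b') * (u * (p * b - a * s)) + (u * a * s) * (u' * (p' * b' - a' * s')) \<in> J"
    by (rule is_ideal_add[OF idl is_ideal_mult[OF idl u(2)] is_ideal_mult[OF idl u'(2)]])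
  also have "(u' * p' * b') * (u * (p * b - a * s)) + (u * a * s) * (u' * (p' * b' - a' * s')) =
    (u * u') * ((p * p') * (b * b') - (a * a') * (s * s'))" by (simp add: algebra_simps)
  finally have "fequiv (p * p') (s * s') (a * a') (b * b')"
    unfolding fequiv_def using prime_m[OF u(1) u'(1)] by (intro exI[of _ "u * u'"] conjI)
  then have "frc (p * p') (s * s') = frc (a * a') (b * b')"
    using frc_eq_iff[OF prime_m[OF s] prime_m[OF b]] by simp
  then show "fraction Q T (cs J a \<otimes>\<^bsub>Q\<^esub> cs J a') (cs J b \<otimes>\<^bsub>Q\<^esub> cs J b') = frc (p * p') (s * s')"
    by (simp add: q frc_def)
qed

lemma L_add: "s \<notin> m \<Longrightarrow> s' \<notin> m \<Longrightarrow> frc p s \<oplus>\<^bsub>L\<^esub> frc p' s' = frc (p * s' + p' * s) (s * s')"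
  unfolding localization_def ring.simps
proof (rule frc_UNION)
  fix a b a' b' assume s: "s \<notin> m" "s' \<notin> m" and b: "b \<notin> m" "b' \<notin> m"
    and e: "fequiv p s a b" "fequiv p' s' a' b'"
  obtain u where u: "u \<notin> m" "u * (p * b - a * s) \<in> J" using fequivE[OF e(1)] .
  obtain u' where u': "u' \<notin> m" "u' * (p' * b' - a' * s') \<in> J" using fequivE[OF e(2)] .
  have "(u' * s' * b') * (u * (p * b - a * s)) + (u * b * s) * (u' * (p' * b' - a' * s')) \<in> J"
    by (rule is_ideal_add[OF idl is_ideal_mult[OF idl u(2)] is_ideal_mult[OF idl u'(2)]])
  also have "(u' * s' * b') * (u * (p * b - a * s)) + (u * b * s) * (u' * (p' * b' - a' * s')) =
    (u * u') * ((p * s' + p' * s) * (b * b') - (a * b' + a' * b) * (s * s'))" by (simp add: algebra_simps)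
  finally have "fequiv (p * s' + p' * s) (s * s') (a * b' + a' * b) (b * b')"
    unfolding fequiv_def using prime_m[OF u(1) u'(1)] by (intro exI[of _ "u * u'"] conjI)
  then have "frc (p * s' + p' * s) (s * s') = frc (a * b' + a' * b) (b * b')"
    using frc_eq_iff[OF prime_m[OF s] prime_m[OF b]] by simp
  then show "fraction Q T (cs J a \<otimes>\<^bsub>Q\<^esub> cs J b' \<oplus>\<^bsub>Q\<^esub> cs J a' \<otimes>\<^bsub>Q\<^esub> cs J b) (cs J b \<otimes>\<^bsub>Q\<^esub> cs J b') =
      frc (p * s' + p' * s) (s * s')"
    by (simp add: q frc_def)
qed

lemma L_one: "\<one>\<^bsub>L\<^esub> = frc 1 1"
  by (simp add: localization_def frc_def q)

lemma L_zero: "\<zero>\<^bsub>L\<^esub> = frc 0 1"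
  by (simp add: localization_def frc_def q cs_0)

text \<open>Scalars are restricted along \<open>S \<rightarrow> S / J \<rightarrow> L\<close>, so
  that later arguments multiply by polynomials instead of classes of fractions.\<close>

definition restrict_scalars :: "(('r set \<times> 'r set) set, 'e) module \<Rightarrow> ('r, 'e) module" where
  "restrict_scalars E = \<lparr>carrier = carrier E, monoid.mult = undefined, one = undefined,
     ring.zero = ring.zero E, add = add E, module.smult = (\<lambda>p e. frc p 1 \<odot>\<^bsub>E\<^esub> e)\<rparr>"

lemma restrict_scalars_simps [simp]:
  "carrier (restrict_scalars E) = carrier E" "add (restrict_scalars E) = add E"
  "ring.zero (restrict_scalars E) = ring.zero E" "p \<odot>\<^bsub>restrict_scalars E\<^esub> e = frc p 1 \<odot>\<^bsub>E\<^esub> e"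
  by (simp_all add: restrict_scalars_def)

lemma frc_add1: "frc (p + p') 1 = frc p 1 \<oplus>\<^bsub>L\<^esub> frc p' 1"
  using one_m by (simp add: L_add)

lemma frc_mult1: "frc (p * p') 1 = frc p 1 \<otimes>\<^bsub>L\<^esub> frc p' 1"
  using one_m by (simp add: L_mult)

lemma restrict_scalars_module:
  assumes "module L E"
  shows "module (ring_of_type_algebra :: 'r ring) (restrict_scalars E)"
proof -
  interpret E: module L E by fact
  show ?thesis
  proof (rule moduleI)
    show "abelian_group (restrict_scalars E)"
    proof (rule abelian_groupI)
      fix x assume "x \<in> carrier (restrict_scalars E)"
      then show "\<exists>y\<in>carrier (restrict_scalars E). y \<oplus>\<^bsub>restrict_scalars E\<^esub> x = \<zero>\<^bsub>restrict_scalars E\<^esub>"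
        by (intro bexI[of _ "\<ominus>\<^bsub>E\<^esub> x"]) (auto simp: E.l_neg)
    qed (auto simp: E.a_ac)
  qed (use one_m in \<open>auto simp: cring_rta frc_carrier frc_add1 frc_mult1 E.smult_l_distr E.smult_r_distr
      E.smult_assoc1 L_one[symmetric]\<close>)
qed

lemma restrict_scalars_J:
  assumes "module L E" "p \<in> J" "e \<in> carrier E"
  shows "p \<odot>\<^bsub>restrict_scalars E\<^esub> e = \<zero>\<^bsub>E\<^esub>"
proof -
  interpret E: module L E by fact
  have "frc p 1 = \<zero>\<^bsub>L\<^esub>"
    unfolding L_zero using assms(2) one_m by (subst frc_eq_iff) (auto simp: fequiv_def intro: exI[of _ 1])
  then show ?thesis using assms(3) by simp
qed

text \<open>Injectivity over \<open>L\<close> is tested on an ideal \<open>b\<close> of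
  \<open>S\<close>: the map \<open>G\<close>, which vanishes on \<open>J\<close>, extends to
  fractions with numerator in \<open>b\<close>, from there to all of \<open>L\<close>, and
  \<open>e\<close> is the value at one. The inclusion of an ideal into \<open>L\<close> is among the
  test maps of \<open>injective_module\<close>.\<close>

lemma baer:
  fixes E :: "(('r set \<times> 'r set) set, 'e) module"
  assumes inj: "injective_module L E" and b: "is_ideal b"
    and G: "\<And>x. x \<in> b \<Longrightarrow> G x \<in> carrier E" "\<And>x y. x \<in> b \<Longrightarrow> y \<in> b \<Longrightarrow> G (x + y) = G x \<oplus>\<^bsub>E\<^esub> G y"
      "\<And>r x. x \<in> b \<Longrightarrow> G (r * x) = r \<odot>\<^bsub>restrict_scalars E\<^esub> G x" "\<And>x. x \<in> b \<Longrightarrow> x \<in> J \<Longrightarrow> G x = \<zero>\<^bsub>E\<^esub>"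
  shows "\<exists>e\<in>carrier E. \<forall>x\<in>b. G x = x \<odot>\<^bsub>restrict_scalars E\<^esub> e"
proof -
  have modE: "module L E" using inj by (simp add: injective_module_def)
  interpret E: module L E by (rule modE)
  let ?B = "self_module L"
  interpret B: module L ?B by (rule self_module_module) (rule E.R.is_cring)
  \<comment> \<open>The ideal of \<open>L\<close> generated by \<open>b\<close>.\<close>
  define H where "H = {frc p s | p s. p \<in> b \<and> s \<notin> m}"
  let ?A = "?B\<lparr>carrier := H\<rparr>"
  have Hsmult: "a \<odot>\<^bsub>?B\<^esub> x \<in> H" if ax: "a \<in> carrier L" "x \<in> H" for a x
  proof -
    obtain r t where r: "a = frc r t" "t \<notin> m" using ax(1) by (auto simp: L_carrier)
    obtain p s where p: "x = frc p s" "p \<in> b" "s \<notin> m" using ax(2) by (auto simp: H_def)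
    have "a \<odot>\<^bsub>?B\<^esub> x = frc (r * p) (t * s)" using r p by (simp add: L_mult)
    then show ?thesis unfolding H_def using is_ideal_mult[OF b p(2)] prime_m[OF r(2) p(3)] by blast
  qed
  have HL: "H \<subseteq> carrier L" using frc_carrier by (auto simp: H_def)
  have "submodule H L ?B"
  proof (rule B.submoduleI[OF _ _ _ _ Hsmult])
    show "H \<subseteq> carrier ?B" using HL by simp
    show "\<zero>\<^bsub>?B\<^esub> \<in> H" using is_ideal_0[OF b] one_m by (auto simp: L_zero H_def)
    fix x assume x: "x \<in> H"
    have "\<ominus>\<^bsub>?B\<^esub> x = (\<ominus>\<^bsub>L\<^esub> \<one>\<^bsub>L\<^esub>) \<odot>\<^bsub>?B\<^esub> x"
      using B.smult_l_minus[of "\<one>\<^bsub>L\<^esub>" x] B.smult_one[of x] x HL by auto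
    also have "\<dots> \<in> H" by (rule Hsmult) (use x in auto)
    finally show "\<ominus>\<^bsub>?B\<^esub> x \<in> H" .
    fix y assume "y \<in> H"
    then obtain p' s' where p': "y = frc p' s'" "p' \<in> b" "s' \<notin> m" by (auto simp: H_def)
    obtain p s where p: "x = frc p s" "p \<in> b" "s \<notin> m" using x by (auto simp: H_def)
    have "p * s' + p' * s \<in> b"
      by (rule is_ideal_add[OF b is_ideal_mult2[OF b p(2)] is_ideal_mult2[OF b p'(2)]])
    then show "x \<oplus>\<^bsub>?B\<^esub> y \<in> H" using prime_m p p' by (auto simp: L_add H_def)
  qed
  then have modA: "module L ?A" by (rule submodule.submodule_is_module[OF _ B.module_axioms])
  have Glin: "G (r * x) = frc r 1 \<odot>\<^bsub>E\<^esub> G x" if "x \<in> b" for r x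
    using G(3)[OF that] by simp
  have act: "frc p s \<odot>\<^bsub>E\<^esub> (frc p' s' \<odot>\<^bsub>E\<^esub> e) = frc (p * p') (s * s') \<odot>\<^bsub>E\<^esub> e"
    if "e \<in> carrier E" "s \<notin> m" "s' \<notin> m" for p s p' s' e
    using that by (simp add: E.smult_assoc1[symmetric] frc_carrier L_mult)
  \<comment> \<open>Equality of fractions puts \<open>u * (p * s' - p' * s)\<close> into both
    \<open>J\<close> and \<open>b\<close>, where \<open>G\<close> vanishes; multiplication by
    \<open>1 / (u * s * s')\<close> then removes the cleared denominators.\<close>
  have wd: "frc 1 s \<odot>\<^bsub>E\<^esub> G p = frc 1 s' \<odot>\<^bsub>E\<^esub> G p'"
    if eq: "frc p s = frc p' s'" and pp: "p \<in> b" "p' \<in> b" "s \<notin> m" "s' \<notin> m" for p s p' s'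
  proof -
    obtain u where u: "u \<notin> m" "u * (p * s' - p' * s) \<in> J"
      using eq pp frc_eq_iff by (auto simp: fequiv_def)
    have ub: "(u * s') * p \<in> b" "(u * s) * p' \<in> b" using is_ideal_mult[OF b] pp by blast+
    have d: "(u * s') * p - (u * s) * p' = u * (p * s' - p' * s)" by (simp add: algebra_simps)
    have db: "u * (p * s' - p' * s) \<in> b" unfolding d[symmetric] by (rule is_ideal_diff[OF b ub])
    have "G ((u * s') * p) = G (u * (p * s' - p' * s) + (u * s) * p')" by (simp add: algebra_simps)
    also have "\<dots> = G ((u * s) * p')" using G(2)[OF db ub(2)] G(4)[OF db u(2)] G(1)[OF ub(2)] by simp
    finally have e: "frc (u * s') 1 \<odot>\<^bsub>E\<^esub> G p = frc (u * s) 1 \<odot>\<^bsub>E\<^esub> G p'"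
      using Glin pp by simp
    have n: "u * s * s' \<notin> m" by (rule prime_m[OF prime_m[OF u(1) pp(3)] pp(4)])
    have 1: "frc 1 (u * s * s') \<odot>\<^bsub>E\<^esub> (frc (u * s') 1 \<odot>\<^bsub>E\<^esub> G p) = frc 1 s \<odot>\<^bsub>E\<^esub> G p"
      using act[OF G(1)[OF pp(1)] n one_m, of 1 "u * s'"] frc_cancel[of s "u * s'" 1] prime_m u pp by (simp add: mult_ac)
    have 2: "frc 1 (u * s * s') \<odot>\<^bsub>E\<^esub> (frc (u * s) 1 \<odot>\<^bsub>E\<^esub> G p') = frc 1 s' \<odot>\<^bsub>E\<^esub> G p'"
      using act[OF G(1)[OF pp(2)] n one_m, of 1 "u * s"] frc_cancel[of s' "u * s" 1] prime_m u pp by (simp add: mult_ac)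
    show ?thesis using 1 2 e by simp
  qed
  define g where "g x = (SOME e. \<exists>p s. x = frc p s \<and> p \<in> b \<and> s \<notin> m \<and> e = frc 1 s \<odot>\<^bsub>E\<^esub> G p)" for x
  have g: "g (frc p s) = frc 1 s \<odot>\<^bsub>E\<^esub> G p" if "p \<in> b" "s \<notin> m" for p s
  proof -
    have "\<exists>p' s'. frc p s = frc p' s' \<and> p' \<in> b \<and> s' \<notin> m \<and> g (frc p s) = frc 1 s' \<odot>\<^bsub>E\<^esub> G p'"
      unfolding g_def by (rule someI_ex) (use that in blast)
    then show ?thesis using wd that by metis
  qed
  have gA: "g \<in> mod_hom L ?A E"
    unfolding mod_hom_def
  proof (intro CollectI conjI ballI Pi_I)
    fix x assume "x \<in> carrier ?A"
    then obtain p s where p: "x = frc p s" "p \<in> b" "s \<notin> m" by (auto simp: H_def)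
    show "g x \<in> carrier E" using p g G(1) frc_carrier by simp
    { fix y assume "y \<in> carrier ?A"
      then obtain p' s' where p': "y = frc p' s'" "p' \<in> b" "s' \<notin> m" by (auto simp: H_def)
      have n: "s * s' \<notin> m" by (rule prime_m[OF p(3) p'(3)])
      have b1: "s' * p \<in> b" "s * p' \<in> b" using is_ideal_mult[OF b] p p' by blast+
      have "g (x \<oplus>\<^bsub>?A\<^esub> y) = g (frc (s' * p + s * p') (s * s'))" using p p' by (simp add: L_add mult.commute)
      also have "\<dots> = frc 1 (s * s') \<odot>\<^bsub>E\<^esub> G (s' * p + s * p')" using g[OF is_ideal_add[OF b b1] n] .
      also have "\<dots> = frc 1 (s * s') \<odot>\<^bsub>E\<^esub> (frc s' 1 \<odot>\<^bsub>E\<^esub> G p) \<oplus>\<^bsub>E\<^esub> frc 1 (s * s') \<odot>\<^bsub>E\<^esub> (frc s 1 \<odot>\<^bsub>E\<^esub> G p')"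
        using G(2)[OF b1] Glin p p' G(1) one_m n by (simp add: E.smult_r_distr frc_carrier)
      also have "\<dots> = g x \<oplus>\<^bsub>E\<^esub> g y"
        using act[OF G(1)[OF p(2)] n one_m, of 1 s'] act[OF G(1)[OF p'(2)] n one_m, of 1 s]
          frc_cancel[of s s' 1] frc_cancel[of s' s 1] p p' g by (simp add: mult.commute)
      finally show "g (x \<oplus>\<^bsub>?A\<^esub> y) = g x \<oplus>\<^bsub>E\<^esub> g y" . }
    fix a assume "a \<in> carrier L"
    then obtain r t where r: "a = frc r t" "t \<notin> m" by (auto simp: L_carrier)
    have "g (a \<odot>\<^bsub>?A\<^esub> x) = g (frc (r * p) (t * s))" using r p by (simp add: L_mult)
    also have "\<dots> = frc 1 (t * s) \<odot>\<^bsub>E\<^esub> G (r * p)" by (rule g[OF is_ideal_mult[OF b p(2)] prime_m[OF r(2) p(3)]])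
    also have "\<dots> = frc 1 (t * s) \<odot>\<^bsub>E\<^esub> (frc r 1 \<odot>\<^bsub>E\<^esub> G p)" using Glin p by simp
    also have "\<dots> = a \<odot>\<^bsub>E\<^esub> g x"
      using act[OF G(1)[OF p(2)] _ one_m, of "t * s" 1 r] act[OF G(1)[OF p(2)] r(2) p(3), of r 1] prime_m r p g by simp
    finally show "g (a \<odot>\<^bsub>?A\<^esub> x) = a \<odot>\<^bsub>E\<^esub> g x" .
  qed
  have idA: "(\<lambda>x. x) \<in> mod_hom L ?A ?B" "inj_on (\<lambda>x. x) (carrier ?A)"
    using HL by (auto simp: mod_hom_def)
  obtain h where h: "h \<in> mod_hom L ?B E" "\<forall>x\<in>carrier ?A. h x = g x"
    using inj modA B.module_axioms idA gA unfolding injective_module_def by blast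
  show ?thesis
  proof (intro bexI ballI)
    show "h \<one>\<^bsub>L\<^esub> \<in> carrier E" using h(1) by (auto simp: mod_hom_def)
    fix x assume x: "x \<in> b"
    have fx: "frc x 1 \<in> H" using x one_m by (auto simp: H_def)
    have "G x = g (frc x 1)" using g[OF x one_m] G(1)[OF x] by (simp add: L_one[symmetric])
    also have "\<dots> = h (frc x 1 \<odot>\<^bsub>?B\<^esub> \<one>\<^bsub>L\<^esub>)" using h(2) fx HL by auto
    also have "\<dots> = frc x 1 \<odot>\<^bsub>E\<^esub> h \<one>\<^bsub>L\<^esub>"
      using h(1) frc_carrier[OF one_m, of x] E.R.one_closed unfolding mod_hom_def self_module_simps by blast
    finally show "G x = x \<odot>\<^bsub>restrict_scalars E\<^esub> h \<one>\<^bsub>L\<^esub>" by simp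
  qed
qed

end

section \<open>The socle modulo a nonzerodivisor\<close>

lemma rta_module_simps:
  fixes M :: "('r::comm_ring_1, 'm, 'd) module_scheme"
  assumes "module ring_of_type_algebra M"
  shows "x \<in> carrier M \<Longrightarrow> r \<odot>\<^bsub>M\<^esub> x \<in> carrier M"
    "x \<in> carrier M \<Longrightarrow> r \<odot>\<^bsub>M\<^esub> (s \<odot>\<^bsub>M\<^esub> x) = (r * s) \<odot>\<^bsub>M\<^esub> x"
    "x \<in> carrier M \<Longrightarrow> 0 \<odot>\<^bsub>M\<^esub> x = \<zero>\<^bsub>M\<^esub>"
    "x \<in> carrier M \<Longrightarrow> 1 \<odot>\<^bsub>M\<^esub> x = x"
    "r \<odot>\<^bsub>M\<^esub> \<zero>\<^bsub>M\<^esub> = \<zero>\<^bsub>M\<^esub>"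
    "\<zero>\<^bsub>M\<^esub> \<in> carrier M"
    "x \<in> carrier M \<Longrightarrow> y \<in> carrier M \<Longrightarrow> x \<oplus>\<^bsub>M\<^esub> y \<in> carrier M"
    "x \<in> carrier M \<Longrightarrow> y \<in> carrier M \<Longrightarrow> x \<ominus>\<^bsub>M\<^esub> y \<in> carrier M"
    "x \<in> carrier M \<Longrightarrow> (r + s) \<odot>\<^bsub>M\<^esub> x = r \<odot>\<^bsub>M\<^esub> x \<oplus>\<^bsub>M\<^esub> s \<odot>\<^bsub>M\<^esub> x"
    "x \<in> carrier M \<Longrightarrow> y \<in> carrier M \<Longrightarrow> r \<odot>\<^bsub>M\<^esub> (x \<oplus>\<^bsub>M\<^esub> y) = r \<odot>\<^bsub>M\<^esub> x \<oplus>\<^bsub>M\<^esub> r \<odot>\<^bsub>M\<^esub> y"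
    "x \<in> carrier M \<Longrightarrow> y \<in> carrier M \<Longrightarrow> x \<ominus>\<^bsub>M\<^esub> y = x \<oplus>\<^bsub>M\<^esub> (-1) \<odot>\<^bsub>M\<^esub> y"
    "x \<in> carrier M \<Longrightarrow> y \<in> carrier M \<Longrightarrow> x \<ominus>\<^bsub>M\<^esub> y = \<zero>\<^bsub>M\<^esub> \<longleftrightarrow> x = y"
proof -
  interpret M: module ring_of_type_algebra M by fact
  show "x \<in> carrier M \<Longrightarrow> r \<odot>\<^bsub>M\<^esub> x \<in> carrier M"
    "x \<in> carrier M \<Longrightarrow> r \<odot>\<^bsub>M\<^esub> (s \<odot>\<^bsub>M\<^esub> x) = (r * s) \<odot>\<^bsub>M\<^esub> x"
    "x \<in> carrier M \<Longrightarrow> 0 \<odot>\<^bsub>M\<^esub> x = \<zero>\<^bsub>M\<^esub>"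
    "x \<in> carrier M \<Longrightarrow> 1 \<odot>\<^bsub>M\<^esub> x = x"
    "r \<odot>\<^bsub>M\<^esub> \<zero>\<^bsub>M\<^esub> = \<zero>\<^bsub>M\<^esub>"
    "\<zero>\<^bsub>M\<^esub> \<in> carrier M"
    "x \<in> carrier M \<Longrightarrow> y \<in> carrier M \<Longrightarrow> x \<oplus>\<^bsub>M\<^esub> y \<in> carrier M"
    "x \<in> carrier M \<Longrightarrow> y \<in> carrier M \<Longrightarrow> x \<ominus>\<^bsub>M\<^esub> y \<in> carrier M"
    "x \<in> carrier M \<Longrightarrow> (r + s) \<odot>\<^bsub>M\<^esub> x = r \<odot>\<^bsub>M\<^esub> x \<oplus>\<^bsub>M\<^esub> s \<odot>\<^bsub>M\<^esub> x"
    "x \<in> carrier M \<Longrightarrow> y \<in> carrier M \<Longrightarrow> r \<odot>\<^bsub>M\<^esub> (x \<oplus>\<^bsub>M\<^esub> y) = r \<odot>\<^bsub>M\<^esub> x \<oplus>\<^bsub>M\<^esub> r \<odot>\<^bsub>M\<^esub> y"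
    using M.smult_closed[of r x] M.smult_assoc1[of r s x] M.smult_l_null[of x] M.smult_one[of x]
      M.smult_r_null[of r] M.smult_l_distr[of r s x] M.smult_r_distr[of r x y] by simp_all
  show *: "x \<ominus>\<^bsub>M\<^esub> y = x \<oplus>\<^bsub>M\<^esub> (-1) \<odot>\<^bsub>M\<^esub> y" if "x \<in> carrier M" "y \<in> carrier M"
    using M.smult_l_minus[of 1 y] M.smult_one[of y] that by (simp add: M.minus_eq)
  show "x \<ominus>\<^bsub>M\<^esub> y = \<zero>\<^bsub>M\<^esub> \<longleftrightarrow> x = y" if x: "x \<in> carrier M" and y: "y \<in> carrier M"
  proof
    show "x = y \<Longrightarrow> x \<ominus>\<^bsub>M\<^esub> y = \<zero>\<^bsub>M\<^esub>" using y by (simp add: M.minus_eq M.r_neg)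
    assume "x \<ominus>\<^bsub>M\<^esub> y = \<zero>\<^bsub>M\<^esub>"
    then have "\<ominus>\<^bsub>M\<^esub> (\<ominus>\<^bsub>M\<^esub> y) = x"
      using x y by (intro M.minus_equality) (auto simp: M.minus_eq)
    then show "x = y" using y by simp
  qed
qed

lemma mod_homD:
  assumes "h \<in> mod_hom ring_of_type_algebra M N"
  shows "x \<in> carrier M \<Longrightarrow> h x \<in> carrier N"
    "x \<in> carrier M \<Longrightarrow> y \<in> carrier M \<Longrightarrow> h (x \<oplus>\<^bsub>M\<^esub> y) = h x \<oplus>\<^bsub>N\<^esub> h y"
    "x \<in> carrier M \<Longrightarrow> h (r \<odot>\<^bsub>M\<^esub> x) = r \<odot>\<^bsub>N\<^esub> h x"
  using assms by (auto simp: mod_hom_def)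

lemma mod_hom_diff:
  fixes M :: "('r::comm_ring_1, 'm, 'd) module_scheme" and N :: "('r, 'n, 'e) module_scheme"
  assumes "module ring_of_type_algebra M" "module ring_of_type_algebra N" "h \<in> mod_hom ring_of_type_algebra M N"
    "x \<in> carrier M" "y \<in> carrier M"
  shows "h (x \<ominus>\<^bsub>M\<^esub> y) = h x \<ominus>\<^bsub>N\<^esub> h y"
  using assms mod_homD[OF assms(3)] by (simp add: rta_module_simps)

lemma high_1_max: "x \<notin> high 1 \<Longrightarrow> x * const_poly (inverse (Poly_Mapping.lookup x 0)) - 1 \<in> high 1"
  by (simp add: high_1 mult.commute[of x] lookup_minus del: One_nat_def)

lemma prime_high_1:
  fixes x y :: "('x::finite, 'k::field) mpoly"
  shows "x \<notin> high 1 \<Longrightarrow> y \<notin> high 1 \<Longrightarrow> x * y \<notin> high 1"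
proof
  assume x: "x \<notin> high 1" and y: "y \<notin> high 1" and xy: "x * y \<in> high 1"
  let ?c = "const_poly (inverse (Poly_Mapping.lookup x 0)) :: ('x, 'k) mpoly"
  have "?c * (x * y) - y * (x * ?c - 1) \<in> high 1"
    by (rule is_ideal_diff[OF high_ideal is_ideal_mult[OF high_ideal xy]
          is_ideal_mult[OF high_ideal high_1_max[OF x]]])
  then show False using y by (simp add: algebra_simps)
qed
lemma one_notin_high_1: "1 \<notin> high 1"
  by (simp add: high_1 del: One_nat_def)

lemma minus_const_high_1: "x - const_poly (Poly_Mapping.lookup x 0) \<in> high 1"
  by (simp add: high_1 lookup_minus del: One_nat_def)

text \<open>Only finitely many monomials lie outside \<open>b\<close>; one of maximal degree is
  pushed into \<open>b\<close> by every variable.\<close>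

lemma exists_socle_monomial:
  fixes b :: "('x::finite, 'k::field) mpoly set"
  assumes b: "is_ideal b" "high N \<subseteq> b" "1 \<notin> b"
  shows "\<exists>\<mu>. mon \<mu> \<notin> b \<and> (\<forall>q\<in>high 1. q * mon \<mu> \<in> b)"
proof -
  let ?B = "{\<mu>. (mon \<mu> :: ('x, 'k) mpoly) \<notin> b}"
  have sub: "?B \<subseteq> {\<mu>. mdeg \<mu> \<le> N}"
    using b(2) high_mon[of _ N, where 'b='k] by (force simp: not_le)
  have fin: "finite ?B" by (rule finite_subset[OF sub finite_mdeg_le])
  have ne: "?B \<noteq> {}" using b(3) by (auto intro!: exI[of _ 0])
  define M where "M = Max (mdeg ` ?B)"
  have "M \<in> mdeg ` ?B" unfolding M_def using fin ne by (intro Max_in) auto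
  then obtain \<mu> where \<mu>: "mon \<mu> \<notin> b" "mdeg \<mu> = M" by auto
  have "mon \<nu> * mon \<mu> \<in> b" if \<nu>: "1 \<le> mdeg \<nu>" for \<nu>
  proof (rule ccontr)
    assume "mon \<nu> * mon \<mu> \<notin> b"
    then have "mdeg (\<nu> + \<mu>) \<le> M" unfolding M_def using fin by (intro Max_ge) (auto simp: mon_add)
    then show False using \<nu> \<mu>(2) by (simp add: mdeg_add)
  qed
  then have "\<forall>q\<in>high 1. q * mon \<mu> \<in> b" using high_mult_mem[OF b(1)] by blast
  then show ?thesis using \<mu>(1) by blast
qed

text \<open>An \<open>r\<close> with nonzero constant term is invertible modulo
  \<open>high 1\<close> and would bring \<open>s\<close> itself into \<open>b\<close>. Hence a
  nonzero socle element of \<open>S / b\<close> spans a copy of the residue field.\<close>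

lemma socle_multiplier:
  fixes b :: "('x::finite, 'k::field) mpoly set"
  assumes b: "is_ideal b" and s: "s \<notin> b" "\<And>q. q \<in> high 1 \<Longrightarrow> q * s \<in> b" and r: "r * s \<in> b"
  shows "r \<in> high 1"
proof (rule ccontr)
  assume "r \<notin> high 1"
  define y :: "('x, 'k) mpoly" where "y = const_poly (inverse (Poly_Mapping.lookup r 0))"
  have "(r * y - 1) * s \<in> b" unfolding y_def by (rule s(2)[OF high_1_max[OF \<open>r \<notin> high 1\<close>]])
  moreover have "y * (r * s) \<in> b" by (rule is_ideal_mult[OF b r])
  ultimately have "y * (r * s) - (r * y - 1) * s \<in> b" using is_ideal_diff[OF b] by blast
  then show False using s(1) by (simp add: algebra_simps)
qed

text \<open>
  The modules \<open>E i\<close> form a finite injective resolution of the localization of \<open>S / J\<close> at the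
  irrelevant ideal, regarded as modules over the polynomial ring, and \<open>e0\<close> is the image of one.
\<close>

locale local_injective_resolution =
  fixes J :: "('x::finite, 'k::field) mpoly set" and E :: "nat \<Rightarrow> (('x, 'k) mpoly, 'e) module"
    and d :: "nat \<Rightarrow> 'e \<Rightarrow> 'e" and e0 :: 'e and len :: nat
  assumes idl: "is_ideal J" and J_high: "J \<subseteq> high 1"
    and module_E: "\<And>i. module polyring (E i)"
    and J_E: "\<And>i p x. p \<in> J \<Longrightarrow> x \<in> carrier (E i) \<Longrightarrow> p \<odot>\<^bsub>E i\<^esub> x = \<zero>\<^bsub>E i\<^esub>"
    and baer_E: "\<And>i b G. is_ideal b \<Longrightarrow> (\<And>x. x \<in> b \<Longrightarrow> G x \<in> carrier (E i)) \<Longrightarrow>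
      (\<And>x y. x \<in> b \<Longrightarrow> y \<in> b \<Longrightarrow> G (x + y) = G x \<oplus>\<^bsub>E i\<^esub> G y) \<Longrightarrow>
      (\<And>r x. x \<in> b \<Longrightarrow> G (r * x) = r \<odot>\<^bsub>E i\<^esub> G x) \<Longrightarrow>
      (\<And>x. x \<in> b \<Longrightarrow> x \<in> J \<Longrightarrow> G x = \<zero>\<^bsub>E i\<^esub>) \<Longrightarrow> \<exists>e\<in>carrier (E i). \<forall>x\<in>b. G x = x \<odot>\<^bsub>E i\<^esub> e"
    and d_hom: "\<And>i. d i \<in> mod_hom polyring (E i) (E (Suc i))"
    and exact_E: "\<And>i. d i ` carrier (E i) = {x \<in> carrier (E (Suc i)). d (Suc i) x = \<zero>\<^bsub>E (Suc (Suc i))\<^esub>}"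
    and E_len: "\<And>i. i > len \<Longrightarrow> carrier (E i) = {\<zero>\<^bsub>E i\<^esub>}"
    and e0: "e0 \<in> carrier (E 0)" "d 0 e0 = \<zero>\<^bsub>E 1\<^esub>"
    and e0_kernel: "\<And>p. p \<odot>\<^bsub>E 0\<^esub> e0 = \<zero>\<^bsub>E 0\<^esub> \<Longrightarrow> \<exists>u. u \<notin> high 1 \<and> u * p \<in> J"
    and d0_kernel: "\<And>x. x \<in> carrier (E 0) \<Longrightarrow> d 0 x = \<zero>\<^bsub>E 1\<^esub> \<Longrightarrow>
      \<exists>u p. u \<notin> high 1 \<and> u \<odot>\<^bsub>E 0\<^esub> x = p \<odot>\<^bsub>E 0\<^esub> e0"
begin

sublocale Em: module polyring "E i" for i by (rule module_E)

lemmas E_simps [simp] = rta_module_simps(1-5,8)[OF module_E]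
lemmas E_add = rta_module_simps(9)[OF module_E]
lemmas E_radd = rta_module_simps(10)[OF module_E]
lemmas E_diff_eq_0 = rta_module_simps(12)[OF module_E]

lemma E_uminus: "x \<in> carrier (E i) \<Longrightarrow> (- s) \<odot>\<^bsub>E i\<^esub> x = \<ominus>\<^bsub>E i\<^esub> (s \<odot>\<^bsub>E i\<^esub> x)"
  using Em.smult_l_minus[of s x i] by simp

lemma E_diff: "x \<in> carrier (E i) \<Longrightarrow> (r - s) \<odot>\<^bsub>E i\<^esub> x = r \<odot>\<^bsub>E i\<^esub> x \<ominus>\<^bsub>E i\<^esub> s \<odot>\<^bsub>E i\<^esub> x"
  using E_add[of x i r "- s"] by (simp add: E_uminus Em.minus_eq)

lemma E_rdiff: "x \<in> carrier (E i) \<Longrightarrow> y \<in> carrier (E i) \<Longrightarrow>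
    r \<odot>\<^bsub>E i\<^esub> (x \<ominus>\<^bsub>E i\<^esub> y) = r \<odot>\<^bsub>E i\<^esub> x \<ominus>\<^bsub>E i\<^esub> r \<odot>\<^bsub>E i\<^esub> y"
  using E_radd[of x i "\<ominus>\<^bsub>E i\<^esub> y" r] Em.smult_r_minus[of r y i] by (simp add: Em.minus_eq)

lemma E_minus_zero [simp]: "x \<in> carrier (E i) \<Longrightarrow> x \<ominus>\<^bsub>E i\<^esub> \<zero>\<^bsub>E i\<^esub> = x"
  by (simp add: Em.minus_eq)

lemma E_minus_self [simp]: "x \<in> carrier (E i) \<Longrightarrow> x \<ominus>\<^bsub>E i\<^esub> x = \<zero>\<^bsub>E i\<^esub>"
  using E_diff_eq_0 by blast

lemma E_cong: "x \<in> carrier (E i) \<Longrightarrow> (r - s) \<odot>\<^bsub>E i\<^esub> x = \<zero>\<^bsub>E i\<^esub> \<Longrightarrow> r \<odot>\<^bsub>E i\<^esub> x = s \<odot>\<^bsub>E i\<^esub> x"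
  by (simp add: E_diff E_diff_eq_0)

lemma d_closed [simp]: "x \<in> carrier (E i) \<Longrightarrow> d i x \<in> carrier (E (Suc i))"
  using d_hom[of i] by (auto simp: mod_hom_def)

lemma d_add: "x \<in> carrier (E i) \<Longrightarrow> y \<in> carrier (E i) \<Longrightarrow> d i (x \<oplus>\<^bsub>E i\<^esub> y) = d i x \<oplus>\<^bsub>E (Suc i)\<^esub> d i y"
  using d_hom[of i] by (auto simp: mod_hom_def)

lemma d_smult: "x \<in> carrier (E i) \<Longrightarrow> d i (r \<odot>\<^bsub>E i\<^esub> x) = r \<odot>\<^bsub>E (Suc i)\<^esub> d i x"
  using d_hom[of i] by (auto simp: mod_hom_def)

lemma d_zero [simp]: "d i \<zero>\<^bsub>E i\<^esub> = \<zero>\<^bsub>E (Suc i)\<^esub>"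
  using d_smult[of "\<zero>\<^bsub>E i\<^esub>" i 0] by simp

lemma d_diff: "x \<in> carrier (E i) \<Longrightarrow> y \<in> carrier (E i) \<Longrightarrow> d i (x \<ominus>\<^bsub>E i\<^esub> y) = d i x \<ominus>\<^bsub>E (Suc i)\<^esub> d i y"
  by (rule mod_hom_diff[OF module_E module_E d_hom])

lemma d_d [simp]: "x \<in> carrier (E i) \<Longrightarrow> d (Suc i) (d i x) = \<zero>\<^bsub>E (Suc (Suc i))\<^esub>"
proof -
  assume "x \<in> carrier (E i)"
  then have "d i x \<in> d i ` carrier (E i)" by (rule imageI)
  then show ?thesis unfolding exact_E by simp
qed

lemma d_kernelE:
  assumes "x \<in> carrier (E (Suc i))" "d (Suc i) x = \<zero>\<^bsub>E (Suc (Suc i))\<^esub>"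
  obtains y where "y \<in> carrier (E i)" "d i y = x"
proof -
  have "x \<in> d i ` carrier (E i)" unfolding exact_E using assms by simp
  then show ?thesis using that by (auto elim!: imageE)
qed

text \<open>The elements of \<open>E i\<close> killed by \<open>b\<close> form
  \<open>Hom(S / b, E i)\<close>. With \<open>d\<close> they make up the complex computing Ext of
  \<open>S / b\<close>.\<close>

definition kills where "kills b i x \<longleftrightarrow> (\<forall>p\<in>b. p \<odot>\<^bsub>E i\<^esub> x = \<zero>\<^bsub>E i\<^esub>)"

lemma killsD: "kills b i x \<Longrightarrow> p \<in> b \<Longrightarrow> p \<odot>\<^bsub>E i\<^esub> x = \<zero>\<^bsub>E i\<^esub>"
  by (simp add: kills_def)

lemma kills_adjoin:
  "x \<in> carrier (E i) \<Longrightarrow> kills b i x \<Longrightarrow> s \<odot>\<^bsub>E i\<^esub> x = \<zero>\<^bsub>E i\<^esub> \<Longrightarrow> kills (adjoin b s) i x"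
  unfolding kills_def adjoin_def by (auto simp: E_add E_simps(2)[symmetric] simp del: E_simps(2))

lemma kills_d: "x \<in> carrier (E i) \<Longrightarrow> kills b i x \<Longrightarrow> kills b (Suc i) (d i x)"
  by (auto simp: kills_def d_smult[symmetric])

lemma kills_diff: "x \<in> carrier (E i) \<Longrightarrow> y \<in> carrier (E i) \<Longrightarrow> kills b i x \<Longrightarrow> kills b i y \<Longrightarrow> kills b i (x \<ominus>\<^bsub>E i\<^esub> y)"
  by (auto simp: kills_def E_rdiff)

lemma kills_J: "x \<in> carrier (E i) \<Longrightarrow> kills J i x"
  by (simp add: kills_def J_E)

text \<open>The rule \<open>r * s \<mapsto> r z\<close> defines a map on the submodule of
  \<open>S / b\<close> generated by \<open>s\<close>; injectivity extends it to
  \<open>S / b\<close>, and \<open>w\<close> is the value at one.\<close>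

lemma ext_cyclic:
  assumes b: "is_ideal b" "J \<subseteq> b" and z: "z \<in> carrier (E i)" "\<And>r. r * s \<in> b \<Longrightarrow> r \<odot>\<^bsub>E i\<^esub> z = \<zero>\<^bsub>E i\<^esub>"
  shows "\<exists>w\<in>carrier (E i). kills b i w \<and> s \<odot>\<^bsub>E i\<^esub> w = z"
proof -
  define G where "G x = (SOME r. x - r * s \<in> b) \<odot>\<^bsub>E i\<^esub> z" for x
  have G: "G x = r \<odot>\<^bsub>E i\<^esub> z" if "x - r * s \<in> b" for x r
  proof -
    define r' where "r' = (SOME r. x - r * s \<in> b)"
    have r': "x - r' * s \<in> b" unfolding r'_def by (rule someI[of _ r]) (rule that)
    have "(x - r * s) - (x - r' * s) \<in> b" by (rule is_ideal_diff[OF b(1) that r'])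
    then have "(r' - r) * s \<in> b" by (simp add: algebra_simps)
    then have "r' \<odot>\<^bsub>E i\<^esub> z = r \<odot>\<^bsub>E i\<^esub> z" using z E_cong by blast
    then show ?thesis by (simp add: G_def r'_def)
  qed
  have "\<exists>e\<in>carrier (E i). \<forall>x\<in>adjoin b s. G x = x \<odot>\<^bsub>E i\<^esub> e"
  proof (rule baer_E[OF adjoin_ideal[OF b(1)]])
    fix x assume x: "x \<in> adjoin b s"
    then obtain r where r: "x - r * s \<in> b" using adjoin_iff by blast
    show "G x \<in> carrier (E i)" using G[OF r] z by simp
    show "G x = \<zero>\<^bsub>E i\<^esub>" if "x \<in> J" using G[of x 0] b(2) that z by auto
    { fix q show "G (q * x) = q \<odot>\<^bsub>E i\<^esub> G x"
        using G[OF r] G[of "q * x" "q * r"] is_ideal_mult[OF b(1) r, of q] z by (simp add: algebra_simps) }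
    fix y assume "y \<in> adjoin b s"
    then obtain t where t: "y - t * s \<in> b" using adjoin_iff by blast
    show "G (x + y) = G x \<oplus>\<^bsub>E i\<^esub> G y"
      using G[OF r] G[OF t] G[of "x + y" "r + t"] is_ideal_add[OF b(1) r t] z by (simp add: algebra_simps E_add)
  qed
  then obtain w where w: "w \<in> carrier (E i)" "\<And>x. x \<in> adjoin b s \<Longrightarrow> G x = x \<odot>\<^bsub>E i\<^esub> w" by blast
  have "kills b i w"
    unfolding kills_def using w(2)[OF adjoin_base] G[of _ 0] z by fastforce
  moreover have "s \<odot>\<^bsub>E i\<^esub> w = z"
    using w(2)[OF adjoin_gen1[OF b(1)]] G[of s 1] is_ideal_0[OF b(1)] z by simp
  ultimately show ?thesis using w(1) by blast
qed

end

text \<open>Here \<open>f_nzd\<close> makes \<open>f\<close> regular on \<open>S / J\<close>, and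
  \<open>high_N\<close> gives the quotient by \<open>f\<close> finite length.\<close>

locale local_injective_resolution_nzd = local_injective_resolution J E d e0 len
  for J :: "('x::finite, 'k::field) mpoly set" and E :: "nat \<Rightarrow> (('x, 'k) mpoly, 'e) module"
    and d :: "nat \<Rightarrow> 'e \<Rightarrow> 'e" and e0 :: 'e and len :: nat +
  fixes f :: "('x, 'k) mpoly" and N :: nat
  assumes f_high: "f \<in> high 1" and f_nzd: "\<And>p. f * p \<in> J \<Longrightarrow> p \<in> J" and high_N: "high N \<subseteq> adjoin J f"
begin

abbreviation C where "C \<equiv> adjoin J f"

lemma C_ideal: "is_ideal C" by (rule adjoin_ideal[OF idl])

lemma J_C: "J \<subseteq> C" using adjoin_base by blast

lemma one_C: "1 \<notin> C"
proof -
  have "C \<subseteq> high 1"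
    unfolding adjoin_def using J_high is_ideal_add[OF high_ideal] is_ideal_mult[OF high_ideal f_high] by blast
  then show ?thesis using one_notin_high_1 by blast
qed

lemma kills_C: "x \<in> carrier (E i) \<Longrightarrow> f \<odot>\<^bsub>E i\<^esub> x = \<zero>\<^bsub>E i\<^esub> \<Longrightarrow> kills C i x"
  by (rule kills_adjoin[OF _ kills_J])

text \<open>Injective modules are divisible by regular elements: \<open>t'\<close> is the value at
  one of an extension of \<open>r * f \<mapsto> r t\<close>.\<close>

lemma divisible:
  assumes "t \<in> carrier (E i)"
  obtains t' where "t' \<in> carrier (E i)" "f \<odot>\<^bsub>E i\<^esub> t' = t"
proof -
  have "\<exists>w\<in>carrier (E i). kills J i w \<and> f \<odot>\<^bsub>E i\<^esub> w = t"
  proof (rule ext_cyclic[OF idl order_refl assms])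
    fix r assume "r * f \<in> J"
    then have "r \<in> J" using f_nzd[of r] by (simp add: mult.commute)
    then show "r \<odot>\<^bsub>E i\<^esub> t = \<zero>\<^bsub>E i\<^esub>" using J_E assms by blast
  qed
  then show ?thesis using that by blast
qed

text \<open>The element \<open>y\<close> stands for the fraction \<open>s / f\<close>. For
  \<open>q\<close> in the irrelevant ideal \<open>q * s\<close> is a multiple of \<open>f\<close>
  modulo \<open>J\<close>, with a cofactor \<open>r\<close> unique because \<open>f\<close> is
  regular, so \<open>q \<mapsto> r e0\<close> is a map to extend.\<close>

lemma ext_quotient:
  assumes s: "\<And>q. q \<in> high 1 \<Longrightarrow> q * s \<in> C"
  shows "\<exists>y\<in>carrier (E 0). \<forall>q\<in>high 1. \<forall>r. q * s - r * f \<in> J \<longrightarrow> q \<odot>\<^bsub>E 0\<^esub> y = r \<odot>\<^bsub>E 0\<^esub> e0"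
proof -
  define G where "G x = (SOME r. x * s - r * f \<in> J) \<odot>\<^bsub>E 0\<^esub> e0" for x
  have G: "G x = r \<odot>\<^bsub>E 0\<^esub> e0" if "x * s - r * f \<in> J" for x r
  proof -
    define r' where "r' = (SOME r. x * s - r * f \<in> J)"
    have r': "x * s - r' * f \<in> J" unfolding r'_def by (rule someI[of _ r]) (rule that)
    have "(x * s - r * f) - (x * s - r' * f) \<in> J" by (rule is_ideal_diff[OF idl that r'])
    then have "f * (r' - r) \<in> J" by (simp add: algebra_simps)
    then have "r' \<odot>\<^bsub>E 0\<^esub> e0 = r \<odot>\<^bsub>E 0\<^esub> e0" using f_nzd J_E e0 E_cong by blast
    then show ?thesis by (simp add: G_def r'_def)
  qed
  have ex: "\<exists>r. x * s - r * f \<in> J" if "x \<in> high 1" for x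
    using s[OF that] adjoin_iff by blast
  have "\<exists>e\<in>carrier (E 0). \<forall>x\<in>high 1. G x = x \<odot>\<^bsub>E 0\<^esub> e"
  proof (rule baer_E[OF high_ideal])
    fix x :: "('x, 'k) mpoly" assume x: "x \<in> high 1"
    then obtain r where r: "x * s - r * f \<in> J" using ex by blast
    show "G x \<in> carrier (E 0)" using G[OF r] e0 by simp
    show "G x = \<zero>\<^bsub>E 0\<^esub>" if "x \<in> J" using G[of x 0] is_ideal_mult2[OF idl that] e0 by simp
    { fix q show "G (q * x) = q \<odot>\<^bsub>E 0\<^esub> G x"
        using G[OF r] G[of "q * x" "q * r"] is_ideal_mult[OF idl r, of q] e0 by (simp add: algebra_simps) }
    fix y :: "('x, 'k) mpoly" assume "y \<in> high 1"
    then obtain t where t: "y * s - t * f \<in> J" using ex by blast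
    show "G (x + y) = G x \<oplus>\<^bsub>E 0\<^esub> G y"
      using G[OF r] G[OF t] G[of "x + y" "r + t"] is_ideal_add[OF idl r t] e0 by (simp add: algebra_simps E_add)
  qed
  then obtain y where y: "y \<in> carrier (E 0)" "\<And>x. x \<in> high 1 \<Longrightarrow> G x = x \<odot>\<^bsub>E 0\<^esub> y" by blast
  show ?thesis
    using y(1) y(2)[symmetric] G by (intro bexI[of _ y]) auto
qed

text \<open>
  Vanishing of \<open>Ext\<close> in degree \<open>n + 1\<close> from the cyclic modules \<open>S / b\<close> of finite length into the localization,
  read off its injective resolution.
\<close>

definition ext_vanishes :: "nat \<Rightarrow> bool" where
  "ext_vanishes n \<longleftrightarrow> (\<forall>b M. is_ideal b \<longrightarrow> J \<subseteq> b \<longrightarrow> high M \<subseteq> b \<longrightarrow>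
    (\<forall>z\<in>carrier (E (Suc n)). d (Suc n) z = \<zero>\<^bsub>E (Suc (Suc n))\<^esub> \<longrightarrow> kills b (Suc n) z \<longrightarrow>
      (\<exists>y\<in>carrier (E n). d n y = z \<and> kills b n y)))"

text \<open>
  The residue field embeds into \<open>S / C\<close> as a socle element, and \<open>Ext\<close> of \<open>S / C\<close> vanishes above degree one
  because \<open>f\<close> is regular.
\<close>

lemma ext_vanishes_residue_field:
  assumes P: "ext_vanishes (Suc (Suc k))"
    and z: "z \<in> carrier (E (Suc (Suc k)))" "d (Suc (Suc k)) z = \<zero>\<^bsub>E (Suc (Suc (Suc k)))\<^esub>" "kills (high 1) (Suc (Suc k)) z"
  shows "\<exists>y\<in>carrier (E (Suc k)). d (Suc k) y = z \<and> kills (high 1) (Suc k) y"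
proof -
  obtain \<mu> where "mon \<mu> \<notin> C" "\<forall>q\<in>high 1. q * mon \<mu> \<in> C"
    using exists_socle_monomial[OF C_ideal high_N one_C] by blast
  then obtain \<sigma> where \<sigma>: "\<sigma> \<notin> C" "\<And>q. q \<in> high 1 \<Longrightarrow> q * \<sigma> \<in> C" by blast
  let ?D = "adjoin C \<sigma>"
  have D: "is_ideal ?D" "J \<subseteq> ?D" "high N \<subseteq> ?D"
    using adjoin_ideal[OF C_ideal] adjoin_base[of _ C \<sigma>] J_C high_N by blast+
  have "r \<odot>\<^bsub>E (Suc (Suc k))\<^esub> z = \<zero>\<^bsub>E (Suc (Suc k))\<^esub>" if "r * \<sigma> \<in> C" for r
    using socle_multiplier[OF C_ideal \<sigma> that] killsD[OF z(3)] by blast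
  \<comment> \<open>The cochain \<open>z\<close> on the residue field is extended along its
    embedding into \<open>S / C\<close>. The extension need not be a cocycle, but its differential
    lives on \<open>S / ?D\<close>, where the vanishing in the next degree corrects it.\<close>
  from ext_cyclic[OF C_ideal J_C z(1) this]
  obtain w where w: "w \<in> carrier (E (Suc (Suc k)))" "kills C (Suc (Suc k)) w" "\<sigma> \<odot>\<^bsub>E (Suc (Suc k))\<^esub> w = z" by blast
  have "kills ?D (Suc (Suc (Suc k))) (d (Suc (Suc k)) w)"
    by (rule kills_adjoin[OF _ kills_d[OF w(1,2)]]) (use w z(2) in \<open>auto simp: d_smult[symmetric]\<close>)
  then obtain w' where w': "w' \<in> carrier (E (Suc (Suc k)))" "d (Suc (Suc k)) w' = d (Suc (Suc k)) w" "kills ?D (Suc (Suc k)) w'"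
    using P[unfolded ext_vanishes_def, rule_format, OF D, of "d (Suc (Suc k)) w"] w(1) by auto
  define w2 where "w2 = w \<ominus>\<^bsub>E (Suc (Suc k))\<^esub> w'"
  have w2: "w2 \<in> carrier (E (Suc (Suc k)))" "d (Suc (Suc k)) w2 = \<zero>\<^bsub>E (Suc (Suc (Suc k)))\<^esub>"
    "kills C (Suc (Suc k)) w2" "\<sigma> \<odot>\<^bsub>E (Suc (Suc k))\<^esub> w2 = z"
  proof -
    show "w2 \<in> carrier (E (Suc (Suc k)))" using w w' by (simp add: w2_def)
    show "d (Suc (Suc k)) w2 = \<zero>\<^bsub>E (Suc (Suc (Suc k)))\<^esub>" using w w' by (simp add: w2_def d_diff)
    have "kills C (Suc (Suc k)) w'" using w'(3) adjoin_base unfolding kills_def by blast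
    then show "kills C (Suc (Suc k)) w2" unfolding w2_def by (rule kills_diff[OF w(1) w'(1) w(2)])
    have "\<sigma> \<odot>\<^bsub>E (Suc (Suc k))\<^esub> w' = \<zero>\<^bsub>E (Suc (Suc k))\<^esub>" using killsD[OF w'(3) adjoin_gen1[OF C_ideal]] .
    then show "\<sigma> \<odot>\<^bsub>E (Suc (Suc k))\<^esub> w2 = z" using w w' z by (simp add: w2_def E_rdiff)
  qed
  obtain v where v: "v \<in> carrier (E (Suc k))" "d (Suc k) v = w2" using d_kernelE[OF w2(1,2)] .
  have "f \<odot>\<^bsub>E (Suc (Suc k))\<^esub> w2 = \<zero>\<^bsub>E (Suc (Suc k))\<^esub>" using killsD[OF w2(3) adjoin_gen1[OF idl]] .
  then have "d (Suc k) (f \<odot>\<^bsub>E (Suc k)\<^esub> v) = \<zero>\<^bsub>E (Suc (Suc k))\<^esub>" using v by (simp add: d_smult)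
  then obtain t where t: "t \<in> carrier (E k)" "d k t = f \<odot>\<^bsub>E (Suc k)\<^esub> v" using d_kernelE v by (metis E_simps(1))
  obtain t' where t': "t' \<in> carrier (E k)" "f \<odot>\<^bsub>E k\<^esub> t' = t" using divisible[OF t(1)] .
  \<comment> \<open>A preimage \<open>v\<close> of \<open>w2\<close> need not be killed by
    \<open>f\<close>. However \<open>f v\<close> is a boundary \<open>d k t\<close>, and after
    dividing \<open>t\<close> by \<open>f\<close> the boundary \<open>d k t'\<close> can be
    subtracted to make it so.\<close>
  define v2 where "v2 = v \<ominus>\<^bsub>E (Suc k)\<^esub> d k t'"
  have v2: "v2 \<in> carrier (E (Suc k))" "d (Suc k) v2 = w2" using v t' w2(1) by (simp_all add: v2_def d_diff)
  have "f \<odot>\<^bsub>E (Suc k)\<^esub> v2 = \<zero>\<^bsub>E (Suc k)\<^esub>"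
    using v t' t by (simp add: v2_def E_rdiff d_smult[symmetric])
  then have Cv2: "kills C (Suc k) v2" by (rule kills_C[OF v2(1)])
  show ?thesis
  proof (intro bexI conjI)
    show "\<sigma> \<odot>\<^bsub>E (Suc k)\<^esub> v2 \<in> carrier (E (Suc k))" using v2 by simp
    show "d (Suc k) (\<sigma> \<odot>\<^bsub>E (Suc k)\<^esub> v2) = z" using v2 w2 by (simp add: d_smult)
    show "kills (high 1) (Suc k) (\<sigma> \<odot>\<^bsub>E (Suc k)\<^esub> v2)"
      unfolding kills_def using v2(1) \<sigma>(2) killsD[OF Cv2] by simp
  qed
qed

text \<open>Devissage along \<open>0 \<rightarrow> k \<rightarrow> S / b \<rightarrow> S / ?D
  \<rightarrow> 0\<close>, where a socle monomial of \<open>S / b\<close> generates the residue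
  field. The number of monomials of degree at most \<open>M\<close> outside the ideal decreases. The
  residue field is handled one degree higher by \<open>ext_vanishes_residue_field\<close>.\<close>

lemma ext_vanishes_step:
  assumes P: "ext_vanishes (Suc (Suc k))"
  shows "ext_vanishes (Suc k)"
proof -
  have "\<exists>y\<in>carrier (E (Suc k)). d (Suc k) y = z \<and> kills b (Suc k) y"
    if "is_ideal b" "J \<subseteq> b" "high M \<subseteq> b" "z \<in> carrier (E (Suc (Suc k)))"
      "d (Suc (Suc k)) z = \<zero>\<^bsub>E (Suc (Suc (Suc k)))\<^esub>" "kills b (Suc (Suc k)) z" for b M z
    using that
  proof (induction "card {\<mu>. mdeg \<mu> \<le> M \<and> (mon \<mu> :: ('x, 'k) mpoly) \<notin> b}" arbitrary: b z rule: less_induct)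
    case less
    show ?case
    proof (cases "1 \<in> b")
      case True
      then have "z = \<zero>\<^bsub>E (Suc (Suc k))\<^esub>" using less.prems(4) killsD[OF less.prems(6) True] by simp
      then show ?thesis by (intro bexI[of _ "\<zero>\<^bsub>E (Suc k)\<^esub>"]) (auto simp: kills_def)
    next
      case False
      obtain \<mu> where \<mu>: "mon \<mu> \<notin> b" "\<forall>q\<in>high 1. q * mon \<mu> \<in> b"
        using exists_socle_monomial[OF less.prems(1,3) False] by blast
      define \<sigma> :: "('x, 'k) mpoly" where "\<sigma> = mon \<mu>"
      have \<sigma>: "\<sigma> \<notin> b" "\<And>q. q \<in> high 1 \<Longrightarrow> q * \<sigma> \<in> b" using \<mu> by (auto simp: \<sigma>_def)
      let ?D = "adjoin b \<sigma>"
      have D: "is_ideal ?D" "J \<subseteq> ?D" "high M \<subseteq> ?D" "b \<subseteq> ?D"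
        using adjoin_ideal[OF less.prems(1)] adjoin_base[of _ b \<sigma>] less.prems(2,3) by blast+
      note z = less.prems(4-6)
      have "kills (high 1) (Suc (Suc k)) (\<sigma> \<odot>\<^bsub>E (Suc (Suc k))\<^esub> z)"
        unfolding kills_def using z(1) \<sigma>(2) killsD[OF z(3)] by simp
      then obtain y0 where y0: "y0 \<in> carrier (E (Suc k))" "d (Suc k) y0 = \<sigma> \<odot>\<^bsub>E (Suc (Suc k))\<^esub> z" "kills (high 1) (Suc k) y0"
        using ext_vanishes_residue_field[OF P, of "\<sigma> \<odot>\<^bsub>E (Suc (Suc k))\<^esub> z"] z by (auto simp: d_smult)
      have "r \<odot>\<^bsub>E (Suc k)\<^esub> y0 = \<zero>\<^bsub>E (Suc k)\<^esub>" if "r * \<sigma> \<in> b" for r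
        using socle_multiplier[OF less.prems(1) \<sigma> that] killsD[OF y0(3)] by blast
      from ext_cyclic[OF less.prems(1,2) y0(1) this]
      obtain y1 where y1: "y1 \<in> carrier (E (Suc k))" "kills b (Suc k) y1" "\<sigma> \<odot>\<^bsub>E (Suc k)\<^esub> y1 = y0" by blast
      \<comment> \<open>On the socle line \<open>z\<close> is now the boundary of \<open>y1\<close>;
        the difference vanishes there and descends to \<open>S / ?D\<close>.\<close>
      define z' where "z' = z \<ominus>\<^bsub>E (Suc (Suc k))\<^esub> d (Suc k) y1"
      have z': "z' \<in> carrier (E (Suc (Suc k)))" "d (Suc (Suc k)) z' = \<zero>\<^bsub>E (Suc (Suc (Suc k)))\<^esub>"
        using z y1 by (simp_all add: z'_def d_diff)
      have "kills ?D (Suc (Suc k)) z'"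
      proof (rule kills_adjoin[OF z'(1)])
        show "kills b (Suc (Suc k)) z'"
          unfolding z'_def using z y1 by (intro kills_diff kills_d) auto
        show "\<sigma> \<odot>\<^bsub>E (Suc (Suc k))\<^esub> z' = \<zero>\<^bsub>E (Suc (Suc k))\<^esub>"
          unfolding z'_def using z y1 y0 by (simp add: E_rdiff d_smult[symmetric])
      qed
      moreover have "card {\<mu>. mdeg \<mu> \<le> M \<and> (mon \<mu> :: ('x, 'k) mpoly) \<notin> ?D}
          < card {\<mu>. mdeg \<mu> \<le> M \<and> (mon \<mu> :: ('x, 'k) mpoly) \<notin> b}"
      proof (rule psubset_card_mono)
        show "finite {\<mu>. mdeg \<mu> \<le> M \<and> (mon \<mu> :: ('x, 'k) mpoly) \<notin> b}"
          by (rule finite_subset[OF _ finite_mdeg_le[of M]]) auto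
        have "mdeg \<mu> < M"
        proof (rule ccontr)
          assume "\<not> mdeg \<mu> < M"
          then have "(mon \<mu> :: ('x, 'k) mpoly) \<in> high M" by (simp add: high_mon)
          then show False using less.prems(3) \<mu>(1) by blast
        qed
        moreover have "mon \<mu> \<in> ?D" using adjoin_gen1[OF less.prems(1), of \<sigma>] by (simp add: \<sigma>_def)
        ultimately show "{\<mu>. mdeg \<mu> \<le> M \<and> (mon \<mu> :: ('x, 'k) mpoly) \<notin> ?D}
          \<subset> {\<mu>. mdeg \<mu> \<le> M \<and> (mon \<mu> :: ('x, 'k) mpoly) \<notin> b}"
          using \<mu>(1) D(4) by (intro psubsetI) (auto dest: less_imp_le)
      qed
      ultimately obtain y2 where y2: "y2 \<in> carrier (E (Suc k))" "d (Suc k) y2 = z'" "kills ?D (Suc k) y2"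
        using less.hyps[OF _ D(1-3) z'] by blast
      have "d (Suc k) (y1 \<oplus>\<^bsub>E (Suc k)\<^esub> y2) = d (Suc k) y1 \<oplus>\<^bsub>E (Suc (Suc k))\<^esub> (z \<ominus>\<^bsub>E (Suc (Suc k))\<^esub> d (Suc k) y1)"
        using y1 y2 by (simp add: d_add z'_def)
      also have "\<dots> = z"
        using z(1) y1(1) by (simp add: Em.minus_eq Em.a_ac Em.r_neg1 Em.r_neg Em.r_neg2)
      finally have "d (Suc k) (y1 \<oplus>\<^bsub>E (Suc k)\<^esub> y2) = z" .
      moreover have "kills b (Suc k) (y1 \<oplus>\<^bsub>E (Suc k)\<^esub> y2)"
        using y1 y2 D(4) unfolding kills_def by (auto simp: E_radd)
      ultimately show ?thesis using y1(1) y2(1) by (intro bexI[of _ "y1 \<oplus>\<^bsub>E (Suc k)\<^esub> y2"]) auto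
    qed
  qed
  then show ?thesis unfolding ext_vanishes_def by blast
qed

text \<open>Beyond \<open>len\<close> the modules \<open>E i\<close> are zero, so the vanishing is
  trivial there and descends to Ext in degree two.\<close>

lemma ext_vanishes_1: "ext_vanishes (Suc 0)"
proof -
  have "ext_vanishes (Suc (Suc len))"
    unfolding ext_vanishes_def
  proof (intro allI ballI impI)
    fix b M z assume "z \<in> carrier (E (Suc (Suc (Suc len))))"
    then have "z = \<zero>\<^bsub>E (Suc (Suc (Suc len)))\<^esub>" using E_len[of "Suc (Suc (Suc len))"] by simp
    then show "\<exists>y\<in>carrier (E (Suc (Suc len))). d (Suc (Suc len)) y = z \<and> kills b (Suc (Suc len)) y"
      by (intro bexI[of _ "\<zero>\<^bsub>E (Suc (Suc len))\<^esub>"]) (auto simp: kills_def)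
  qed
  then show ?thesis
  proof (induction len)
    case 0
    then show ?case by (rule ext_vanishes_step)
  next
    case (Suc n)
    then show ?case using ext_vanishes_step by blast
  qed
qed

text \<open>
  If \<open>s1\<close> and \<open>s2\<close> were independent in the socle of \<open>S / C\<close>, the map fixing \<open>s1\<close> and killing \<open>s2\<close> would extend to
  multiplication by some \<open>\<beta> / v\<close>: a unit does not kill \<open>s2\<close> and a non-unit kills \<open>s1\<close>.  In terms of the
  resolution, the element \<open>a\<close> of \<open>A / f A\<close>, where \<open>A\<close> is the localization, is represented by
  \<open>d 0 y\<close> with \<open>f y = a e0\<close>.
\<close>

lemma socle_one_dimensional:
  assumes s1: "\<And>q. q \<in> high 1 \<Longrightarrow> q * s1 \<in> C" and s2: "s2 \<notin> C" "\<And>q. q \<in> high 1 \<Longrightarrow> q * s2 \<in> C"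
  shows "\<exists>c. s1 - const_poly c * s2 \<in> C"
proof (rule ccontr)
  assume neg: "\<nexists>c. s1 - const_poly c * s2 \<in> C"
  then have s1C: "s1 \<notin> C" by (metis diff_zero mult_zero_left single_zero)
  let ?C2 = "adjoin C s2"
  have C2: "is_ideal ?C2" "J \<subseteq> ?C2" "C \<subseteq> ?C2"
    using adjoin_ideal[OF C_ideal] adjoin_base[of _ C s2] J_C by blast+
  \<comment> \<open>The irrelevant ideal kills \<open>s2\<close> modulo \<open>C\<close>, so a
    coefficient \<open>r\<close> may be replaced by its constant term.\<close>
  have s1C2: "s1 \<notin> ?C2"
  proof
    assume "s1 \<in> ?C2"
    then obtain p r where p: "s1 = p + r * s2" "p \<in> C" by (auto simp: adjoin_def)
    let ?c = "const_poly (Poly_Mapping.lookup r 0)"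
    have "p + (r - ?c) * s2 \<in> C" by (rule is_ideal_add[OF C_ideal p(2) s2(2)[OF minus_const_high_1]])
    then have "s1 - ?c * s2 \<in> C" using p(1) by (simp add: algebra_simps)
    then show False using neg by blast
  qed
  let ?B = "adjoin ?C2 s1"
  have B: "is_ideal ?B" "J \<subseteq> ?B" "high N \<subseteq> ?B" "?C2 \<subseteq> ?B"
    using adjoin_ideal[OF C2(1)] adjoin_base[of _ ?C2 s1] C2 high_N by blast+
  obtain y1 where y1: "y1 \<in> carrier (E 0)"
    and y1_eq: "\<And>q r. q \<in> high 1 \<Longrightarrow> q * s1 - r * f \<in> J \<Longrightarrow> q \<odot>\<^bsub>E 0\<^esub> y1 = r \<odot>\<^bsub>E 0\<^esub> e0"
    using ext_quotient[OF s1] by blast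
  have f_y1: "f \<odot>\<^bsub>E 0\<^esub> y1 = s1 \<odot>\<^bsub>E 0\<^esub> e0"
    using y1_eq[OF f_high, of s1] is_ideal_0[OF idl] by (simp add: mult.commute)
  \<comment> \<open>As \<open>y1\<close> stands for \<open>s1 / f\<close>, its boundary represents
    \<open>s1\<close> as a homomorphism from the residue field into \<open>A / f A\<close>.\<close>
  define z1 where "z1 = d 0 y1"
  have z1: "z1 \<in> carrier (E (Suc 0))" "d (Suc 0) z1 = \<zero>\<^bsub>E (Suc (Suc 0))\<^esub>" using y1 by (simp_all add: z1_def)
  have "q \<odot>\<^bsub>E (Suc 0)\<^esub> z1 = \<zero>\<^bsub>E (Suc 0)\<^esub>" if q: "q \<in> high 1" for q
  proof -
    obtain r where "q * s1 - r * f \<in> J" using s1[OF q] adjoin_iff by blast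
    then have "q \<odot>\<^bsub>E 0\<^esub> y1 = r \<odot>\<^bsub>E 0\<^esub> e0" using y1_eq q by blast
    then show ?thesis using y1 e0 by (simp add: z1_def d_smult[symmetric]) (simp add: d_smult)
  qed
  then have "r \<odot>\<^bsub>E (Suc 0)\<^esub> z1 = \<zero>\<^bsub>E (Suc 0)\<^esub>" if "r * s1 \<in> ?C2" for r
    using socle_multiplier[OF C2(1) s1C2 _ that] s1 C2(3) by blast
  from ext_cyclic[OF C2(1,2) z1(1) this]
  obtain z where z: "z \<in> carrier (E (Suc 0))" "kills ?C2 (Suc 0) z" "s1 \<odot>\<^bsub>E (Suc 0)\<^esub> z = z1" by blast
  \<comment> \<open>The extension \<open>z\<close> to \<open>S / ?C2\<close> is made a cocycle by
    the vanishing of Ext in degree two for the quotient by \<open>?B\<close>.\<close>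
  have "kills ?B (Suc (Suc 0)) (d (Suc 0) z)"
    by (rule kills_adjoin[OF _ kills_d[OF z(1,2)]]) (use z z1 in \<open>auto simp: d_smult[symmetric]\<close>)
  then obtain z' where z': "z' \<in> carrier (E (Suc 0))" "d (Suc 0) z' = d (Suc 0) z" "kills ?B (Suc 0) z'"
    using ext_vanishes_1[unfolded ext_vanishes_def, rule_format, OF B(1-3), of "d (Suc 0) z"] z(1) by auto
  define z2 where "z2 = z \<ominus>\<^bsub>E (Suc 0)\<^esub> z'"
  have z2: "z2 \<in> carrier (E (Suc 0))" "d (Suc 0) z2 = \<zero>\<^bsub>E (Suc (Suc 0))\<^esub>" "kills ?C2 (Suc 0) z2" "s1 \<odot>\<^bsub>E (Suc 0)\<^esub> z2 = z1"
  proof -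
    show "z2 \<in> carrier (E (Suc 0))" using z z' by (simp add: z2_def)
    show "d (Suc 0) z2 = \<zero>\<^bsub>E (Suc (Suc 0))\<^esub>" using z z' by (simp add: z2_def d_diff)
    have "kills ?C2 (Suc 0) z'" using z'(3) B(4) unfolding kills_def by blast
    then show "kills ?C2 (Suc 0) z2" unfolding z2_def by (rule kills_diff[OF z(1) z'(1) z(2)])
    have "s1 \<odot>\<^bsub>E (Suc 0)\<^esub> z' = \<zero>\<^bsub>E (Suc 0)\<^esub>" using killsD[OF z'(3) adjoin_gen1[OF C2(1)]] .
    then show "s1 \<odot>\<^bsub>E (Suc 0)\<^esub> z2 = z1" using z z' z1 by (simp add: z2_def E_rdiff)
  qed
  obtain y where y: "y \<in> carrier (E 0)" "d 0 y = z2" using d_kernelE[OF z2(1,2)] .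
  have kf: "f \<odot>\<^bsub>E (Suc 0)\<^esub> z2 = \<zero>\<^bsub>E (Suc 0)\<^esub>" "s2 \<odot>\<^bsub>E (Suc 0)\<^esub> z2 = \<zero>\<^bsub>E (Suc 0)\<^esub>"
    using killsD[OF z2(3)] adjoin_gen1[OF idl, of f] C2(3) adjoin_gen1[OF C_ideal, of s2] by blast+
  \<comment> \<open>The element \<open>f y\<close> is closed, hence lies in the localization as
    \<open>\<beta> / v\<close>: this is the value at one of the map
    \<open>S / ?C2 \<rightarrow> A / f A\<close>.\<close>
  obtain v \<beta> where v: "v \<notin> high 1" "v \<odot>\<^bsub>E 0\<^esub> (f \<odot>\<^bsub>E 0\<^esub> y) = \<beta> \<odot>\<^bsub>E 0\<^esub> e0"
    using d0_kernel[of "f \<odot>\<^bsub>E 0\<^esub> y"] y kf by (auto simp: d_smult simp del: E_simps(2))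
  obtain u p where u: "u \<notin> high 1" "u \<odot>\<^bsub>E 0\<^esub> (s1 \<odot>\<^bsub>E 0\<^esub> y \<ominus>\<^bsub>E 0\<^esub> y1) = p \<odot>\<^bsub>E 0\<^esub> e0"
    using d0_kernel[of "s1 \<odot>\<^bsub>E 0\<^esub> y \<ominus>\<^bsub>E 0\<^esub> y1"] y y1 z1 z2(4) by (auto simp: d_smult d_diff z1_def[symmetric])
  obtain u' p' where u': "u' \<notin> high 1" "u' \<odot>\<^bsub>E 0\<^esub> (s2 \<odot>\<^bsub>E 0\<^esub> y) = p' \<odot>\<^bsub>E 0\<^esub> e0"
    using d0_kernel[of "s2 \<odot>\<^bsub>E 0\<^esub> y"] y kf by (auto simp: d_smult simp del: E_simps(2))
  \<comment> \<open>The equation \<open>s1 * \<beta> / v - s1 = f * p / u\<close> multiplied by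
    \<open>u * v\<close>; below, \<open>s2 * \<beta> / v = f * p' / u'\<close> is cleared in the
    same way.\<close>
  have e1: "(u * s1 * \<beta> - u * v * s1 - v * f * p) \<odot>\<^bsub>E 0\<^esub> e0 = \<zero>\<^bsub>E 0\<^esub>"
  proof -
    have "(v * f) \<odot>\<^bsub>E 0\<^esub> (u \<odot>\<^bsub>E 0\<^esub> (s1 \<odot>\<^bsub>E 0\<^esub> y \<ominus>\<^bsub>E 0\<^esub> y1)) =
        (u * s1) \<odot>\<^bsub>E 0\<^esub> (v \<odot>\<^bsub>E 0\<^esub> (f \<odot>\<^bsub>E 0\<^esub> y)) \<ominus>\<^bsub>E 0\<^esub> (u * v) \<odot>\<^bsub>E 0\<^esub> (f \<odot>\<^bsub>E 0\<^esub> y1)"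
      using y y1 by (simp add: E_rdiff mult_ac)
    then have "(v * f) \<odot>\<^bsub>E 0\<^esub> (p \<odot>\<^bsub>E 0\<^esub> e0) =
        (u * s1) \<odot>\<^bsub>E 0\<^esub> (\<beta> \<odot>\<^bsub>E 0\<^esub> e0) \<ominus>\<^bsub>E 0\<^esub> (u * v) \<odot>\<^bsub>E 0\<^esub> (s1 \<odot>\<^bsub>E 0\<^esub> e0)"
      unfolding u(2) v(2) f_y1 .
    then show ?thesis using e0 by (simp add: E_diff mult_ac)
  qed
  have e2: "(u' * s2 * \<beta> - v * f * p') \<odot>\<^bsub>E 0\<^esub> e0 = \<zero>\<^bsub>E 0\<^esub>"
  proof -
    have "(v * f) \<odot>\<^bsub>E 0\<^esub> (u' \<odot>\<^bsub>E 0\<^esub> (s2 \<odot>\<^bsub>E 0\<^esub> y)) = (u' * s2) \<odot>\<^bsub>E 0\<^esub> (v \<odot>\<^bsub>E 0\<^esub> (f \<odot>\<^bsub>E 0\<^esub> y))"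
      using y by (simp add: mult_ac)
    then have "(v * f) \<odot>\<^bsub>E 0\<^esub> (p' \<odot>\<^bsub>E 0\<^esub> e0) = (u' * s2) \<odot>\<^bsub>E 0\<^esub> (\<beta> \<odot>\<^bsub>E 0\<^esub> e0)"
      unfolding u'(2) v(2) .
    then show ?thesis using e0 by (simp add: E_diff mult_ac)
  qed
  have fC: "q * f \<in> C" for q using adjoin_gen[OF idl] .
  show False
  proof (cases "\<beta> \<in> high 1")
    case True
    obtain w where w: "w \<notin> high 1" "w * (u * s1 * \<beta> - u * v * s1 - v * f * p) \<in> J" using e0_kernel[OF e1] by blast
    have "(w * u) * (\<beta> * s1) - w * (u * s1 * \<beta> - u * v * s1 - v * f * p) - (w * v * p) * f \<in> C"
      using J_C w(2) fC is_ideal_mult[OF C_ideal s1[OF True]] by (intro is_ideal_diff[OF C_ideal]) auto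
    then have "(w * u * v) * s1 \<in> C" by (simp add: algebra_simps)
    then have "w * u * v \<in> high 1" using socle_multiplier[OF C_ideal s1C s1] by blast
    then show False using prime_high_1 w(1) u(1) v(1) by blast
  next
    case False
    obtain w where w: "w \<notin> high 1" "w * (u' * s2 * \<beta> - v * f * p') \<in> J" using e0_kernel[OF e2] by blast
    have "w * (u' * s2 * \<beta> - v * f * p') + (w * v * p') * f \<in> C"
      using J_C w(2) fC by (intro is_ideal_add[OF C_ideal]) auto
    then have "(w * u' * \<beta>) * s2 \<in> C" by (simp add: algebra_simps)
    then have "w * u' * \<beta> \<in> high 1" using socle_multiplier[OF C_ideal s2] by blast
    then show False using prime_high_1 w(1) u'(1) False by blast
  qed
qed

end

section \<open>Duality\<close>

text \<open>Otherwise the simplifier turns \<open>high 1\<close> into \<open>high (Suc 0)\<close>, which no longer matches the locale interpretations.\<close>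

declare One_nat_def [simp del]

text \<open>A nonzero constant term would itself be a component in \<open>J\<close>, and it is a
  unit.\<close>

lemma proper_hideal_subset_high_1:
  assumes "hideal J" "1 \<notin> J"
  shows "J \<subseteq> high 1"
proof
  fix p assume p: "p \<in> J"
  show "p \<in> high 1"
  proof (rule ccontr)
    assume "p \<notin> high 1"
    then have c: "Poly_Mapping.lookup p 0 \<noteq> 0" by (simp add: high_1 del: One_nat_def)
    have "hcomp 0 p = const_poly (Poly_Mapping.lookup p 0)"
      by (rule poly_mapping_eqI) (auto simp: lookup_hcomp lookup_single when_def mdeg_eq_0_iff)
    then have "const_poly (inverse (Poly_Mapping.lookup p 0)) * const_poly (Poly_Mapping.lookup p 0) \<in> J"
      using hideal_hcomp[OF assms(1) p, of 0] is_ideal_mult[OF hideal_ideal[OF assms(1)]] by metis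
    then show False using c assms(2) by (simp add: mult_single)
  qed
qed

text \<open>The Gorenstein condition is applied at the maximal ideal \<open>high 1\<close>, and the
  resulting injective resolution is turned into one over \<open>S\<close> by restricting
  scalars.\<close>

lemma gorenstein_socle_one_dimensional:
  fixes J :: "('x::finite, 'k::field) mpoly set"
  assumes J: "hideal J" "1 \<notin> J" and gor: "gorenstein_ring TYPE('e) (polyring Quot J)"
    and f: "f \<in> high 1" "\<And>p. f * p \<in> J \<Longrightarrow> p \<in> J" "high N \<subseteq> adjoin J f"
    and s1: "\<And>q. q \<in> high 1 \<Longrightarrow> q * s1 \<in> adjoin J f"
    and s2: "s2 \<notin> adjoin J f" "\<And>q. q \<in> high 1 \<Longrightarrow> q * s2 \<in> adjoin J f"
  shows "\<exists>c. s1 - const_poly c * s2 \<in> adjoin J f"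
proof -
  note Jh = proper_hideal_subset_high_1[OF J] and Ji = hideal_ideal[OF J(1)]
  interpret ql: quotient_localization J "high 1"
    using Ji Jh high_ideal high_1_max one_notin_high_1 by unfold_locales blast+
  have "finite_injective_dimension TYPE('e) ql.L (self_module ql.L)"
    using gor ql.m_maximal unfolding gorenstein_ring_def by blast
  then obtain len :: nat and E :: "nat \<Rightarrow> ((('x, 'k) mpoly set \<times> ('x, 'k) mpoly set) set, 'e) module" and \<eta> d where
    E: "\<And>i. injective_module ql.L (E i)" and len: "\<And>i. i > len \<Longrightarrow> carrier (E i) = {\<zero>\<^bsub>E i\<^esub>}"
    and \<eta>: "\<eta> \<in> mod_hom ql.L (self_module ql.L) (E 0)" "inj_on \<eta> (carrier (self_module ql.L))"
    and d: "\<And>i. d i \<in> mod_hom ql.L (E i) (E (Suc i))"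
    and ex0: "\<eta> ` carrier (self_module ql.L) = {x \<in> carrier (E 0). d 0 x = \<zero>\<^bsub>E 1\<^esub>}"
    and ex: "\<And>i. d i ` carrier (E i) = {x \<in> carrier (E (Suc i)). d (Suc i) x = \<zero>\<^bsub>E (Suc (Suc i))\<^esub>}"
    unfolding finite_injective_dimension_def by (elim exE conjE) (rule that, blast+)
  have mE: "module ql.L (E i)" for i using E by (simp add: injective_module_def)
  interpret L: cring ql.L using mE[of 0] by (simp add: module_def)
  interpret E0: module ql.L "E 0" by (rule mE)
  have \<eta>c: "\<eta> x \<in> carrier (E 0)" if "x \<in> carrier ql.L" for x
    using \<eta>(1) that by (auto simp: mod_hom_def)
  have \<eta>1: "\<eta> (ql.frc p 1) = ql.frc p 1 \<odot>\<^bsub>E 0\<^esub> \<eta> \<one>\<^bsub>ql.L\<^esub>" for p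
  proof -
    have "\<eta> (ql.frc p 1 \<otimes>\<^bsub>ql.L\<^esub> \<one>\<^bsub>ql.L\<^esub>) = ql.frc p 1 \<odot>\<^bsub>E 0\<^esub> \<eta> \<one>\<^bsub>ql.L\<^esub>"
      using \<eta>(1) ql.frc_carrier[OF ql.one_m, of p] L.one_closed unfolding mod_hom_def self_module_simps by blast
    then show ?thesis using ql.frc_carrier[OF ql.one_m, of p] by simp
  qed
  have \<eta>0: "\<eta> (ql.frc 0 1) = \<zero>\<^bsub>E 0\<^esub>"
    using \<eta>1[of 0] \<eta>c[OF L.one_closed] by (simp add: ql.L_zero[symmetric])
  interpret res: local_injective_resolution J "\<lambda>i. ql.restrict_scalars (E i)" d "\<eta> \<one>\<^bsub>ql.L\<^esub>" len
  proof (rule local_injective_resolution.intro)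
    show "is_ideal J" "J \<subseteq> high 1" by (rule Ji, rule Jh)
    show "\<And>i. module polyring (ql.restrict_scalars (E i))" by (rule ql.restrict_scalars_module[OF mE])
    show "\<And>i p x. p \<in> J \<Longrightarrow> x \<in> carrier (ql.restrict_scalars (E i)) \<Longrightarrow>
        p \<odot>\<^bsub>ql.restrict_scalars (E i)\<^esub> x = \<zero>\<^bsub>ql.restrict_scalars (E i)\<^esub>"
      using ql.restrict_scalars_J[OF mE] by simp
    show "\<And>i. d i \<in> mod_hom polyring (ql.restrict_scalars (E i)) (ql.restrict_scalars (E (Suc i)))"
      using d ql.frc_carrier[OF ql.one_m] by (auto simp: mod_hom_def)
    show "\<And>i. d i ` carrier (ql.restrict_scalars (E i)) = {x \<in> carrier (ql.restrict_scalars (E (Suc i))).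
        d (Suc i) x = \<zero>\<^bsub>ql.restrict_scalars (E (Suc (Suc i)))\<^esub>}"
      using ex by simp
    show "\<And>i. i > len \<Longrightarrow> carrier (ql.restrict_scalars (E i)) = {\<zero>\<^bsub>ql.restrict_scalars (E i)\<^esub>}"
      using len by simp
    show "\<eta> \<one>\<^bsub>ql.L\<^esub> \<in> carrier (ql.restrict_scalars (E 0))" using \<eta>c[OF L.one_closed] by simp
    have "\<eta> \<one>\<^bsub>ql.L\<^esub> \<in> {x \<in> carrier (E 0). d 0 x = \<zero>\<^bsub>E 1\<^esub>}"
      unfolding ex0[symmetric] self_module_simps by (rule imageI[OF L.one_closed])
    then show "d 0 (\<eta> \<one>\<^bsub>ql.L\<^esub>) = \<zero>\<^bsub>ql.restrict_scalars (E 1)\<^esub>" by simp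
  next
    fix p assume "p \<odot>\<^bsub>ql.restrict_scalars (E 0)\<^esub> \<eta> \<one>\<^bsub>ql.L\<^esub> = \<zero>\<^bsub>ql.restrict_scalars (E 0)\<^esub>"
    then have "\<eta> (ql.frc p 1) = \<eta> (ql.frc 0 1)" using \<eta>1 \<eta>0 by simp
    then have "ql.frc p 1 = ql.frc 0 1"
      using inj_onD[OF \<eta>(2)] ql.frc_carrier[OF ql.one_m] by simp
    then show "\<exists>u. u \<notin> high 1 \<and> u * p \<in> J"
      using ql.frc_eq_iff[OF ql.one_m ql.one_m] by (simp add: ql.fequiv_def)
  next
    fix x assume "x \<in> carrier (ql.restrict_scalars (E 0))" "d 0 x = \<zero>\<^bsub>ql.restrict_scalars (E 1)\<^esub>"
    then have "x \<in> \<eta> ` carrier (self_module ql.L)" unfolding ex0 by simp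
    then obtain l where "x = \<eta> l" "l \<in> carrier ql.L" by auto
    then obtain p s where s: "x = \<eta> (ql.frc p s)" "s \<notin> high 1" by (auto simp: ql.L_carrier)
    have "ql.frc s 1 \<odot>\<^bsub>E 0\<^esub> x = \<eta> (ql.frc s 1 \<otimes>\<^bsub>ql.L\<^esub> ql.frc p s)"
      using \<eta>(1) ql.frc_carrier[OF ql.one_m, of s] ql.frc_carrier[OF s(2), of p]
      unfolding s(1) mod_hom_def self_module_simps by (auto simp del: One_nat_def)
    also have "ql.frc s 1 \<otimes>\<^bsub>ql.L\<^esub> ql.frc p s = ql.frc p 1"
      using ql.L_mult[OF ql.one_m s(2), of s p] ql.frc_cancel[OF ql.one_m s(2), of p] by simp
    finally show "\<exists>u p. u \<notin> high 1 \<and> u \<odot>\<^bsub>ql.restrict_scalars (E 0)\<^esub> x = p \<odot>\<^bsub>ql.restrict_scalars (E 0)\<^esub> \<eta> \<one>\<^bsub>ql.L\<^esub>"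
      using s(2) \<eta>1[of p] by (intro exI[of _ s] exI[of _ p]) simp
  next
    fix i b and G :: "('x, 'k) mpoly \<Rightarrow> 'e" assume "is_ideal b"
      "\<And>x. x \<in> b \<Longrightarrow> G x \<in> carrier (ql.restrict_scalars (E i))"
      "\<And>x y. x \<in> b \<Longrightarrow> y \<in> b \<Longrightarrow> G (x + y) = G x \<oplus>\<^bsub>ql.restrict_scalars (E i)\<^esub> G y"
      "\<And>r x. x \<in> b \<Longrightarrow> G (r * x) = r \<odot>\<^bsub>ql.restrict_scalars (E i)\<^esub> G x"
      "\<And>x. x \<in> b \<Longrightarrow> x \<in> J \<Longrightarrow> G x = \<zero>\<^bsub>ql.restrict_scalars (E i)\<^esub>"
    then show "\<exists>e\<in>carrier (ql.restrict_scalars (E i)). \<forall>x\<in>b. G x = x \<odot>\<^bsub>ql.restrict_scalars (E i)\<^esub> e"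
      using ql.baer[OF E, of b G i] by simp
  qed
  interpret local_injective_resolution_nzd J "\<lambda>i. ql.restrict_scalars (E i)" d "\<eta> \<one>\<^bsub>ql.L\<^esub>" len f N
    using f by unfold_locales
  show ?thesis by (rule socle_one_dimensional[OF s1 s2])
qed

section \<open>Linear functionals and self-duality of \<open>S / C\<close>\<close>

definition k_linear :: "(('x::finite, 'k::field) mpoly \<Rightarrow> 'k) \<Rightarrow> bool" where
  "k_linear \<phi> \<longleftrightarrow> (\<forall>x y. \<phi> (x + y) = \<phi> x + \<phi> y) \<and> (\<forall>c x. \<phi> (const_poly c * x) = c * \<phi> x)"

lemma k_linear_add: "k_linear \<phi> \<Longrightarrow> \<phi> (x + y) = \<phi> x + \<phi> y"
  and k_linear_const: "k_linear \<phi> \<Longrightarrow> \<phi> (const_poly c * x) = c * \<phi> x"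
  by (auto simp: k_linear_def)

lemma k_linear_0: "k_linear \<phi> \<Longrightarrow> \<phi> 0 = 0"
  using k_linear_const[of \<phi> 0 0] by simp

lemma k_linear_diff: "k_linear \<phi> \<Longrightarrow> \<phi> (x - y) = \<phi> x - \<phi> y"
  using k_linear_add[of \<phi> "x - y" y] by simp

lemma k_linear_sum: "k_linear \<phi> \<Longrightarrow> \<phi> (sum g A) = (\<Sum>i\<in>A. \<phi> (g i))"
  by (induction A rule: infinite_finite_induct) (auto simp: k_linear_0 k_linear_add)

text \<open>Adding \<open>u\<close> to \<open>B\<close> either changes nothing on the common kernel
  of \<open>B\<close>, or some \<open>h0\<close> there has \<open>\<phi> u h0\<close> nonzero.
  Evaluation at \<open>h0\<close> then forces the coefficient of \<open>\<phi> u\<close>.\<close>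

lemma functional_in_span:
  assumes "finite B" "\<And>b. b \<in> B \<Longrightarrow> k_linear (\<phi> b)" "k_linear \<psi>"
    "\<And>h. (\<And>b. b \<in> B \<Longrightarrow> \<phi> b h = 0) \<Longrightarrow> \<psi> h = 0"
  shows "\<exists>c. \<forall>h. \<psi> h = (\<Sum>b\<in>B. c b * \<phi> b h)"
  using assms
proof (induction B arbitrary: \<psi> rule: finite_induct)
  case (insert u B)
  have ex: "\<exists>c. \<forall>h. \<psi> h = (\<Sum>b\<in>insert u B. c b * \<phi> b h)"
    if "\<And>h. \<psi> h = (\<Sum>b\<in>B. c b * \<phi> b h) + a * \<phi> u h" for c a
    using that insert.hyps
    by (intro exI[of _ "c(u := a)"]) (auto simp: add.commute intro!: sum.cong)
  show ?case
  proof (cases "\<exists>h0. (\<forall>b\<in>B. \<phi> b h0 = 0) \<and> \<phi> u h0 \<noteq> 0")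
    case True
    then obtain h0 where h0: "\<And>b. b \<in> B \<Longrightarrow> \<phi> b h0 = 0" "\<phi> u h0 \<noteq> 0" by blast
    define a where "a = \<psi> h0 / \<phi> u h0"
    have lu: "k_linear (\<phi> u)" using insert.prems by blast
    have "\<exists>c. \<forall>h. \<psi> h - a * \<phi> u h = (\<Sum>b\<in>B. c b * \<phi> b h)"
    proof (rule insert.IH)
      show "k_linear (\<lambda>h. \<psi> h - a * \<phi> u h)"
        using insert.prems(2) lu by (simp add: k_linear_def algebra_simps)
      fix h assume h: "\<And>b. b \<in> B \<Longrightarrow> \<phi> b h = 0"
      let ?r = "\<phi> u h / \<phi> u h0"
      have "\<psi> (h - const_poly ?r * h0) = 0"
      proof (rule insert.prems(3))
        fix b assume "b \<in> insert u B"
        then show "\<phi> b (h - const_poly ?r * h0) = 0"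
          using h h0 insert.prems(1) by (auto simp: k_linear_diff k_linear_const)
      qed
      then show "\<psi> h - a * \<phi> u h = 0"
        using insert.prems(2) by (simp add: k_linear_diff k_linear_const a_def)
    qed (use insert.prems in blast)
    then obtain c where "\<And>h. \<psi> h - a * \<phi> u h = (\<Sum>b\<in>B. c b * \<phi> b h)" by blast
    then have "\<psi> h = (\<Sum>b\<in>B. c b * \<phi> b h) + a * \<phi> u h" for h by (simp add: diff_eq_eq)
    then show ?thesis by (rule ex)
  next
    case False
    have "\<exists>c. \<forall>h. \<psi> h = (\<Sum>b\<in>B. c b * \<phi> b h)"
    proof (rule insert.IH)
      fix h assume h: "\<And>b. b \<in> B \<Longrightarrow> \<phi> b h = 0"
      with False have "\<phi> u h = 0" by blast
      with h show "\<psi> h = 0" by (intro insert.prems(3)) auto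
    qed (use insert.prems in blast)+
    then show ?thesis using ex[of _ 0] by auto
  qed
qed simp

text \<open>The quotient by \<open>J + (f)\<close> vanishes above degree \<open>w\<close>, and its
  socle is the line spanned by the class of \<open>\<sigma>\<close> in degree
  \<open>w\<close>.\<close>

locale artinian_gorenstein =
  fixes J :: "('x::finite, 'k::field) mpoly set" and f :: "('x, 'k) mpoly" and t :: nat and w :: int
    and \<sigma> :: "('x, 'k) mpoly"
  assumes hom: "hideal J" and f_piece: "f \<in> poly_piece (int t)"
    and top: "\<And>e. e > w \<Longrightarrow> poly_piece e \<subseteq> adjoin J f"
    and \<sigma>: "\<sigma> \<in> poly_piece w" "\<sigma> \<notin> adjoin J f"
    and socle: "\<And>s. (\<And>q. q \<in> high 1 \<Longrightarrow> q * s \<in> adjoin J f) \<Longrightarrow> \<exists>c. s - const_poly c * \<sigma> \<in> adjoin J f"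
begin

abbreviation C where "C \<equiv> adjoin J f"

lemmas idl = hideal_ideal[OF hom]

lemma C_ideal: "is_ideal C" by (rule adjoin_ideal[OF idl])

lemma C_hideal: "hideal C"
  unfolding hideal_def
proof (intro conjI ballI allI)
  fix p e assume "p \<in> C"
  then obtain j r where p: "p = j + r * f" "j \<in> J" by (auto simp: adjoin_def)
  have "hcomp e p = hcomp e j + hcomp (e - int t) r * f"
    using hcomp_mult_piece[OF f_piece, of e r] by (simp add: p hcomp_add mult.commute)
  then show "hcomp e p \<in> C" unfolding adjoin_def using hideal_hcomp[OF hom p(2)] by blast
qed (rule C_ideal)

lemmas high_C = high_subset_if_pieces[OF C_ideal top]

text \<open>The piece of top degree consists of socle elements and is therefore spanned by
  \<open>\<sigma>\<close>; \<open>\<tau>\<close> is the coordinate along it.\<close>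

definition \<tau> :: "('x, 'k) mpoly \<Rightarrow> 'k" where
  "\<tau> p = (THE c. hcomp w p - const_poly c * \<sigma> \<in> C)"

lemma tau_unique: "p - const_poly c * \<sigma> \<in> C \<Longrightarrow> p - const_poly c' * \<sigma> \<in> C \<Longrightarrow> c = c'"
proof (rule ccontr)
  assume a: "p - const_poly c * \<sigma> \<in> C" "p - const_poly c' * \<sigma> \<in> C" "c \<noteq> c'"
  have "(p - const_poly c' * \<sigma>) - (p - const_poly c * \<sigma>) \<in> C" by (rule is_ideal_diff[OF C_ideal a(2,1)])
  then have "const_poly (c - c') * \<sigma> \<in> C" by (simp add: single_diff algebra_simps)
  then have "const_poly (inverse (c - c')) * (const_poly (c - c') * \<sigma>) \<in> C" by (rule is_ideal_mult[OF C_ideal])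
  then show False using a(3) \<sigma>(2) by (simp add: mult.assoc[symmetric] mult_single)
qed

lemma tau_eq: "hcomp w p - const_poly c * \<sigma> \<in> C \<Longrightarrow> \<tau> p = c"
  unfolding \<tau>_def using tau_unique by (intro the_equality)

lemma tau: "hcomp w p - const_poly (\<tau> p) * \<sigma> \<in> C"
proof -
  obtain c where c: "hcomp w p - const_poly c * \<sigma> \<in> C"
    using socle[OF top_piece_socle[OF C_ideal top hcomp_in_piece]] by blast
  then show ?thesis using tau_eq[OF c] by simp
qed

lemma tau_linear: "k_linear \<tau>"
  unfolding k_linear_def
proof (intro conjI allI)
  fix x y c
  have "hcomp w (x + y) - const_poly (\<tau> x + \<tau> y) * \<sigma> \<in> C"
    using is_ideal_add[OF C_ideal tau[of x] tau[of y]] by (simp add: hcomp_add const_poly_add algebra_simps)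
  then show "\<tau> (x + y) = \<tau> x + \<tau> y" by (rule tau_eq)
  have "hcomp w (const_poly c * x) - const_poly (c * \<tau> x) * \<sigma> \<in> C"
    using is_ideal_mult[OF C_ideal tau[of x], of "const_poly c"]
    by (simp only: hcomp_const const_poly_mult right_diff_distrib mult.assoc)
  then show "\<tau> (const_poly c * x) = c * \<tau> x" by (rule tau_eq)
qed

lemma tau_C: "p \<in> C \<Longrightarrow> \<tau> p = 0"
  by (rule tau_eq) (simp add: hideal_hcomp[OF C_hideal])

lemma tau_hcomp: "\<tau> (hcomp w p) = \<tau> p"
  by (rule tau_eq) (simp add: hcomp_piece[OF hcomp_in_piece] tau)

text \<open>Every nonzero class has a monomial multiple that is a nonzero socle element, hence a
  nonzero multiple of \<open>\<sigma>\<close>, and \<open>\<tau>\<close> detects it.\<close>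

lemma tau_nondegenerate:
  assumes "\<And>r. \<tau> (r * p) = 0"
  shows "p \<in> C"
proof (rule ccontr)
  assume p: "p \<notin> C"
  let ?b = "{q. q * p \<in> C}"
  have b: "is_ideal ?b" by (rule is_ideal_colon[OF C_ideal])
  have "high (nat (w + 1)) \<subseteq> ?b" using high_C is_ideal_mult2[OF C_ideal] by blast
  from exists_socle_monomial[OF b this] p
  obtain \<mu> where \<mu>: "mon \<mu> * p \<notin> C" "\<And>q. q \<in> high 1 \<Longrightarrow> q * (mon \<mu> * p) \<in> C"
    by (auto simp: mult.assoc)
  obtain c where c: "mon \<mu> * p - const_poly c * \<sigma> \<in> C" using socle[OF \<mu>(2)] by blast
  have "hcomp w (mon \<mu> * p) - const_poly c * \<sigma> \<in> C"
    using hideal_hcomp[OF C_hideal c, of w] by (simp add: hcomp_diff hcomp_const hcomp_piece[OF \<sigma>(1)])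
  then have "c = 0" using tau_eq assms by metis
  then show False using c \<mu>(1) by simp
qed

lemma tau_mult_linear: "k_linear (\<lambda>h. \<tau> (u * h))"
  using k_linear_add[OF tau_linear] k_linear_const[OF tau_linear]
  by (simp add: k_linear_def distrib_left mult.left_commute[of u])

text \<open>When \<open>u\<close> is added, either some \<open>h'\<close> pairs to zero with
  \<open>B\<close> but not with \<open>u\<close>, and \<open>h\<close> is corrected by a multiple of
  it, or the functional of \<open>u\<close> is a combination of those of \<open>B\<close>. In the
  second case nondegeneracy makes \<open>u\<close> the same combination modulo \<open>C\<close>, so
  \<open>\<mu> u\<close> is already right.\<close>

lemma tau_represents_finite:
  assumes \<mu>: "k_linear \<mu>" "\<And>p. p \<in> C \<Longrightarrow> \<mu> p = 0" and B: "finite B"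
  shows "\<exists>h. \<forall>b\<in>B. \<mu> b = \<tau> (b * h)"
  using B
proof induction
  case (insert u B)
  then obtain h where h: "\<And>b. b \<in> B \<Longrightarrow> \<mu> b = \<tau> (b * h)" by blast
  show ?case
  proof (cases "\<exists>h'. (\<forall>b\<in>B. \<tau> (b * h') = 0) \<and> \<tau> (u * h') \<noteq> 0")
    case True
    then obtain h' where h': "\<And>b. b \<in> B \<Longrightarrow> \<tau> (b * h') = 0" "\<tau> (u * h') \<noteq> 0" by blast
    define c where "c = (\<mu> u - \<tau> (u * h)) / \<tau> (u * h')"
    have "\<tau> (b * (h + const_poly c * h')) = \<tau> (b * h) + c * \<tau> (b * h')" for b
      using k_linear_add[OF tau_mult_linear, of b] k_linear_const[OF tau_mult_linear, of b] by simp
    then show ?thesis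
      using h h' by (intro exI[of _ "h + const_poly c * h'"]) (auto simp: c_def)
  next
    case False
    have "\<exists>c. \<forall>h. \<tau> (u * h) = (\<Sum>b\<in>B. c b * \<tau> (b * h))"
      using False insert.hyps by (intro functional_in_span tau_mult_linear) auto
    then obtain c where c: "\<And>h. \<tau> (u * h) = (\<Sum>b\<in>B. c b * \<tau> (b * h))" by blast
    let ?v = "u - (\<Sum>b\<in>B. const_poly (c b) * b)"
    have "\<tau> (r * ?v) = 0" for r
    proof -
      have "r * ?v = u * r - (\<Sum>b\<in>B. const_poly (c b) * (b * r))"
        by (simp add: right_diff_distrib sum_distrib_left mult_ac)
      then show ?thesis
        using c[of r] by (simp add: k_linear_diff[OF tau_linear] k_linear_sum[OF tau_linear] k_linear_const[OF tau_linear])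
    qed
    then have "\<mu> ?v = 0" using tau_nondegenerate \<mu>(2) by blast
    then have "\<mu> u = (\<Sum>b\<in>B. c b * \<mu> b)"
      by (simp add: k_linear_diff[OF \<mu>(1)] k_linear_sum[OF \<mu>(1)] k_linear_const[OF \<mu>(1)])
    also have "\<dots> = \<tau> (u * h)" using h by (simp add: c)
    finally show ?thesis using h by (intro exI[of _ h]) auto
  qed
qed simp

text \<open>Monomials of large degree lie in \<open>C\<close>, where both sides vanish, so finitely
  many remain to be matched.\<close>

lemma tau_represents:
  assumes \<mu>: "k_linear \<mu>" "\<And>p. p \<in> C \<Longrightarrow> \<mu> p = 0"
  shows "\<exists>h. \<forall>r. \<mu> r = \<tau> (r * h)"
proof -
  let ?B = "{mon m :: ('x, 'k) mpoly | m. mdeg m \<le> nat (w + 1)}"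
  have "finite ?B" using finite_mdeg_le[where 'x='x, of "nat (w + 1)"] by simp
  then have "\<exists>h. \<forall>b\<in>?B. \<mu> b = \<tau> (b * h)" by (intro tau_represents_finite \<mu>)
  then obtain h where h: "\<forall>b\<in>?B. \<mu> b = \<tau> (b * h)" by (elim exE)
  have mon: "\<mu> (mon m) = \<tau> (mon m * h)" for m
  proof (cases "mdeg m \<le> nat (w + 1)")
    case True
    then show ?thesis using h by blast
  next
    case False
    then have "mon m \<in> C" using high_C high_mon[of m "nat (w + 1)", where 'b='k] by auto
    then show ?thesis using \<mu>(2) tau_C is_ideal_mult2[OF C_ideal] by metis
  qed
  have "\<mu> r = \<tau> (r * h)" for r
  proof -
    let ?S = "\<Sum>m\<in>Poly_Mapping.keys r. const_poly (Poly_Mapping.lookup r m) * mon m"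
    have r: "r = ?S" by (rule mpoly_expand) auto
    have "\<mu> ?S = (\<Sum>m\<in>Poly_Mapping.keys r. Poly_Mapping.lookup r m * \<tau> (mon m * h))"
      by (simp only: k_linear_sum[OF \<mu>(1)] k_linear_const[OF \<mu>(1)] mon)
    also have "\<dots> = \<tau> (?S * h)"
      by (simp only: sum_distrib_right mult.assoc k_linear_sum[OF tau_linear] k_linear_const[OF tau_linear])
    finally have "\<mu> ?S = \<tau> (?S * h)" .
    then show ?thesis using r by simp
  qed
  then show ?thesis by blast
qed

lemma tau_mult_piece: "r \<in> poly_piece i \<Longrightarrow> \<tau> (r * h) = \<tau> (r * hcomp (w - i) h)"
  by (metis hcomp_mult_piece tau_hcomp)

end

section \<open>Homomorphisms of graded modules\<close>

lemma ideal_quot_simps: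
  fixes I :: "('x::finite, 'k::field) mpoly set"
  assumes I: "is_ideal I"
  shows "carrier (ideal_quot J I) = cs I ` J"
    "ring.zero (ideal_quot J I) = I"
    "add (ideal_quot J I) (cs I x) (cs I y) = cs I (x + y)"
    "module.smult (ideal_quot J I) r (cs I x) = cs I (r * x)"
    "ideal_quot_piece J I e = cs I ` (J \<inter> poly_piece e)"
proof -
  have c: "a_r_coset (self_module polyring\<lparr>carrier := J\<rparr>) I y = cs I y" for y
    by (rule a_r_coset_cs) simp
  show "carrier (ideal_quot J I) = cs I ` J"
    by (auto simp: ideal_quot_def quot_module_def A_RCOSETS_def' c)
  show "ring.zero (ideal_quot J I) = I" by (simp add: ideal_quot_def quot_module_def)
  show "add (ideal_quot J I) (cs I x) (cs I y) = cs I (x + y)"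
    using cs_set_add[OF I, of "self_module polyring\<lparr>carrier := J\<rparr>"] by (simp add: ideal_quot_def quot_module_def)
  have "cs I (r * y) = cs I (r * x)" if "y \<in> cs I x" for y
    using that is_ideal_mult[OF I, of "y - x" r] by (simp add: cs_eq_iff[OF I] cs_mem right_diff_distrib)
  then have "(\<Union>y\<in>cs I x. cs I (r * y)) = cs I (r * x)" using cs_self[OF I, of x] by blast
  then show "module.smult (ideal_quot J I) r (cs I x) = cs I (r * x)"
    by (simp add: ideal_quot_def quot_module_def c)
  show "ideal_quot_piece J I e = cs I ` (J \<inter> poly_piece e)"
    by (simp add: ideal_quot_piece_def quot_grading_def c)
qed

lemma mod_hom_cs:
  fixes I :: "('x::finite, 'k::field) mpoly set"
  assumes I: "is_ideal I" and h: "h \<in> mod_hom polyring M (ideal_quot J I)"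
  shows "x \<in> carrier M \<Longrightarrow> \<exists>p\<in>J. h x = cs I p"
    "x \<in> carrier M \<Longrightarrow> y \<in> carrier M \<Longrightarrow> h x = cs I p \<Longrightarrow> h y = cs I q \<Longrightarrow> h (x \<oplus>\<^bsub>M\<^esub> y) = cs I (p + q)"
    "x \<in> carrier M \<Longrightarrow> h x = cs I p \<Longrightarrow> h (r \<odot>\<^bsub>M\<^esub> x) = cs I (r * p)"
  using mod_homD[OF h] by (simp_all add: ideal_quot_simps[OF I] image_iff)

lemma mod_hom_cs_diff:
  fixes I :: "('x::finite, 'k::field) mpoly set"
  assumes I: "is_ideal I" and h: "h \<in> mod_hom polyring M (ideal_quot J I)" and M: "module polyring M"
    and "x \<in> carrier M" "y \<in> carrier M" "h x = cs I p" "h y = cs I q"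
  shows "h (x \<ominus>\<^bsub>M\<^esub> y) = cs I (p - q)"
  using mod_hom_cs(2)[OF I h, of x "(-1) \<odot>\<^bsub>M\<^esub> y" p "- q"] mod_hom_cs(3)[OF I h, of y q "-1"] assms
  by (simp add: rta_module_simps[OF M])

lemma mod_hom_cs_finsum:
  fixes I :: "('x::finite, 'k::field) mpoly set"
  assumes I: "is_ideal I" and h: "h \<in> mod_hom polyring M (ideal_quot J I)" and M: "module polyring M"
    and A: "finite A" and g: "\<And>i. i \<in> A \<Longrightarrow> g i \<in> carrier M" "\<And>i. i \<in> A \<Longrightarrow> h (g i) = cs I (q i)"
  shows "h (finsum M g A) = cs I (\<Sum>i\<in>A. q i)"
proof -
  interpret M: module polyring M by fact
  show ?thesis using A g
  proof (induction A)
    case empty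
    have "h \<zero>\<^bsub>M\<^esub> = h (0 \<odot>\<^bsub>M\<^esub> \<zero>\<^bsub>M\<^esub>)" by simp
    also obtain p where "h \<zero>\<^bsub>M\<^esub> = cs I p" using mod_hom_cs(1)[OF I h] by blast
    then have "h (0 \<odot>\<^bsub>M\<^esub> \<zero>\<^bsub>M\<^esub>) = cs I (0 * p)" by (intro mod_hom_cs(3)[OF I h]) auto
    finally show ?case by simp
  next
    case (insert i A)
    then have "finsum M g (insert i A) = g i \<oplus>\<^bsub>M\<^esub> finsum M g A" by (intro M.finsum_insert) auto
    then show ?case
      using insert mod_hom_cs(2)[OF I h, of "g i" "finsum M g A" "q i" "\<Sum>i\<in>A. q i"] by (auto intro: M.finsum_closed)
  qed
qed

lemma mod_hom_finsum:
  fixes M :: "('r::comm_ring_1, 'm, 'd) module_scheme" and N :: "('r, 'n, 'e) module_scheme"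
  assumes M: "module ring_of_type_algebra M" and N: "module ring_of_type_algebra N"
    and h: "h \<in> mod_hom ring_of_type_algebra M N"
    and A: "finite A" and g: "\<And>i. i \<in> A \<Longrightarrow> g i \<in> carrier M"
  shows "h (finsum M g A) = finsum N (\<lambda>i. h (g i)) A"
proof -
  interpret M: module ring_of_type_algebra M by fact
  interpret N: module ring_of_type_algebra N by fact
  show ?thesis using A g
  proof (induction A)
    case empty
    have "h (0 \<odot>\<^bsub>M\<^esub> \<zero>\<^bsub>M\<^esub>) = 0 \<odot>\<^bsub>N\<^esub> h \<zero>\<^bsub>M\<^esub>" by (rule mod_homD(3)[OF h]) simp
    then show ?case using mod_homD(1)[OF h, of "\<zero>\<^bsub>M\<^esub>"] by (simp add: rta_module_simps[OF M] rta_module_simps[OF N])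
  next
    case (insert i A)
    then have "finsum M g (insert i A) = g i \<oplus>\<^bsub>M\<^esub> finsum M g A" by (intro M.finsum_insert) auto
    moreover have "finsum N (\<lambda>i. h (g i)) (insert i A) = h (g i) \<oplus>\<^bsub>N\<^esub> finsum N (\<lambda>i. h (g i)) A"
      using insert mod_homD(1)[OF h] by (intro N.finsum_insert) auto
    ultimately show ?case
      using insert mod_homD(2)[OF h] by (auto intro: M.finsum_closed)
  qed
qed

text \<open>The family concentrated in degree \<open>e\<close> and the family \<open>c\<close> both
  decompose the same element, and decompositions are unique.\<close>

lemma graded_module_component:
  assumes "graded_module N G" and A: "finite A" "e \<in> A" and c: "\<And>i. i \<in> A \<Longrightarrow> c i \<in> G i"
    and z: "finsum N c A \<in> G e"
  shows "finsum N c A = c e"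
proof -
  interpret N: module polyring N using assms(1) by (simp add: graded_module_def)
  have sub: "subgroup (G i) (add_monoid N)" for i using assms(1) by (simp add: graded_module_def)
  have G0: "\<zero>\<^bsub>N\<^esub> \<in> G i" for i using subgroup.one_closed[OF sub[of i]] by simp
  have GN: "G i \<subseteq> carrier N" for i using subgroup.subset[OF sub[of i]] by simp
  define z where "z = finsum N c A"
  define c1 where "c1 i = (if i = e then z else \<zero>\<^bsub>N\<^esub>)" for i
  define c2 where "c2 i = (if i \<in> A then c i else \<zero>\<^bsub>N\<^esub>)" for i
  have zc: "z \<in> carrier N" "z \<in> G e" using GN assms z_def by auto
  have "\<exists>!c. (\<forall>e. c e \<in> G e) \<and> finite {e. c e \<noteq> \<zero>\<^bsub>N\<^esub>} \<and> z = finsum N c {e. c e \<noteq> \<zero>\<^bsub>N\<^esub>}"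
    using assms(1) zc unfolding graded_module_def by blast
  moreover have "(\<forall>e. c1 e \<in> G e) \<and> finite {e. c1 e \<noteq> \<zero>\<^bsub>N\<^esub>} \<and> z = finsum N c1 {e. c1 e \<noteq> \<zero>\<^bsub>N\<^esub>}"
  proof (intro conjI allI)
    show "c1 i \<in> G i" for i using zc G0 by (simp add: c1_def)
    show "finite {e. c1 e \<noteq> \<zero>\<^bsub>N\<^esub>}" by (rule finite_subset[of _ "{e}"]) (auto simp: c1_def)
    show "z = finsum N c1 {e. c1 e \<noteq> \<zero>\<^bsub>N\<^esub>}"
    proof (cases "z = \<zero>\<^bsub>N\<^esub>")
      case True
      then have "{e. c1 e \<noteq> \<zero>\<^bsub>N\<^esub>} = {}" by (auto simp: c1_def)
      then show ?thesis using True by simp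
    next
      case False
      then have "{e. c1 e \<noteq> \<zero>\<^bsub>N\<^esub>} = {e}" by (auto simp: c1_def)
      then show ?thesis using zc by (simp add: c1_def)
    qed
  qed
  moreover have "(\<forall>e. c2 e \<in> G e) \<and> finite {e. c2 e \<noteq> \<zero>\<^bsub>N\<^esub>} \<and> z = finsum N c2 {e. c2 e \<noteq> \<zero>\<^bsub>N\<^esub>}"
  proof (intro conjI allI)
    show "c2 i \<in> G i" for i using c G0 by (simp add: c2_def)
    have s: "{e. c2 e \<noteq> \<zero>\<^bsub>N\<^esub>} \<subseteq> A" by (auto simp: c2_def)
    then show "finite {e. c2 e \<noteq> \<zero>\<^bsub>N\<^esub>}" using A(1) by (rule finite_subset)
    show "z = finsum N c2 {e. c2 e \<noteq> \<zero>\<^bsub>N\<^esub>}"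
      unfolding z_def using A s c GN
      by (intro N.add.finprod_mono_neutral_cong_right) (auto simp: c2_def)
  qed
  ultimately have "c1 = c2" by blast
  then have "c1 e = c2 e" by simp
  then show ?thesis using A(2) by (simp add: c1_def c2_def z_def)
qed

lemma graded_module_decompose:
  assumes "graded_module N G" "x \<in> carrier N"
  obtains c A where "finite A" "\<And>i. c i \<in> G i" "x = finsum N c A"
  using assms unfolding graded_module_def by metis

lemma graded_module_piece_subset: "graded_module N G \<Longrightarrow> G e \<subseteq> carrier N"
  using subgroup.subset[of "G e" "add_monoid N"] by (simp add: graded_module_def)

text \<open>The component of \<open>x\<close> in degree \<open>e\<close> works, since the other
  components map into other degrees of a homogeneous element.\<close>

lemma graded_hom_lift:
  assumes M: "graded_module M GM" and N: "graded_module N GN" and h: "h \<in> homogeneous_hom M GM N GN 0"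
    and x: "x \<in> carrier M" "h x \<in> GN e"
  shows "\<exists>x'\<in>GM e. h x' = h x"
proof -
  have mM: "module polyring M" and mN: "module polyring N" using M N by (auto simp: graded_module_def)
  interpret M: module polyring M by (rule mM)
  have hm: "h \<in> mod_hom polyring M N" and hG: "\<And>i y. y \<in> GM i \<Longrightarrow> h y \<in> GN i"
    using h by (auto simp: homogeneous_hom_def)
  obtain c A where c: "finite A" "\<And>i. c i \<in> GM i" "x = finsum M c A"
    using graded_module_decompose[OF M x(1)] by blast
  have cc: "c i \<in> carrier M" for i using c(2) graded_module_piece_subset[OF M] by blast
  \<comment> \<open>Extending \<open>c\<close> by zero allows \<open>e\<close> to be added to the
    index set even when it is not in \<open>A\<close>.\<close>
  define c' where "c' i = (if i \<in> A then c i else \<zero>\<^bsub>M\<^esub>)" for i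
  have c'G: "c' i \<in> GM i" for i
    using c(2) subgroup.one_closed[of "GM i" "add_monoid M"] M by (simp add: c'_def graded_module_def)
  have c'c: "c' i \<in> carrier M" for i using cc by (simp add: c'_def)
  have "finsum M c A = finsum M c' (insert e A)"
    using c(1) cc by (intro M.add.finprod_mono_neutral_cong_left) (auto simp: c'_def)
  then have "h x = finsum N (\<lambda>i. h (c' i)) (insert e A)"
    using mod_hom_finsum[OF mM mN hm, of "insert e A" c'] c c'c by simp
  moreover have "finsum N (\<lambda>i. h (c' i)) (insert e A) = h (c' e)"
    using calculation c(1) x(2) hG[OF c'G] by (intro graded_module_component[OF N]) auto
  ultimately show ?thesis using c'G[of e] by auto
qed

definition lin_comb :: "('r, 'f) module \<Rightarrow> nat \<Rightarrow> (nat \<Rightarrow> 'f) \<Rightarrow> (nat \<Rightarrow> 'r) \<Rightarrow> 'f" where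
  "lin_comb M n b s = finsum M (\<lambda>j. s j \<odot>\<^bsub>M\<^esub> b j) {..<n}"

lemma lin_comb_simps:
  fixes M :: "('r::comm_ring_1, 'f) module"
  assumes M: "module ring_of_type_algebra M" and b: "\<And>j. j < n \<Longrightarrow> b j \<in> carrier M"
  shows "lin_comb M n b s \<in> carrier M"
    "lin_comb M n b (\<lambda>j. s j + s' j) = lin_comb M n b s \<oplus>\<^bsub>M\<^esub> lin_comb M n b s'"
    "lin_comb M n b (\<lambda>j. r * s j) = r \<odot>\<^bsub>M\<^esub> lin_comb M n b s"
    "lin_comb M n b (\<lambda>j. 0) = \<zero>\<^bsub>M\<^esub>"
proof -
  interpret M: module ring_of_type_algebra M by fact
  note simps = rta_module_simps[OF M]
  show "lin_comb M n b s \<in> carrier M"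
    unfolding lin_comb_def using b simps by (intro M.finsum_closed) auto
  show "lin_comb M n b (\<lambda>j. s j + s' j) = lin_comb M n b s \<oplus>\<^bsub>M\<^esub> lin_comb M n b s'"
  proof -
    have "lin_comb M n b (\<lambda>j. s j + s' j) = finsum M (\<lambda>j. s j \<odot>\<^bsub>M\<^esub> b j \<oplus>\<^bsub>M\<^esub> s' j \<odot>\<^bsub>M\<^esub> b j) {..<n}"
      unfolding lin_comb_def using b by (intro M.finsum_cong') (auto simp: simps)
    then show ?thesis unfolding lin_comb_def using b by (simp add: M.finsum_addf simps)
  qed
  show "lin_comb M n b (\<lambda>j. r * s j) = r \<odot>\<^bsub>M\<^esub> lin_comb M n b s"
  proof -
    have "lin_comb M n b (\<lambda>j. r * s j) = finsum M (\<lambda>j. r \<odot>\<^bsub>M\<^esub> (s j \<odot>\<^bsub>M\<^esub> b j)) {..<n}"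
      unfolding lin_comb_def using b by (intro M.finsum_cong') (auto simp: simps)
    then show ?thesis unfolding lin_comb_def using b by (subst M.finsum_smult_ldistr) (auto simp: simps)
  qed
  show "lin_comb M n b (\<lambda>j. 0) = \<zero>\<^bsub>M\<^esub>"
    unfolding lin_comb_def using b by (intro M.add.finprod_one_eqI) (auto simp: simps)
qed

lemma lin_comb_sum:
  fixes M :: "('r::comm_ring_1, 'f) module"
  assumes M: "module ring_of_type_algebra M" and b: "\<And>j. j < n \<Longrightarrow> b j \<in> carrier M" and "finite D"
  shows "lin_comb M n b (\<lambda>j. \<Sum>i\<in>D. s i j) = finsum M (\<lambda>i. lin_comb M n b (s i)) D"
proof -
  interpret M: module ring_of_type_algebra M by fact
  show ?thesis using assms(3)
  proof induction
    case empty
    then show ?case using lin_comb_simps(4)[OF M b] by simp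
  next
    case (insert i D)
    then show ?case using lin_comb_simps(1,2)[OF M b] by (simp add: M.finsum_insert Pi_iff)
  qed
qed

lemma mod_hom_lin_comb:
  fixes I :: "('x::finite, 'k::field) mpoly set"
  assumes I: "is_ideal I" and h: "h \<in> mod_hom polyring M (ideal_quot J I)" and M: "module polyring M"
    and b: "\<And>j. j < n \<Longrightarrow> b j \<in> carrier M" "\<And>j. j < n \<Longrightarrow> h (b j) = cs I (q j)"
  shows "h (lin_comb M n b s) = cs I (\<Sum>j<n. s j * q j)"
  unfolding lin_comb_def using b mod_hom_cs(3)[OF I h]
  by (intro mod_hom_cs_finsum[OF I h M]) (auto simp: rta_module_simps[OF M])

section \<open>The functional of a cocycle\<close>

lemma ex1_unique: "\<exists>!x. P x \<Longrightarrow> P a \<Longrightarrow> P b \<Longrightarrow> a = b"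
  by blast

text \<open>The top degree is \<open>a + int t\<close>, and \<open>f_J\<close> says that
  \<open>f\<close> kills \<open>J / I\<close>.\<close>

locale ext_computation = artinian_gorenstein J f t "a + int t" \<sigma>
  for J :: "('x::finite, 'k::field) mpoly set" and f t a \<sigma> +
  fixes I :: "('x, 'k) mpoly set" and F :: "nat \<Rightarrow> (('x, 'k) mpoly, 'f) module" and GF d \<epsilon>
  assumes I_hom: "hideal I" and I_J: "I \<subseteq> J" and f_J: "\<And>j. j \<in> J \<Longrightarrow> f * j \<in> I"
    and f_nzd: "\<And>p. f * p \<in> J \<Longrightarrow> p \<in> J"
    and res: "graded_free_resolution (ideal_quot J I) (ideal_quot_piece J I) F GF d \<epsilon>"
begin

abbreviation R where "R \<equiv> ideal_quot UNIV J"
abbreviation F0 where "F0 \<equiv> F 0"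
abbreviation F1 where "F1 \<equiv> F (Suc 0)"
abbreviation F2 where "F2 \<equiv> F (Suc (Suc 0))"

lemmas I_ideal = hideal_ideal[OF I_hom]
lemmas R_simps = ideal_quot_simps[OF idl]
lemmas M_simps = ideal_quot_simps[OF I_ideal]

lemma F_graded: "graded_module (F i) (GF i)"
  using res by (simp add: graded_free_resolution_def graded_free_module_def)

lemma F_module: "module polyring (F i)"
  using F_graded by (simp add: graded_module_def)

lemmas F_simps [simp] = rta_module_simps(1-8)[OF F_module]
lemmas F_distr = rta_module_simps(9-11)[OF F_module]
lemmas F_diff_eq_0 = rta_module_simps(12)[OF F_module]

lemma GF_carrier: "x \<in> GF i e \<Longrightarrow> x \<in> carrier (F i)"
  using graded_module_piece_subset[OF F_graded] by blast

lemma eps_hom: "\<epsilon> \<in> homogeneous_hom F0 (GF 0) (ideal_quot J I) (ideal_quot_piece J I) 0"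
  and d_hom: "d i \<in> homogeneous_hom (F (Suc i)) (GF (Suc i)) (F i) (GF i) 0"
  and eps_surj: "\<epsilon> ` carrier F0 = carrier (ideal_quot J I)"
  and exact0: "d 0 ` carrier F1 = {x \<in> carrier F0. \<epsilon> x = I}"
  and exact1: "d (Suc 0) ` carrier F2 = {x \<in> carrier F1. d 0 x = \<zero>\<^bsub>F0\<^esub>}"
  using res by (simp_all add: graded_free_resolution_def M_simps One_nat_def)

lemma eps_mod_hom: "\<epsilon> \<in> mod_hom polyring F0 (ideal_quot J I)"
  and eps_graded: "x \<in> GF 0 e \<Longrightarrow> \<epsilon> x \<in> cs I ` (J \<inter> poly_piece e)"
  and d_mod_hom: "d i \<in> mod_hom polyring (F (Suc i)) (F i)"
  and d_graded: "y \<in> GF (Suc i) e \<Longrightarrow> d i y \<in> GF i e"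
  using eps_hom d_hom[of i] by (auto simp: homogeneous_hom_def M_simps image_subset_iff)

lemma d_closed [simp]: "x \<in> carrier (F (Suc i)) \<Longrightarrow> d i x \<in> carrier (F i)"
  and d_add: "x \<in> carrier (F (Suc i)) \<Longrightarrow> y \<in> carrier (F (Suc i)) \<Longrightarrow> d i (x \<oplus>\<^bsub>F (Suc i)\<^esub> y) = d i x \<oplus>\<^bsub>F i\<^esub> d i y"
  and d_smult: "x \<in> carrier (F (Suc i)) \<Longrightarrow> d i (r \<odot>\<^bsub>F (Suc i)\<^esub> x) = r \<odot>\<^bsub>F i\<^esub> d i x"
  using mod_homD[OF d_mod_hom] by blast+

lemma d_diff: "x \<in> carrier (F (Suc i)) \<Longrightarrow> y \<in> carrier (F (Suc i)) \<Longrightarrow> d i (x \<ominus>\<^bsub>F (Suc i)\<^esub> y) = d i x \<ominus>\<^bsub>F i\<^esub> d i y"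
  by (rule mod_hom_diff[OF F_module F_module d_mod_hom])

lemma eps_lift: "j \<in> J \<Longrightarrow> \<exists>y\<in>carrier F0. \<epsilon> y = cs I j"
proof -
  assume "j \<in> J"
  then have "cs I j \<in> \<epsilon> ` carrier F0" unfolding eps_surj M_simps by (rule imageI)
  then show ?thesis by auto
qed

lemma eps_kernel_lift: "y \<in> carrier F0 \<Longrightarrow> \<epsilon> y = I \<Longrightarrow> \<exists>x\<in>carrier F1. d 0 x = y"
proof -
  assume "y \<in> carrier F0" "\<epsilon> y = I"
  then have "y \<in> d 0 ` carrier F1" unfolding exact0 by simp
  then show ?thesis by auto
qed

lemma eps_d0: "x \<in> carrier F1 \<Longrightarrow> \<epsilon> (d 0 x) = I"
proof -
  assume "x \<in> carrier F1"
  then have "d 0 x \<in> d 0 ` carrier F1" by (rule imageI)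
  then show ?thesis unfolding exact0 by simp
qed

lemma d0_d1: "x \<in> carrier F2 \<Longrightarrow> d 0 (d (Suc 0) x) = \<zero>\<^bsub>F0\<^esub>"
proof -
  assume "x \<in> carrier F2"
  then have "d (Suc 0) x \<in> d (Suc 0) ` carrier F2" by (rule imageI)
  then show ?thesis unfolding exact1 by simp
qed

text \<open>As \<open>f\<close> kills \<open>J / I\<close>, the element \<open>f y\<close> has image
  zero and comes from \<open>F1\<close>: the lift on which cocycles are evaluated.\<close>

lemma d0_lift: "y \<in> carrier F0 \<Longrightarrow> \<exists>x\<in>carrier F1. d 0 x = f \<odot>\<^bsub>F0\<^esub> y"
proof (rule eps_kernel_lift)
  assume y: "y \<in> carrier F0"
  then obtain j where j: "j \<in> J" "\<epsilon> y = cs I j" using mod_hom_cs(1)[OF I_ideal eps_mod_hom] by blast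
  have "\<epsilon> (f \<odot>\<^bsub>F0\<^esub> y) = cs I (f * j)" by (rule mod_hom_cs(3)[OF I_ideal eps_mod_hom y j(2)])
  then show "\<epsilon> (f \<odot>\<^bsub>F0\<^esub> y) = I" using f_J[OF j(1)] cs_eq_iff[OF I_ideal, of "f * j" 0] by (simp add: cs_0)
qed simp

definition tauR :: "('x, 'k) mpoly set \<Rightarrow> 'k" where "tauR c = \<tau> (SOME p. p \<in> c)"

lemma tauR_cs [simp]: "tauR (cs J p) = \<tau> p"
proof -
  have "(SOME q. q \<in> cs J p) \<in> cs J p" by (rule someI[of _ p]) (rule cs_self[OF idl])
  then have "(SOME q. q \<in> cs J p) - p \<in> C" using adjoin_base by (simp add: cs_mem)
  from tau_C[OF this] show ?thesis by (simp add: tauR_def k_linear_diff[OF tau_linear])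
qed

abbreviation Z where "Z \<equiv> cocycles polyring F d R (Suc 0)"

lemma Z_iff: "\<phi> \<in> Z \<longleftrightarrow> \<phi> \<in> mod_hom polyring F1 R \<and> \<phi> \<in> extensional (carrier F1) \<and>
    (\<forall>x\<in>carrier F2. \<phi> (d (Suc 0) x) = J)"
  by (auto simp: cocycles_def Hom_module_def R_simps)

lemma Z_mod_hom: "\<phi> \<in> Z \<Longrightarrow> \<phi> \<in> mod_hom polyring F1 R"
  by (simp add: Z_iff)

lemma Z_cs: "\<phi> \<in> Z \<Longrightarrow> x \<in> carrier F1 \<Longrightarrow> \<exists>p. \<phi> x = cs J p"
  using mod_hom_cs(1)[OF idl Z_mod_hom] by blast

lemmas Z_add = mod_hom_cs(2)[OF idl Z_mod_hom]
lemmas Z_smult = mod_hom_cs(3)[OF idl Z_mod_hom]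
lemmas Z_diff = mod_hom_cs_diff[OF idl Z_mod_hom F_module]

lemma Z_kernel: "\<phi> \<in> Z \<Longrightarrow> x \<in> carrier F1 \<Longrightarrow> d 0 x = \<zero>\<^bsub>F0\<^esub> \<Longrightarrow> \<phi> x = cs J 0"
proof -
  assume \<phi>: "\<phi> \<in> Z" and x: "x \<in> carrier F1" "d 0 x = \<zero>\<^bsub>F0\<^esub>"
  then have "x \<in> d (Suc 0) ` carrier F2" unfolding exact1 by simp
  then show ?thesis using \<phi> by (auto simp: Z_iff cs_0)
qed

text \<open>Elements with equal image differ by the image of \<open>F2\<close>, where cocycles
  vanish; so a cocycle is a map on the syzygies of \<open>J / I\<close>.\<close>

lemma Z_eq: "\<phi> \<in> Z \<Longrightarrow> x \<in> carrier F1 \<Longrightarrow> y \<in> carrier F1 \<Longrightarrow> d 0 x = d 0 y \<Longrightarrow> \<phi> x = \<phi> y"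
proof -
  assume \<phi>: "\<phi> \<in> Z" and x: "x \<in> carrier F1" and y: "y \<in> carrier F1" and e: "d 0 x = d 0 y"
  obtain p where p: "\<phi> x = cs J p" using Z_cs[OF \<phi> x] by blast
  obtain q where q: "\<phi> y = cs J q" using Z_cs[OF \<phi> y] by blast
  note pq = p q
  have "d 0 (x \<ominus>\<^bsub>F1\<^esub> y) = \<zero>\<^bsub>F0\<^esub>"
    using d_diff[OF x y] F_diff_eq_0[of "d 0 x" 0 "d 0 y"] e x y by simp
  then have "cs J (p - q) = cs J 0"
    using Z_kernel[OF \<phi>, of "x \<ominus>\<^bsub>F1\<^esub> y"] Z_diff[OF \<phi> x y pq] x y by simp
  then show ?thesis using pq cs_eq_iff[OF idl] by simp
qed

text \<open>
  A cocycle \<open>\<phi>\<close> induces a map \<open>J / I \<rightarrow> S / (J + (f))\<close>, sending the class of \<open>j\<close> to the class of \<open>\<phi> x\<close>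
  where \<open>d 0 x\<close> is \<open>f\<close> times a lift of \<open>j\<close>; composing it with \<open>\<tau>\<close> gives the functional \<open>Phi \<phi>\<close>.
\<close>

definition Phi :: "('f \<Rightarrow> ('x, 'k) mpoly set) \<Rightarrow> ('x, 'k) mpoly \<Rightarrow> 'k" where
  "Phi \<phi> j = (THE v. \<exists>x\<in>carrier F1. \<exists>y\<in>carrier F0. d 0 x = f \<odot>\<^bsub>F0\<^esub> y \<and> \<epsilon> y = cs I j \<and> v = tauR (\<phi> x))"

text \<open>If \<open>y\<close> lies over zero, then \<open>y = d 0 u\<close> and
  \<open>\<phi> x\<close> is \<open>f\<close> times \<open>\<phi> u\<close>. This is what makes
  \<open>Phi\<close> independent of its choices.\<close>

lemma Phi_zero:
  assumes \<phi>: "\<phi> \<in> Z" and x: "x \<in> carrier F1" and y: "y \<in> carrier F0" and e: "d 0 x = f \<odot>\<^bsub>F0\<^esub> y" "\<epsilon> y = I"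
  shows "tauR (\<phi> x) = 0"
proof -
  obtain u where u: "u \<in> carrier F1" "d 0 u = y" using eps_kernel_lift[OF y e(2)] by blast
  obtain p where p: "\<phi> u = cs J p" using Z_cs[OF \<phi> u(1)] by blast
  have "\<phi> x = \<phi> (f \<odot>\<^bsub>F1\<^esub> u)" by (rule Z_eq[OF \<phi> x]) (use u e in \<open>simp_all add: d_smult\<close>)
  also have "\<dots> = cs J (f * p)" by (rule Z_smult[OF \<phi> u(1) p])
  finally show ?thesis using tau_C[of "p * f"] adjoin_gen[OF idl, of p f] by (simp add: mult.commute)
qed

lemma Phi_eq:
  assumes \<phi>: "\<phi> \<in> Z" and x: "x \<in> carrier F1" and y: "y \<in> carrier F0" and e: "d 0 x = f \<odot>\<^bsub>F0\<^esub> y" "\<epsilon> y = cs I j"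
  shows "Phi \<phi> j = tauR (\<phi> x)"
  unfolding Phi_def
proof (rule the_equality)
  show "\<exists>x'\<in>carrier F1. \<exists>y\<in>carrier F0. d 0 x' = f \<odot>\<^bsub>F0\<^esub> y \<and> \<epsilon> y = cs I j \<and> tauR (\<phi> x) = tauR (\<phi> x')"
    using x y e by blast
  fix v assume "\<exists>x\<in>carrier F1. \<exists>y\<in>carrier F0. d 0 x = f \<odot>\<^bsub>F0\<^esub> y \<and> \<epsilon> y = cs I j \<and> v = tauR (\<phi> x)"
  then obtain x' y' where x': "x' \<in> carrier F1" "y' \<in> carrier F0" "d 0 x' = f \<odot>\<^bsub>F0\<^esub> y'" "\<epsilon> y' = cs I j"
    and v: "v = tauR (\<phi> x')" by blast
  obtain q q' where q: "\<phi> x = cs J q" and q': "\<phi> x' = cs J q'"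
    using Z_cs[OF \<phi> x] Z_cs[OF \<phi> x'(1)] by blast
  have "tauR (\<phi> (x \<ominus>\<^bsub>F1\<^esub> x')) = 0"
  proof (rule Phi_zero[OF \<phi>])
    show "d 0 (x \<ominus>\<^bsub>F1\<^esub> x') = f \<odot>\<^bsub>F0\<^esub> (y \<ominus>\<^bsub>F0\<^esub> y')"
      using x x' y e by (simp add: d_add d_smult F_distr mult.commute)
    show "\<epsilon> (y \<ominus>\<^bsub>F0\<^esub> y') = I"
      using mod_hom_cs_diff[OF I_ideal eps_mod_hom F_module y x'(2) e(2) x'(4)] by (simp add: cs_0)
  qed (use x x' y in auto)
  then have "\<tau> (q - q') = 0" using Z_diff[OF \<phi> x x'(1) q q'] by simp
  then show "v = tauR (\<phi> x)" using v q q' by (simp add: k_linear_diff[OF tau_linear])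
qed

lemma Phi_lift:
  assumes \<phi>: "\<phi> \<in> Z" and j: "j \<in> J"
  obtains x y p where "x \<in> carrier F1" "y \<in> carrier F0" "d 0 x = f \<odot>\<^bsub>F0\<^esub> y" "\<epsilon> y = cs I j"
    "\<phi> x = cs J p" "Phi \<phi> j = \<tau> p"
proof -
  obtain y where y: "y \<in> carrier F0" "\<epsilon> y = cs I j" using eps_lift[OF j] by blast
  obtain x where x: "x \<in> carrier F1" "d 0 x = f \<odot>\<^bsub>F0\<^esub> y" using d0_lift[OF y(1)] by blast
  obtain p where p: "\<phi> x = cs J p" using Z_cs[OF \<phi> x(1)] by blast
  show ?thesis using that[OF x(1) y(1) x(2) y(2) p] Phi_eq[OF \<phi> x(1) y(1) x(2) y(2)] p by simp
qed

lemma Phi_add: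
  assumes \<phi>: "\<phi> \<in> Z" and j: "j \<in> J" "j' \<in> J"
  shows "Phi \<phi> (j + j') = Phi \<phi> j + Phi \<phi> j'"
proof -
  obtain x y p where 1: "x \<in> carrier F1" "y \<in> carrier F0" "d 0 x = f \<odot>\<^bsub>F0\<^esub> y" "\<epsilon> y = cs I j"
    "\<phi> x = cs J p" "Phi \<phi> j = \<tau> p" using Phi_lift[OF \<phi> j(1)] .
  obtain x' y' p' where 2: "x' \<in> carrier F1" "y' \<in> carrier F0" "d 0 x' = f \<odot>\<^bsub>F0\<^esub> y'" "\<epsilon> y' = cs I j'"
    "\<phi> x' = cs J p'" "Phi \<phi> j' = \<tau> p'" using Phi_lift[OF \<phi> j(2)] .
  have "Phi \<phi> (j + j') = tauR (\<phi> (x \<oplus>\<^bsub>F1\<^esub> x'))"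
    using 1 2 mod_hom_cs(2)[OF I_ideal eps_mod_hom 1(2) 2(2) 1(4) 2(4)]
    by (intro Phi_eq[OF \<phi>, of _ "y \<oplus>\<^bsub>F0\<^esub> y'"]) (auto simp: d_add F_distr)
  also have "\<dots> = \<tau> (p + p')" using Z_add[OF \<phi> 1(1) 2(1) 1(5) 2(5)] by simp
  finally show ?thesis using 1 2 by (simp add: k_linear_add[OF tau_linear])
qed

text \<open>Linearity over \<open>S\<close> of the induced map
  \<open>J / I \<rightarrow> S / C\<close>, kept in this form because \<open>Phi\<close> itself
  takes values in the field.\<close>

lemma Phi_mult:
  assumes \<phi>: "\<phi> \<in> Z" and x: "x \<in> carrier F1" and y: "y \<in> carrier F0" and e: "d 0 x = f \<odot>\<^bsub>F0\<^esub> y" "\<epsilon> y = cs I j"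
    and p: "\<phi> x = cs J p"
  shows "Phi \<phi> (r * j) = \<tau> (r * p)"
proof -
  have "Phi \<phi> (r * j) = tauR (\<phi> (r \<odot>\<^bsub>F1\<^esub> x))"
    using x y e mod_hom_cs(3)[OF I_ideal eps_mod_hom y e(2), of r]
    by (intro Phi_eq[OF \<phi>, of _ "r \<odot>\<^bsub>F0\<^esub> y"]) (auto simp: d_smult mult.commute)
  then show ?thesis using Z_smult[OF \<phi> x p] by simp
qed

lemma Phi_const: "\<phi> \<in> Z \<Longrightarrow> j \<in> J \<Longrightarrow> Phi \<phi> (const_poly c * j) = c * Phi \<phi> j"
  using Phi_lift[of \<phi> j] Phi_mult[of \<phi> _ _ j _ "const_poly c"] k_linear_const[OF tau_linear, of c] by metis

lemma Phi_I: "\<phi> \<in> Z \<Longrightarrow> j \<in> I \<Longrightarrow> Phi \<phi> j = 0"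
proof -
  assume \<phi>: "\<phi> \<in> Z" and j: "j \<in> I"
  obtain x y p where 1: "x \<in> carrier F1" "y \<in> carrier F0" "d 0 x = f \<odot>\<^bsub>F0\<^esub> y" "\<epsilon> y = cs I j"
    "\<phi> x = cs J p" "Phi \<phi> j = \<tau> p" using Phi_lift[OF \<phi>, of j] j I_J by blast
  have "\<epsilon> y = I" using 1(4) j cs_eq_iff[OF I_ideal, of j 0] by (simp add: cs_0)
  then show ?thesis using Phi_zero[OF \<phi> 1(1-3)] 1(5,6) by simp
qed

text \<open>The target \<open>S / C\<close> of the induced map is annihilated by
  \<open>J\<close>.\<close>

lemma Phi_square: "\<phi> \<in> Z \<Longrightarrow> i \<in> J \<Longrightarrow> j \<in> J \<Longrightarrow> Phi \<phi> (i * j) = 0"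
proof -
  assume \<phi>: "\<phi> \<in> Z" and i: "i \<in> J" and j: "j \<in> J"
  obtain x y p where 1: "x \<in> carrier F1" "y \<in> carrier F0" "d 0 x = f \<odot>\<^bsub>F0\<^esub> y" "\<epsilon> y = cs I j"
    "\<phi> x = cs J p" "Phi \<phi> j = \<tau> p" using Phi_lift[OF \<phi> j] .
  have "i * p \<in> C" using adjoin_base is_ideal_mult2[OF idl i] by blast
  then show ?thesis using Phi_mult[OF \<phi> 1(1-5), of i] tau_C by simp
qed

section \<open>The ideal \<open>I + J^2\<close>\<close>

definition I' :: "('x, 'k) mpoly set" where "I' = I <+>\<^bsub>polyring\<^esub> (J \<cdot>\<^bsub>polyring\<^esub> J)"

lemma J2_ideal: "is_ideal (J \<cdot>\<^bsub>polyring\<^esub> J)"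
  using ring.ideal_prod_is_ideal[OF cring.axioms(1)[OF cring_rta], of J J] by (simp add: ideal_rta_iff idl)

lemma I'_iff: "p \<in> I' \<longleftrightarrow> (\<exists>i\<in>I. \<exists>s\<in>J \<cdot>\<^bsub>polyring\<^esub> J. p = i + s)"
  by (auto simp: I'_def set_add_def')

lemma I'_ideal: "is_ideal I'"
proof (rule is_idealI)
  show "0 \<in> I'" unfolding I'_iff using is_ideal_0[OF I_ideal] is_ideal_0[OF J2_ideal] by (intro bexI[of _ 0]) auto
next
  fix p q assume "p \<in> I'" "q \<in> I'"
  then obtain i s i' s' where "p = i + s" "q = i' + s'" "i \<in> I" "i' \<in> I" "s \<in> J \<cdot>\<^bsub>polyring\<^esub> J" "s' \<in> J \<cdot>\<^bsub>polyring\<^esub> J"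
    unfolding I'_iff by blast
  then show "p + q \<in> I'"
    unfolding I'_iff using is_ideal_add[OF I_ideal, of i i'] is_ideal_add[OF J2_ideal, of s s']
    by (intro bexI[of _ "i + i'"] bexI[of _ "s + s'"]) auto
next
  fix r p assume "p \<in> I'"
  then obtain i s where "p = i + s" "i \<in> I" "s \<in> J \<cdot>\<^bsub>polyring\<^esub> J" unfolding I'_iff by blast
  then show "r * p \<in> I'"
    unfolding I'_iff using is_ideal_mult[OF I_ideal, of i r] is_ideal_mult[OF J2_ideal, of s r]
    by (intro bexI[of _ "r * i"] bexI[of _ "r * s"]) (auto simp: distrib_left)
qed

lemma I_I': "I \<subseteq> I'"
  using is_ideal_0[OF J2_ideal] by (force simp: I'_iff)

lemma J2_I': "i \<in> J \<Longrightarrow> j \<in> J \<Longrightarrow> i * j \<in> I'"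
  unfolding I'_iff using is_ideal_0[OF I_ideal] ideal_prod.prod[of i J j J polyring] by (intro bexI[of _ 0] bexI[of _ "i * j"]) auto

lemma J2_hcomp: "p \<in> J \<cdot>\<^bsub>polyring\<^esub> J \<Longrightarrow> hcomp e p \<in> J \<cdot>\<^bsub>polyring\<^esub> J"
proof (induction rule: ideal_prod.induct)
  case (prod i j)
  have "i * j = (\<Sum>c\<in>degs i. hcomp c i * j)"
    using arg_cong[OF hcomp_decomp[of "degs i" i], of "\<lambda>u. u * j"] by (simp add: sum_distrib_right)
  then have "hcomp e (i * j) = (\<Sum>c\<in>degs i. hcomp c i * hcomp (e - c) j)"
    by (simp only: hcomp_sum hcomp_mult_piece[OF hcomp_in_piece])
  moreover have "hcomp c i * hcomp (e - c) j \<in> J \<cdot>\<^bsub>polyring\<^esub> J" for c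
    using ideal_prod.prod[of "hcomp c i" J "hcomp (e - c) j" J polyring] prod hideal_hcomp[OF hom] by simp
  ultimately show ?case by (simp add: is_ideal_sum[OF J2_ideal])
next
  case (sum p q)
  then show ?case by (simp add: hcomp_add is_ideal_add[OF J2_ideal])
qed

lemma I'_hcomp: "p \<in> I' \<Longrightarrow> hcomp e p \<in> I'"
  unfolding I'_iff using hideal_hcomp[OF I_hom] J2_hcomp by (fastforce simp: hcomp_add)

lemma I'_J: "I' \<subseteq> J"
proof
  fix p assume "p \<in> I'"
  then obtain i s where p: "p = i + s" "i \<in> I" "s \<in> J \<cdot>\<^bsub>polyring\<^esub> J" unfolding I'_iff by blast
  have "s \<in> J" using p(3)
    by (induction rule: ideal_prod.induct) (auto simp: is_ideal_mult[OF idl] is_ideal_add[OF idl])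
  then show "p \<in> J" using p I_J is_ideal_add[OF idl] by blast
qed

lemma Phi_I': "\<phi> \<in> Z \<Longrightarrow> p \<in> I' \<Longrightarrow> Phi \<phi> p = 0"
proof -
  assume \<phi>: "\<phi> \<in> Z" and "p \<in> I'"
  then obtain i s where p: "p = i + s" "i \<in> I" "s \<in> J \<cdot>\<^bsub>polyring\<^esub> J" unfolding I'_iff by blast
  have "s \<in> J \<and> Phi \<phi> s = 0" using p(3)
    by (induction rule: ideal_prod.induct)
      (auto simp: is_ideal_mult[OF idl] is_ideal_add[OF idl] Phi_square[OF \<phi>] Phi_add[OF \<phi>])
  then show ?thesis using p I_J Phi_add[OF \<phi>, of i s] Phi_I[OF \<phi>] by auto
qed

lemma Phi_cong: "\<phi> \<in> Z \<Longrightarrow> j \<in> J \<Longrightarrow> j' \<in> J \<Longrightarrow> j - j' \<in> I' \<Longrightarrow> Phi \<phi> j = Phi \<phi> j'"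
  using Phi_add[of \<phi> "j - j'" j'] Phi_I'[of \<phi> "j - j'"] I'_J by auto

text \<open>Uniqueness of coefficients is passed from functions restricted to indices below
  \<open>n\<close> to arbitrary ones, compared only below \<open>n\<close>, so that sums and
  multiples need no restriction.\<close>

lemma basis:
  obtains n b \<delta> where "\<And>j. j < n \<Longrightarrow> b j \<in> GF 0 (\<delta> j)"
    "\<And>y. y \<in> carrier F0 \<Longrightarrow> \<exists>s. y = lin_comb F0 n b s"
    "\<And>s s' j. lin_comb F0 n b s = lin_comb F0 n b s' \<Longrightarrow> j < n \<Longrightarrow> s j = s' j"
proof -
  have "graded_free_module F0 (GF 0)" using res by (simp add: graded_free_resolution_def)
  then obtain n b and \<delta> :: "nat \<Rightarrow> int" where b: "\<forall>j<n. b j \<in> GF 0 (\<delta> j)"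
    and ex1: "\<forall>x\<in>carrier F0. \<exists>!s. s \<in> {..<n} \<rightarrow>\<^sub>E carrier polyring \<and> x = finsum F0 (\<lambda>j. s j \<odot>\<^bsub>F0\<^esub> b j) {..<n}"
    unfolding graded_free_module_def by (elim exE conjE)
  have bc: "b j \<in> carrier F0" if "j < n" for j using b GF_carrier that by blast
  interpret F0: module polyring F0 by (rule F_module)
  have restr: "lin_comb F0 n b s = finsum F0 (\<lambda>j. restrict s {..<n} j \<odot>\<^bsub>F0\<^esub> b j) {..<n}" for s
    unfolding lin_comb_def using bc by (intro F0.finsum_cong') auto
  show ?thesis
  proof (rule that)
    show "b j \<in> GF 0 (\<delta> j)" if "j < n" for j using b that by blast
    show "\<exists>s. y = lin_comb F0 n b s" if y: "y \<in> carrier F0" for y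
    proof -
      obtain s where "y = finsum F0 (\<lambda>j. s j \<odot>\<^bsub>F0\<^esub> b j) {..<n}" using bspec[OF ex1 y] by (elim ex1E conjE)
      then show ?thesis by (auto simp: lin_comb_def)
    qed
    fix s s' j assume e: "lin_comb F0 n b s = lin_comb F0 n b s'" and j: "j < n"
    have "lin_comb F0 n b s \<in> carrier F0" by (rule lin_comb_simps(1)[OF F_module bc])
    then have "\<exists>!s'. s' \<in> {..<n} \<rightarrow>\<^sub>E carrier polyring \<and>
        lin_comb F0 n b s = finsum F0 (\<lambda>j. s' j \<odot>\<^bsub>F0\<^esub> b j) {..<n}"
      by (rule bspec[OF ex1])
    from ex1_unique[OF this, of "restrict s {..<n}" "restrict s' {..<n}"]
    have "restrict s {..<n} = restrict s' {..<n}"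
      unfolding restr[symmetric] using e by simp
    then show "s j = s' j" using j by (metis lessThan_iff restrict_apply')
  qed
qed

end

lemma graded_module_finsum:
  assumes N: "graded_module N G" and A: "finite A" "\<And>i. i \<in> A \<Longrightarrow> g i \<in> G e"
  shows "finsum N g A \<in> G e"
proof -
  interpret N: module polyring N using N by (simp add: graded_module_def)
  have sub: "subgroup (G e) (add_monoid N)" using N by (simp add: graded_module_def)
  show ?thesis using A
  proof (induction A)
    case empty
    then show ?case using subgroup.one_closed[OF sub] by simp
  next
    case (insert i A)
    then have "g j \<in> carrier N" if "j \<in> insert i A" for j
      using that graded_module_piece_subset[OF N] by blast
    then have "finsum N g (insert i A) = g i \<oplus>\<^bsub>N\<^esub> finsum N g A"
      using insert by (intro N.finsum_insert) auto
    then show ?case using insert subgroup.m_closed[OF sub, of "g i" "finsum N g A"] by simp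
  qed
qed

context ext_computation
begin

text \<open>Regrouping the components of all coefficients by total degree exhibits the combination
  as a sum of homogeneous elements. Only degree \<open>e\<close> survives, and freeness identifies
  the coefficients.\<close>

lemma lin_comb_homogeneous:
  assumes b: "\<And>j. j < n \<Longrightarrow> b j \<in> GF 0 (\<delta> j)"
    and uniq: "\<And>s s' j. lin_comb F0 n b s = lin_comb F0 n b s' \<Longrightarrow> j < n \<Longrightarrow> s j = s' j"
    and s: "lin_comb F0 n b s \<in> GF 0 e" and j: "j < n"
  shows "s j \<in> poly_piece (e - \<delta> j)"
proof -
  interpret F0: module polyring F0 by (rule F_module)
  have bc: "b j \<in> carrier F0" if "j < n" for j using b[OF that] GF_carrier by blast
  define D where "D = insert e (\<Union>j<n. (\<lambda>i. i + \<delta> j) ` degs (s j))"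
  have D: "finite D" "e \<in> D" by (auto simp: D_def)
  define \<rho> where "\<rho> i j = hcomp (i - \<delta> j) (s j)" for i j
  have sum: "(\<Sum>i\<in>D. \<rho> i j) = s j" if j: "j < n" for j
  proof -
    have "s j = (\<Sum>i\<in>(\<lambda>i. i - \<delta> j) ` D. hcomp i (s j))"
    proof (rule hcomp_decomp)
      show "degs (s j) \<subseteq> (\<lambda>i. i - \<delta> j) ` D"
      proof
        fix i assume "i \<in> degs (s j)"
        then have "i + \<delta> j \<in> D" unfolding D_def using j by blast
        then show "i \<in> (\<lambda>i. i - \<delta> j) ` D" by (rule rev_image_eqI) simp
      qed
    qed (use D in simp)
    also have "\<dots> = (\<Sum>i\<in>D. \<rho> i j)"
      unfolding \<rho>_def by (subst sum.reindex) (auto simp: inj_on_def)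
    finally show ?thesis by simp
  qed
  have "lin_comb F0 n b s = lin_comb F0 n b (\<lambda>j. \<Sum>i\<in>D. \<rho> i j)"
    unfolding lin_comb_def using bc sum by (intro F0.finsum_cong') auto
  also have "\<dots> = finsum F0 (\<lambda>i. lin_comb F0 n b (\<rho> i)) D"
    by (rule lin_comb_sum[OF F_module bc D(1)])
  finally have eq: "lin_comb F0 n b s = finsum F0 (\<lambda>i. lin_comb F0 n b (\<rho> i)) D" .
  have "lin_comb F0 n b (\<rho> i) \<in> GF 0 i" for i
    unfolding lin_comb_def
  proof (rule graded_module_finsum[OF F_graded])
    fix j assume "j \<in> {..<n}"
    then have "\<rho> i j \<odot>\<^bsub>F0\<^esub> b j \<in> GF 0 ((i - \<delta> j) + \<delta> j)"
      using F_graded[of 0] b hcomp_in_piece unfolding \<rho>_def graded_module_def by blast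
    then show "\<rho> i j \<odot>\<^bsub>F0\<^esub> b j \<in> GF 0 i" by simp
  qed simp
  then have "finsum F0 (\<lambda>i. lin_comb F0 n b (\<rho> i)) D = lin_comb F0 n b (\<rho> e)"
    using s eq D by (intro graded_module_component[OF F_graded]) auto
  then have "s j = \<rho> e j" using uniq eq j by simp
  then show ?thesis using hcomp_in_piece[of "e - \<delta> j" "s j"] by (simp add: \<rho>_def)
qed

lemma basis_lift:
  assumes b: "b \<in> GF 0 e"
  obtains m where "m \<in> J" "m \<in> poly_piece e" "\<epsilon> b = cs I m"
  using eps_graded[OF b] by blast

abbreviation GR where "GR \<equiv> ideal_quot_piece UNIV J"

text \<open>If \<open>x\<close> lifts \<open>f b j\<close>, nondegeneracy puts a representative of
  \<open>\<phi> x\<close> into \<open>C\<close>, so \<open>\<phi> x\<close> is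
  \<open>f * q j\<close>; the map \<open>g\<close> sends \<open>b j\<close> to \<open>q j\<close>.
  Then \<open>f\<close> times \<open>\<phi> x - g (d 0 x)\<close> is zero, and \<open>f\<close> is
  regular. No homogeneity of \<open>g\<close> is asked for, as \<open>Ext_piece\<close> takes
  homogeneous cocycles modulo all coboundaries.\<close>

lemma Phi_injective:
  assumes \<phi>: "\<phi> \<in> Z" and hom0: "\<phi> \<in> homogeneous_hom F1 (GF (Suc 0)) R GR 0"
    and zero: "\<And>j. j \<in> J \<Longrightarrow> j \<in> poly_piece a \<Longrightarrow> Phi \<phi> j = 0"
  shows "\<exists>g\<in>mod_hom polyring F0 R. \<forall>x\<in>carrier F1. \<phi> x = g (d 0 x)"
proof -
  interpret F0: module polyring F0 by (rule F_module)
  obtain n b \<delta> where b: "\<And>j. j < n \<Longrightarrow> b j \<in> GF 0 (\<delta> j)"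
    and span: "\<And>y. y \<in> carrier F0 \<Longrightarrow> \<exists>s. y = lin_comb F0 n b s"
    and uniq: "\<And>s s' j. lin_comb F0 n b s = lin_comb F0 n b s' \<Longrightarrow> j < n \<Longrightarrow> s j = s' j"
    by (rule basis, rule that)
  have bc: "b j \<in> carrier F0" if "j < n" for j using b[OF that] GF_carrier by blast
  have "\<exists>x q. x \<in> carrier F1 \<and> d 0 x = f \<odot>\<^bsub>F0\<^esub> b j \<and> \<phi> x = cs J (f * q)" if j: "j < n" for j
  proof -
    obtain m where m: "m \<in> J" "m \<in> poly_piece (\<delta> j)" "\<epsilon> (b j) = cs I m" using basis_lift[OF b[OF j]] .
    obtain x0 where x0: "x0 \<in> carrier F1" "d 0 x0 = f \<odot>\<^bsub>F0\<^esub> b j" using d0_lift[OF bc[OF j]] by blast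
    have "f \<odot>\<^bsub>F0\<^esub> b j \<in> GF 0 (int t + \<delta> j)"
      using F_graded[of 0] b[OF j] f_piece unfolding graded_module_def by blast
    then obtain x where x: "x \<in> GF (Suc 0) (int t + \<delta> j)" "d 0 x = f \<odot>\<^bsub>F0\<^esub> b j"
      using graded_hom_lift[OF F_graded F_graded d_hom x0(1)] x0(2) by metis
    have xc: "x \<in> carrier F1" using x(1) GF_carrier by blast
    have "\<phi> x \<in> GR (int t + \<delta> j)" using hom0 x(1) by (force simp: homogeneous_hom_def)
    then obtain p where p: "p \<in> poly_piece (int t + \<delta> j)" "\<phi> x = cs J p" by (auto simp: R_simps)
    have "\<tau> (r * p) = 0" for r
    proof -
      \<comment> \<open>Since \<open>p\<close> has degree \<open>\<delta> j + t\<close> and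
        \<open>\<tau>\<close> lives in degree \<open>a + t\<close>, only this component of
        \<open>r\<close> matters; it moves \<open>m\<close> into degree \<open>a\<close>, where
        \<open>zero\<close> applies.\<close>
      define r0 where "r0 = hcomp (a - \<delta> j) r"
      have "\<tau> (r * p) = \<tau> (p * r)" by (simp add: mult.commute)
      also have "\<dots> = \<tau> (r0 * p)" using tau_mult_piece[OF p(1), of r] by (simp add: r0_def mult.commute)
      also have "\<dots> = Phi \<phi> (r0 * m)" using Phi_mult[OF \<phi> xc bc[OF j] x(2) m(3) p(2)] by simp
      also have "\<dots> = 0"
        using zero[OF is_ideal_mult[OF idl m(1)]] poly_piece_mult[OF hcomp_in_piece[of "a - \<delta> j" r] m(2)]
        by (simp add: r0_def)
      finally show ?thesis .
    qed
    then have "p \<in> C" by (rule tau_nondegenerate)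
    then obtain q where "p - q * f \<in> J" using adjoin_iff by blast
    then have "cs J p = cs J (f * q)" by (simp add: cs_eq_iff[OF idl] mult.commute)
    then show ?thesis using xc x(2) p(2) by auto
  qed
  then obtain xs q where xs: "\<And>j. j < n \<Longrightarrow> xs j \<in> carrier F1"
    "\<And>j. j < n \<Longrightarrow> d 0 (xs j) = f \<odot>\<^bsub>F0\<^esub> b j" "\<And>j. j < n \<Longrightarrow> \<phi> (xs j) = cs J (f * q j)" by metis
  define g where "g y = cs J (\<Sum>j<n. (SOME s. y = lin_comb F0 n b s) j * q j)" for y
  have g: "g (lin_comb F0 n b s) = cs J (\<Sum>j<n. s j * q j)" for s
  proof -
    define s' where "s' = (SOME s'. lin_comb F0 n b s = lin_comb F0 n b s')"
    have "lin_comb F0 n b s = lin_comb F0 n b s'" unfolding s'_def by (rule someI[of _ s]) simp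
    then have "(\<Sum>j<n. s' j * q j) = (\<Sum>j<n. s j * q j)" using uniq[of s s'] by (intro sum.cong) auto
    then show ?thesis by (simp add: g_def s'_def)
  qed
  have "g \<in> mod_hom polyring F0 R"
    unfolding mod_hom_def
  proof (intro CollectI conjI ballI Pi_I)
    fix y assume "y \<in> carrier F0"
    then obtain s where s: "y = lin_comb F0 n b s" using span by blast
    show "g y \<in> carrier R" by (simp add: s g R_simps)
    { fix y' assume "y' \<in> carrier F0"
      then obtain s' where s': "y' = lin_comb F0 n b s'" using span by blast
      show "g (y \<oplus>\<^bsub>F0\<^esub> y') = g y \<oplus>\<^bsub>R\<^esub> g y'"
        using lin_comb_simps(2)[OF F_module bc, where s=s and s'=s'] g[of "\<lambda>j. s j + s' j"]
        by (simp add: s s' g R_simps distrib_right sum.distrib) }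
    fix r
    show "g (r \<odot>\<^bsub>F0\<^esub> y) = r \<odot>\<^bsub>R\<^esub> g y"
      using lin_comb_simps(3)[OF F_module bc, where r=r and s=s] g[of "\<lambda>j. r * s j"]
      by (simp add: s g R_simps sum_distrib_left mult.assoc)
  qed
  moreover have "\<phi> x = g (d 0 x)" if x: "x \<in> carrier F1" for x
  proof -
    obtain s where s: "d 0 x = lin_comb F0 n b s" using span[of "d 0 x"] x by auto
    obtain p where p: "\<phi> x = cs J p" using Z_cs[OF \<phi> x] by blast
    \<comment> \<open>Both \<open>?x\<close> and \<open>f x\<close> lie over \<open>f\<close> times
      \<open>d 0 x\<close>, so \<open>\<phi>\<close> takes the same value on them.\<close>
    let ?x = "lin_comb F1 n xs s"
    have xc: "?x \<in> carrier F1" by (rule lin_comb_simps(1)[OF F_module xs(1)])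
    have "d 0 ?x = finsum F0 (\<lambda>j. d 0 (s j \<odot>\<^bsub>F1\<^esub> xs j)) {..<n}"
      unfolding lin_comb_def using xs(1) by (intro mod_hom_finsum[OF F_module F_module d_mod_hom]) auto
    also have "\<dots> = lin_comb F0 n b (\<lambda>j. f * s j)"
      unfolding lin_comb_def using xs bc
      by (intro F0.finsum_cong') (auto simp: d_smult mult.commute)
    also have "\<dots> = f \<odot>\<^bsub>F0\<^esub> d 0 x" using lin_comb_simps(3)[OF F_module bc, where r=f and s=s] s by simp
    finally have "\<phi> ?x = \<phi> (f \<odot>\<^bsub>F1\<^esub> x)"
      using x xc by (intro Z_eq[OF \<phi>]) (auto simp: d_smult)
    moreover have "\<phi> ?x = cs J (\<Sum>j<n. s j * (f * q j))"
      by (rule mod_hom_lin_comb[OF idl Z_mod_hom[OF \<phi>] F_module xs(1,3)])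
    ultimately have "cs J (\<Sum>j<n. s j * (f * q j)) = cs J (f * p)"
      using Z_smult[OF \<phi> x p, of f] by simp
    then have "f * ((\<Sum>j<n. s j * q j) - p) \<in> J"
      by (simp add: cs_eq_iff[OF idl] right_diff_distrib sum_distrib_left mult.left_commute)
    then have "cs J (\<Sum>j<n. s j * q j) = cs J p" using f_nzd cs_eq_iff[OF idl] by blast
    then show ?thesis by (simp add: p s g)
  qed
  ultimately show ?thesis by blast
qed

text \<open>For a generator \<open>m\<close> of \<open>J / I\<close> the functional
  \<open>r \<mapsto> \<mu> (r * m)\<close> kills \<open>C\<close>, because \<open>J * m\<close> lies
  in \<open>J^2\<close> and \<open>f * m\<close> in \<open>I\<close>. By duality it is
  \<open>r \<mapsto> \<tau> (r * h)\<close>. The elements \<open>h\<close> define a map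
  \<open>u\<close> on \<open>F0\<close> lifting the desired map
  \<open>J / I \<rightarrow> S / C\<close>, and the cocycle is \<open>u\<close> after
  \<open>d 0\<close>, divided by \<open>f\<close>.\<close>

lemma Phi_surjective:
  assumes \<mu>: "\<And>i j. i \<in> J \<Longrightarrow> j \<in> J \<Longrightarrow> \<mu> (i + j) = \<mu> i + \<mu> j"
      "\<And>c j. j \<in> J \<Longrightarrow> \<mu> (const_poly c * j) = c * \<mu> j"
    and \<mu>_I': "\<And>j. j \<in> I' \<Longrightarrow> \<mu> j = (0::'k)" and \<mu>_a: "\<And>j. j \<in> J \<Longrightarrow> \<mu> (hcomp a j) = \<mu> j"
  shows "\<exists>\<phi>\<in>Z \<inter> homogeneous_hom F1 (GF (Suc 0)) R GR 0. \<forall>j\<in>J. Phi \<phi> j = \<mu> j"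
proof -
  interpret F0: module polyring F0 by (rule F_module)
  obtain n b \<delta> where b: "\<And>j. j < n \<Longrightarrow> b j \<in> GF 0 (\<delta> j)"
    and span: "\<And>y. y \<in> carrier F0 \<Longrightarrow> \<exists>s. y = lin_comb F0 n b s"
    and uniq: "\<And>s s' j. lin_comb F0 n b s = lin_comb F0 n b s' \<Longrightarrow> j < n \<Longrightarrow> s j = s' j"
    by (rule basis, rule that)
  have bc: "b j \<in> carrier F0" if "j < n" for j using b[OF that] GF_carrier by blast
  have "\<exists>m h. m \<in> J \<and> \<epsilon> (b j) = cs I m \<and> h \<in> poly_piece (\<delta> j + int t) \<and> (\<forall>r. \<mu> (r * m) = \<tau> (r * h))"
    if j: "j < n" for j
  proof -
    obtain m where m: "m \<in> J" "m \<in> poly_piece (\<delta> j)" "\<epsilon> (b j) = cs I m" using basis_lift[OF b[OF j]] .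
    have "\<exists>h. \<forall>r. \<mu> (r * m) = \<tau> (r * h)"
    proof (rule tau_represents)
      show "k_linear (\<lambda>r. \<mu> (r * m))"
        using \<mu> is_ideal_mult[OF idl m(1)] by (simp add: k_linear_def distrib_right mult.assoc)
      fix p assume "p \<in> C"
      then obtain c r where p: "p = c + r * f" "c \<in> J" by (auto simp: adjoin_def)
      have "r * (f * m) \<in> I'" using is_ideal_mult[OF I_ideal f_J[OF m(1)]] I_I' by blast
      then have "p * m \<in> I'"
        using is_ideal_add[OF I'_ideal J2_I'[OF p(2) m(1)], of "r * (f * m)"] by (simp add: p(1) distrib_right mult.assoc)
      then show "\<mu> (p * m) = 0" by (rule \<mu>_I')
    qed
    then obtain h where h: "\<And>r. \<mu> (r * m) = \<tau> (r * h)" by blast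
    \<comment> \<open>As \<open>\<mu>\<close> sees only degree \<open>a\<close> and
      \<open>\<tau>\<close> only degree \<open>a + t\<close>, this component of \<open>h\<close>
      represents the same functional; its homogeneity gives the cocycle degree zero.\<close>
    define h' where "h' = hcomp (\<delta> j + int t) h"
    have "\<mu> (r * m) = \<tau> (r * h')" for r
    proof -
      define r0 where "r0 = hcomp (a - \<delta> j) r"
      have r0m: "hcomp a (r * m) = r0 * m"
        using hcomp_mult_piece[OF m(2), of a r] by (simp add: r0_def mult.commute)
      have "\<tau> (r * h') = \<tau> (h' * r)" by (simp add: mult.commute)
      also have "\<dots> = \<tau> (h' * r0)"
        using tau_mult_piece[OF hcomp_in_piece[of "\<delta> j + int t" h], of r] by (simp add: h'_def r0_def)
      also have "\<dots> = \<tau> (r0 * h')" by (simp add: mult.commute)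
      also have "\<dots> = \<tau> (r0 * h)"
        using tau_mult_piece[OF hcomp_in_piece[of "a - \<delta> j" r], of h] by (simp add: h'_def r0_def algebra_simps)
      also have "\<dots> = \<mu> (hcomp a (r * m))" by (simp add: h r0m)
      also have "\<dots> = \<mu> (r * m)" by (rule \<mu>_a[OF is_ideal_mult[OF idl m(1)]])
      finally show ?thesis by simp
    qed
    moreover have "h' \<in> poly_piece (\<delta> j + int t)" by (simp add: h'_def hcomp_in_piece)
    ultimately show ?thesis using m by blast
  qed
  then obtain m h where m: "\<And>j. j < n \<Longrightarrow> m j \<in> J" "\<And>j. j < n \<Longrightarrow> \<epsilon> (b j) = cs I (m j)"
    and h: "\<And>j. j < n \<Longrightarrow> h j \<in> poly_piece (\<delta> j + int t)" "\<And>j r. j < n \<Longrightarrow> \<mu> (r * m j) = \<tau> (r * h j)" by metis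
  define u where "u s = (\<Sum>j<n. s j * h j)" for s :: "nat \<Rightarrow> ('x, 'k) mpoly"
  define v where "v s = (\<Sum>j<n. s j * m j)" for s :: "nat \<Rightarrow> ('x, 'k) mpoly"
  have vJ: "v s \<in> J" for s unfolding v_def using m(1) by (intro is_ideal_sum[OF idl] is_ideal_mult[OF idl]) auto
  have eps_v: "\<epsilon> (lin_comb F0 n b s) = cs I (v s)" for s
    unfolding v_def by (rule mod_hom_lin_comb[OF I_ideal eps_mod_hom F_module bc m(2)])
  have \<mu>_sum: "\<mu> (\<Sum>i\<in>A. g i) = (\<Sum>i\<in>A. \<mu> (g i))" if "finite A" "\<And>i. i \<in> A \<Longrightarrow> g i \<in> J" for A and g :: "nat \<Rightarrow> ('x, 'k) mpoly"
    using that
  proof (induction A)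
    case empty
    then show ?case using \<mu>_I'[OF is_ideal_0[OF I'_ideal]] by simp
  next
    case (insert i A)
    then show ?case using \<mu>(1)[of "g i" "sum g A"] is_ideal_sum[OF idl, of A g] by simp
  qed
  have uv: "\<tau> (r * u s) = \<mu> (r * v s)" for r s
  proof -
    have "\<mu> (r * v s) = (\<Sum>j<n. \<mu> ((r * s j) * m j))"
      unfolding v_def sum_distrib_left mult.assoc[symmetric] using m(1)
      by (intro \<mu>_sum) (auto intro: is_ideal_mult[OF idl])
    also have "\<dots> = (\<Sum>j<n. \<tau> ((r * s j) * h j))" using h(2) by (intro sum.cong) auto
    also have "\<dots> = \<tau> (r * u s)"
      unfolding u_def sum_distrib_left mult.assoc[symmetric] by (rule k_linear_sum[OF tau_linear, symmetric])
    finally show ?thesis by simp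
  qed
  \<comment> \<open>Well-definedness of the map \<open>J / I \<rightarrow> S / C\<close>: relations
    among the generators go to zero by nondegeneracy, because \<open>\<mu>\<close> vanishes on
    \<open>I\<close>.\<close>
  have u_C: "u s \<in> C" if "\<epsilon> (lin_comb F0 n b s) = I" for s
  proof (rule tau_nondegenerate)
    fix r
    have "v s \<in> I" using that eps_v cs_eq_iff[OF I_ideal, of "v s" 0] by (simp add: cs_0)
    then have "r * v s \<in> I'" using is_ideal_mult[OF I_ideal] I_I' by blast
    then show "\<tau> (r * u s) = 0" using uv \<mu>_I' by simp
  qed
  have u_cong: "u s = u s'" if "lin_comb F0 n b s = lin_comb F0 n b s'" for s s'
    unfolding u_def using uniq[OF that] by (intro sum.cong) auto
  have u_add: "u (\<lambda>j. s j + s' j) = u s + u s'" for s s'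
    by (simp add: u_def distrib_right sum.distrib)
  have u_smult: "u (\<lambda>j. r * s j) = r * u s" for r s
    by (simp add: u_def sum_distrib_left mult.assoc)
  \<comment> \<open>The quotient of \<open>u s\<close> by \<open>f\<close> modulo \<open>J\<close>,
    unique because \<open>f\<close> is regular.\<close>
  define \<phi> where "\<phi> = (\<lambda>x\<in>carrier F1. cs J (SOME q. \<exists>s. d 0 x = lin_comb F0 n b s \<and> u s - q * f \<in> J))"
  have \<phi>: "\<phi> x = cs J q" if x: "x \<in> carrier F1" "d 0 x = lin_comb F0 n b s" "u s - q * f \<in> J" for x s q
  proof -
    define q' where "q' = (SOME q. \<exists>s. d 0 x = lin_comb F0 n b s \<and> u s - q * f \<in> J)"
    have "\<exists>s. d 0 x = lin_comb F0 n b s \<and> u s - q' * f \<in> J"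
      unfolding q'_def by (rule someI[of _ q]) (use x in blast)
    then obtain s' where s': "d 0 x = lin_comb F0 n b s'" "u s' - q' * f \<in> J" by blast
    have "u s' = u s" by (rule u_cong) (use s' x in simp)
    then have "u s - q' * f \<in> J" using s'(2) by simp
    from is_ideal_diff[OF idl x(3) this] have "f * (q' - q) \<in> J" by (simp add: algebra_simps)
    then show ?thesis using f_nzd x(1) by (simp add: \<phi>_def q'_def[symmetric] cs_eq_iff[OF idl])
  qed
  have ex: "\<exists>s q. d 0 x = lin_comb F0 n b s \<and> u s - q * f \<in> J" if x: "x \<in> carrier F1" for x
  proof -
    obtain s where s: "d 0 x = lin_comb F0 n b s" using span[of "d 0 x"] x by auto
    then have "u s \<in> C" using u_C eps_d0[OF x] by simp
    then show ?thesis using s adjoin_iff by blast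
  qed
  have \<phi>Z: "\<phi> \<in> Z"
    unfolding Z_iff
  proof (intro conjI ballI)
    show "\<phi> \<in> extensional (carrier F1)" by (simp add: \<phi>_def)
    show "\<phi> \<in> mod_hom polyring F1 R"
      unfolding mod_hom_def
    proof (intro CollectI conjI ballI Pi_I)
      fix x assume x: "x \<in> carrier F1"
      then obtain s q where s: "d 0 x = lin_comb F0 n b s" "u s - q * f \<in> J" using ex by blast
      show "\<phi> x \<in> carrier R" using \<phi>[OF x s] by (simp add: R_simps)
      { fix x' assume x': "x' \<in> carrier F1"
        then obtain s' q' where s': "d 0 x' = lin_comb F0 n b s'" "u s' - q' * f \<in> J" using ex by blast
        have "\<phi> (x \<oplus>\<^bsub>F1\<^esub> x') = cs J (q + q')"
        proof (rule \<phi>)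
          show "d 0 (x \<oplus>\<^bsub>F1\<^esub> x') = lin_comb F0 n b (\<lambda>j. s j + s' j)"
            using x x' s s' lin_comb_simps(2)[OF F_module bc, where s=s and s'=s'] by (simp add: d_add)
          show "u (\<lambda>j. s j + s' j) - (q + q') * f \<in> J"
            using is_ideal_add[OF idl s(2) s'(2)] by (simp add: u_add algebra_simps)
        qed (use x x' in simp)
        then show "\<phi> (x \<oplus>\<^bsub>F1\<^esub> x') = \<phi> x \<oplus>\<^bsub>R\<^esub> \<phi> x'" using \<phi>[OF x s] \<phi>[OF x' s'] by (simp add: R_simps) }
      fix r
      have "\<phi> (r \<odot>\<^bsub>F1\<^esub> x) = cs J (r * q)"
      proof (rule \<phi>)
        show "d 0 (r \<odot>\<^bsub>F1\<^esub> x) = lin_comb F0 n b (\<lambda>j. r * s j)"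
          using x s lin_comb_simps(3)[OF F_module bc, where r=r and s=s] by (simp add: d_smult)
        show "u (\<lambda>j. r * s j) - (r * q) * f \<in> J"
          using is_ideal_mult[OF idl s(2), of r] by (simp add: u_smult algebra_simps)
      qed (use x in simp)
      then show "\<phi> (r \<odot>\<^bsub>F1\<^esub> x) = r \<odot>\<^bsub>R\<^esub> \<phi> x" using \<phi>[OF x s] by (simp add: R_simps)
    qed
    fix x assume x: "x \<in> carrier F2"
    have "\<phi> (d (Suc 0) x) = cs J 0"
      by (rule \<phi>[of _ "\<lambda>j. 0"])
        (use x d0_d1[OF x] lin_comb_simps(4)[OF F_module bc] in \<open>simp_all add: u_def is_ideal_0[OF idl]\<close>)
    then show "\<phi> (d (Suc 0) x) = J" by (simp add: cs_0)
  qed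
  have "\<phi> \<in> homogeneous_hom F1 (GF (Suc 0)) R GR 0"
    unfolding homogeneous_hom_def
  proof (intro CollectI conjI allI image_subsetI)
    show "\<phi> \<in> mod_hom polyring F1 R" by (rule Z_mod_hom[OF \<phi>Z])
    fix e x assume x: "x \<in> GF (Suc 0) e"
    then have xc: "x \<in> carrier F1" by (rule GF_carrier)
    then obtain s q where s: "d 0 x = lin_comb F0 n b s" "u s - q * f \<in> J" using ex by blast
    have "lin_comb F0 n b s \<in> GF 0 e" using d_graded[OF x] s(1) by simp
    then have sp: "s j \<in> poly_piece (e - \<delta> j)" if j: "j < n" for j
    proof (rule lin_comb_homogeneous[where b=b and n=n and \<delta>=\<delta>, rotated 2])
      show "s1 i = s2 i" if "lin_comb F0 n b s1 = lin_comb F0 n b s2" "i < n" for s1 s2 i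
        using that by (rule uniq)
    qed (use b j in auto)
    have "u s \<in> poly_piece (e + int t)"
      unfolding u_def
    proof (rule poly_piece_sum)
      fix j assume "j \<in> {..<n}"
      then have j: "j < n" by simp
      have "e - \<delta> j + (\<delta> j + int t) = e + int t" by simp
      then show "s j * h j \<in> poly_piece (e + int t)"
        using poly_piece_mult[OF sp[OF j] h(1)[OF j]] by simp
    qed
    \<comment> \<open>The quotient by \<open>f\<close> can be taken homogeneous, since both
      \<open>u s\<close> and \<open>f\<close> are.\<close>
    then have "u s - hcomp e q * f \<in> J"
      using hideal_hcomp[OF hom s(2), of "e + int t"] hcomp_mult_piece[OF f_piece, of "e + int t" q]
      by (simp add: hcomp_diff hcomp_piece mult.commute)
    from \<phi>[OF xc s(1) this] show "\<phi> x \<in> GR (e + 0)" by (simp add: R_simps hcomp_in_piece)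
  qed
  moreover have "Phi \<phi> j = \<mu> j" if j: "j \<in> J" for j
  proof -
    obtain x y p where x: "x \<in> carrier F1" "y \<in> carrier F0" "d 0 x = f \<odot>\<^bsub>F0\<^esub> y" "\<epsilon> y = cs I j"
      "\<phi> x = cs J p" "Phi \<phi> j = \<tau> p" using Phi_lift[OF \<phi>Z j] .
    obtain s where s: "y = lin_comb F0 n b s" using span[OF x(2)] by blast
    \<comment> \<open>Here \<open>d 0 x\<close> is \<open>f y\<close>, so dividing by
      \<open>f\<close> returns the value of \<open>u\<close> at \<open>y\<close>.\<close>
    have "\<phi> x = cs J (u s)"
    proof (rule \<phi>[OF x(1)])
      show "d 0 x = lin_comb F0 n b (\<lambda>j. f * s j)" using x(3) s lin_comb_simps(3)[OF F_module bc, where r=f and s=s] by simp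
      show "u (\<lambda>j. f * s j) - u s * f \<in> J" by (simp add: u_smult mult.commute is_ideal_0[OF idl])
    qed
    then have "Phi \<phi> j = \<tau> (u s)" using Phi_eq[OF \<phi>Z x(1-4)] by simp
    also have "\<dots> = \<mu> (v s)" using uv[of 1 s] by simp
    also have "\<dots> = \<mu> ((v s - j) + j)" by simp
    also have "\<dots> = \<mu> (v s - j) + \<mu> j" using is_ideal_diff[OF idl vJ j] j by (intro \<mu>(1))
    also have "\<mu> (v s - j) = 0"
    proof (rule \<mu>_I')
      have "cs I (v s) = cs I j" using x(4) s eps_v by simp
      then show "v s - j \<in> I'" using cs_eq_iff[OF I_ideal] I_I' by blast
    qed
    finally show ?thesis by simp
  qed
  ultimately show ?thesis using \<phi>Z by blast
qed

end

section \<open>The isomorphism\<close>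

declare coboundaries.simps [simp del]

context ext_computation
begin

section \<open>Operations on cocycles and their classes\<close>

definition padd where "padd \<phi> \<psi> = (\<lambda>x\<in>carrier F1. \<phi> x \<oplus>\<^bsub>R\<^esub> \<psi> x)"
definition psmult where "psmult r \<phi> = (\<lambda>x\<in>carrier F1. r \<odot>\<^bsub>R\<^esub> \<phi> x)"
definition pull where "pull g = (\<lambda>x\<in>carrier F1. g (d 0 x))"

lemma padd_Z:
  assumes \<phi>: "\<phi> \<in> Z" and \<psi>: "\<psi> \<in> Z"
  shows "padd \<phi> \<psi> \<in> Z"
proof -
  have eq: "padd \<phi> \<psi> x = cs J (p + q)" if "x \<in> carrier F1" "\<phi> x = cs J p" "\<psi> x = cs J q" for x p q
    using that by (simp add: padd_def R_simps)
  show ?thesis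
    unfolding Z_iff mod_hom_def
  proof (intro conjI CollectI ballI Pi_I)
    show "padd \<phi> \<psi> \<in> extensional (carrier F1)" by (simp add: padd_def)
    fix x assume x: "x \<in> carrier F1"
    obtain p where p: "\<phi> x = cs J p" using Z_cs[OF \<phi> x] by blast
    obtain q where q: "\<psi> x = cs J q" using Z_cs[OF \<psi> x] by blast
    show "padd \<phi> \<psi> x \<in> carrier R" using eq[OF x p q] by (simp add: R_simps)
    { fix y assume y: "y \<in> carrier F1"
      obtain p' where p': "\<phi> y = cs J p'" using Z_cs[OF \<phi> y] by blast
      obtain q' where q': "\<psi> y = cs J q'" using Z_cs[OF \<psi> y] by blast
      show "padd \<phi> \<psi> (x \<oplus>\<^bsub>F1\<^esub> y) = padd \<phi> \<psi> x \<oplus>\<^bsub>R\<^esub> padd \<phi> \<psi> y"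
        using eq[OF _ Z_add[OF \<phi> x y p p'] Z_add[OF \<psi> x y q q']] eq[OF x p q] eq[OF y p' q'] x y
        by (simp add: R_simps algebra_simps) }
    fix r
    show "padd \<phi> \<psi> (r \<odot>\<^bsub>F1\<^esub> x) = r \<odot>\<^bsub>R\<^esub> padd \<phi> \<psi> x"
      using eq[OF _ Z_smult[OF \<phi> x p, of r] Z_smult[OF \<psi> x q, of r]] eq[OF x p q] x
      by (simp add: R_simps distrib_left)
  next
    fix x assume x: "x \<in> carrier F2"
    then have "\<phi> (d (Suc 0) x) = cs J 0" "\<psi> (d (Suc 0) x) = cs J 0" using \<phi> \<psi> by (simp_all add: Z_iff cs_0)
    then show "padd \<phi> \<psi> (d (Suc 0) x) = J" using eq[of "d (Suc 0) x" 0 0] x by (simp add: cs_0)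
  qed
qed

lemma psmult_Z:
  assumes \<phi>: "\<phi> \<in> Z"
  shows "psmult r \<phi> \<in> Z"
proof -
  have eq: "psmult r \<phi> x = cs J (r * p)" if "x \<in> carrier F1" "\<phi> x = cs J p" for x p
    using that by (simp add: psmult_def R_simps)
  show ?thesis
    unfolding Z_iff mod_hom_def
  proof (intro conjI CollectI ballI Pi_I)
    show "psmult r \<phi> \<in> extensional (carrier F1)" by (simp add: psmult_def)
    fix x assume x: "x \<in> carrier F1"
    obtain p where p: "\<phi> x = cs J p" using Z_cs[OF \<phi> x] by blast
    show "psmult r \<phi> x \<in> carrier R" using eq[OF x p] by (simp add: R_simps)
    { fix y assume y: "y \<in> carrier F1"
      obtain p' where p': "\<phi> y = cs J p'" using Z_cs[OF \<phi> y] by blast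
      show "psmult r \<phi> (x \<oplus>\<^bsub>F1\<^esub> y) = psmult r \<phi> x \<oplus>\<^bsub>R\<^esub> psmult r \<phi> y"
        using eq[OF _ Z_add[OF \<phi> x y p p']] eq[OF x p] eq[OF y p'] x y
        by (simp add: R_simps distrib_left) }
    fix u
    show "psmult r \<phi> (u \<odot>\<^bsub>F1\<^esub> x) = u \<odot>\<^bsub>R\<^esub> psmult r \<phi> x"
      using eq[OF _ Z_smult[OF \<phi> x p, of u]] eq[OF x p] x
      by (simp add: R_simps mult.left_commute)
  next
    fix x assume x: "x \<in> carrier F2"
    then have "\<phi> (d (Suc 0) x) = cs J 0" using \<phi> by (simp add: Z_iff cs_0)
    then show "psmult r \<phi> (d (Suc 0) x) = J" using eq[of "d (Suc 0) x" 0] x by (simp add: cs_0)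
  qed
qed

lemma pull_Z:
  assumes g: "g \<in> mod_hom polyring F0 R"
  shows "pull g \<in> Z"
  unfolding Z_iff mod_hom_def
proof (intro conjI CollectI ballI Pi_I)
  show "pull g \<in> extensional (carrier F1)" by (simp add: pull_def)
  fix x assume x: "x \<in> carrier F1"
  show "pull g x \<in> carrier R" using mod_homD(1)[OF g] x by (simp add: pull_def)
  show "pull g (x \<oplus>\<^bsub>F1\<^esub> y) = pull g x \<oplus>\<^bsub>R\<^esub> pull g y" if "y \<in> carrier F1" for y
    using mod_homD(2)[OF g] x that by (simp add: pull_def d_add)
  show "pull g (r \<odot>\<^bsub>F1\<^esub> x) = r \<odot>\<^bsub>R\<^esub> pull g x" for r
    using mod_homD(3)[OF g] x by (simp add: pull_def d_smult)
next
  fix x assume x: "x \<in> carrier F2"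
  obtain p where "g \<zero>\<^bsub>F0\<^esub> = cs J p" using mod_hom_cs(1)[OF idl g, of "\<zero>\<^bsub>F0\<^esub>"] by auto
  from mod_hom_cs(3)[OF idl g _ this, of 0] have "g \<zero>\<^bsub>F0\<^esub> = cs J 0" by simp
  then show "pull g (d (Suc 0) x) = J" using x d0_d1[OF x] by (simp add: pull_def cs_0)
qed

lemma Phi_padd:
  assumes \<phi>: "\<phi> \<in> Z" and \<psi>: "\<psi> \<in> Z" and j: "j \<in> J"
  shows "Phi (padd \<phi> \<psi>) j = Phi \<phi> j + Phi \<psi> j"
proof -
  obtain x y p where x: "x \<in> carrier F1" "y \<in> carrier F0" "d 0 x = f \<odot>\<^bsub>F0\<^esub> y" "\<epsilon> y = cs I j"
    "\<phi> x = cs J p" "Phi \<phi> j = \<tau> p" using Phi_lift[OF \<phi> j] .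
  obtain q where q: "\<psi> x = cs J q" using Z_cs[OF \<psi> x(1)] by blast
  show ?thesis
    using Phi_eq[OF padd_Z[OF \<phi> \<psi>] x(1-4)] Phi_eq[OF \<psi> x(1-4)] x q
    by (simp add: padd_def R_simps k_linear_add[OF tau_linear])
qed

lemma Phi_psmult:
  assumes \<phi>: "\<phi> \<in> Z" and j: "j \<in> J"
  shows "Phi (psmult (const_poly c) \<phi>) j = c * Phi \<phi> j"
proof -
  obtain x y p where x: "x \<in> carrier F1" "y \<in> carrier F0" "d 0 x = f \<odot>\<^bsub>F0\<^esub> y" "\<epsilon> y = cs I j"
    "\<phi> x = cs J p" "Phi \<phi> j = \<tau> p" using Phi_lift[OF \<phi> j] .
  show ?thesis
    using Phi_eq[OF psmult_Z[OF \<phi>] x(1-4)] x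
    by (simp add: psmult_def R_simps k_linear_const[OF tau_linear])
qed

text \<open>On a lift of \<open>f y\<close> the coboundary of \<open>g\<close> takes the value
  \<open>f\<close> times \<open>g y\<close>, which is zero modulo \<open>C\<close>.\<close>

lemma Phi_pull:
  assumes g: "g \<in> mod_hom polyring F0 R" and j: "j \<in> J"
  shows "Phi (pull g) j = 0"
proof -
  obtain x y p where x: "x \<in> carrier F1" "y \<in> carrier F0" "d 0 x = f \<odot>\<^bsub>F0\<^esub> y" "\<epsilon> y = cs I j"
    "pull g x = cs J p" "Phi (pull g) j = \<tau> p" using Phi_lift[OF pull_Z[OF g] j] .
  obtain q where q: "g y = cs J q" using mod_hom_cs(1)[OF idl g x(2)] by blast
  have "pull g x = cs J (f * q)"
    using x(1,3) mod_hom_cs(3)[OF idl g x(2) q, of f] by (simp add: pull_def)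
  then have "Phi (pull g) j = \<tau> (f * q)" using Phi_eq[OF pull_Z[OF g] x(1-4)] by simp
  then show ?thesis using tau_C[of "q * f"] adjoin_gen[OF idl, of q f] by (simp add: mult.commute)
qed

abbreviation HZ where "HZ \<equiv> (Hom_module polyring F1 R)\<lparr>carrier := Z\<rparr>"
abbreviation B1 where "B1 \<equiv> coboundaries polyring F d R (Suc 0)"
abbreviation ext_coset where "ext_coset \<phi> \<equiv> a_r_coset HZ B1 \<phi>"

lemma HZ_simps: "add (Hom_module polyring F1 R) = padd" "module.smult (Hom_module polyring F1 R) = psmult"
  by (simp_all add: Hom_module_def padd_def psmult_def fun_eq_iff)

lemma B1_eq: "B1 = pull ` mod_hom polyring F0 R"
proof
  show "B1 \<subseteq> pull ` mod_hom polyring F0 R"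
    by (auto simp: coboundaries.simps Hom_module_def pull_def)
  show "pull ` mod_hom polyring F0 R \<subseteq> B1"
  proof
    fix \<phi> assume "\<phi> \<in> pull ` mod_hom polyring F0 R"
    then obtain g where g: "\<phi> = pull g" "g \<in> mod_hom polyring F0 R" by blast
    have "restrict g (carrier F0) \<in> mod_hom polyring F0 R" using g(2) by (auto simp: mod_hom_def)
    then have "restrict g (carrier F0) \<in> carrier (Hom_module polyring F0 R)" by (simp add: Hom_module_def)
    moreover have "\<phi> = (\<lambda>x\<in>carrier F1. restrict g (carrier F0) (d 0 x))"
      unfolding g(1) pull_def by (rule restrict_ext) simp
    ultimately show "\<phi> \<in> B1" unfolding coboundaries.simps by (intro image_eqI)
  qed
qed

lemma ext_coset_eq: "ext_coset \<phi> = {padd (pull g) \<phi> | g. g \<in> mod_hom polyring F0 R}"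
  by (auto simp: a_r_coset_def r_coset_def B1_eq HZ_simps)

lemma zero_hom: "(\<lambda>x. cs J 0) \<in> mod_hom polyring F0 R"
  by (auto simp: mod_hom_def R_simps)

lemma ext_coset_self: "\<phi> \<in> Z \<Longrightarrow> \<phi> \<in> ext_coset \<phi>"
proof -
  assume \<phi>: "\<phi> \<in> Z"
  have "padd (pull (\<lambda>x. cs J 0)) \<phi> = \<phi>"
  proof
    fix x show "padd (pull (\<lambda>x. cs J 0)) \<phi> x = \<phi> x"
    proof (cases "x \<in> carrier F1")
      case True
      then obtain p where "\<phi> x = cs J p" using Z_cs[OF \<phi>] by blast
      then show ?thesis using True by (simp add: padd_def pull_def R_simps)
    next
      case False
      then show ?thesis using \<phi> by (simp add: padd_def Z_iff extensional_def)
    qed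
  qed
  then show ?thesis unfolding ext_coset_eq using zero_hom by (metis (mono_tags, lifting) mem_Collect_eq)
qed

lemma ext_coset_mem: "\<phi> \<in> Z \<Longrightarrow> \<psi> \<in> ext_coset \<phi> \<Longrightarrow> \<psi> \<in> Z \<and> (\<forall>j\<in>J. Phi \<psi> j = Phi \<phi> j)"
  unfolding ext_coset_eq using padd_Z[OF pull_Z] Phi_padd[OF pull_Z] Phi_pull by auto

text \<open>Used in both directions, this yields equality of the classes of cocycles that differ by
  a coboundary.\<close>

lemma ext_coset_subset:
  assumes \<phi>: "\<phi> \<in> Z" and \<psi>: "\<psi> \<in> Z" and g: "g \<in> mod_hom polyring F0 R"
    and eq: "\<And>x. x \<in> carrier F1 \<Longrightarrow> \<phi> x = g (d 0 x) \<oplus>\<^bsub>R\<^esub> \<psi> x"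
  shows "ext_coset \<phi> \<subseteq> ext_coset \<psi>"
proof
  fix \<chi> assume "\<chi> \<in> ext_coset \<phi>"
  then obtain h where h: "\<chi> = padd (pull h) \<phi>" "h \<in> mod_hom polyring F0 R" unfolding ext_coset_eq by blast
  let ?k = "\<lambda>y. h y \<oplus>\<^bsub>R\<^esub> g y"
  have "?k \<in> mod_hom polyring F0 R"
    unfolding mod_hom_def
  proof (intro CollectI conjI ballI Pi_I)
    fix y assume y: "y \<in> carrier F0"
    obtain p where p: "h y = cs J p" using mod_hom_cs(1)[OF idl h(2) y] by blast
    obtain q where q: "g y = cs J q" using mod_hom_cs(1)[OF idl g y] by blast
    show "h y \<oplus>\<^bsub>R\<^esub> g y \<in> carrier R" by (simp add: p q R_simps)
    { fix y' assume y': "y' \<in> carrier F0"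
      obtain p' where p': "h y' = cs J p'" using mod_hom_cs(1)[OF idl h(2) y'] by blast
      obtain q' where q': "g y' = cs J q'" using mod_hom_cs(1)[OF idl g y'] by blast
      show "h (y \<oplus>\<^bsub>F0\<^esub> y') \<oplus>\<^bsub>R\<^esub> g (y \<oplus>\<^bsub>F0\<^esub> y') = (h y \<oplus>\<^bsub>R\<^esub> g y) \<oplus>\<^bsub>R\<^esub> (h y' \<oplus>\<^bsub>R\<^esub> g y')"
        using mod_hom_cs(2)[OF idl h(2) y y' p p'] mod_hom_cs(2)[OF idl g y y' q q']
        by (simp add: p q p' q' R_simps algebra_simps) }
    fix r
    show "h (r \<odot>\<^bsub>F0\<^esub> y) \<oplus>\<^bsub>R\<^esub> g (r \<odot>\<^bsub>F0\<^esub> y) = r \<odot>\<^bsub>R\<^esub> (h y \<oplus>\<^bsub>R\<^esub> g y)"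
      using mod_hom_cs(3)[OF idl h(2) y p, of r] mod_hom_cs(3)[OF idl g y q, of r]
      by (simp add: p q R_simps distrib_left)
  qed
  moreover have "\<chi> = padd (pull ?k) \<psi>"
  proof
    fix x show "\<chi> x = padd (pull ?k) \<psi> x"
    proof (cases "x \<in> carrier F1")
      case True
      obtain p where p: "h (d 0 x) = cs J p" using mod_hom_cs(1)[OF idl h(2), of "d 0 x"] True by auto
      obtain q where q: "g (d 0 x) = cs J q" using mod_hom_cs(1)[OF idl g, of "d 0 x"] True by auto
      obtain r where r: "\<psi> x = cs J r" using Z_cs[OF \<psi> True] by blast
      show ?thesis using True eq[OF True] by (simp add: h(1) padd_def pull_def p q r R_simps add.assoc)
    qed (simp add: h(1) padd_def)
  qed
  ultimately show "\<chi> \<in> ext_coset \<psi>" unfolding ext_coset_eq by blast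
qed

definition V where "V = cs I' ` (J \<inter> poly_piece a)"

definition Theta :: "('f \<Rightarrow> ('x, 'k) mpoly set) set \<Rightarrow> ('x, 'k) mpoly set \<Rightarrow> 'k" where
  "Theta A = (\<lambda>v\<in>V. Phi (SOME \<phi>. \<phi> \<in> A) (SOME j. j \<in> J \<inter> poly_piece a \<and> v = cs I' j))"

text \<open>Stated for any nonempty set of cocycles with a common functional, so that sums and
  multiples of cosets, given as sets, need not first be recognised as cosets.\<close>

lemma Theta_eq:
  assumes A: "A \<noteq> {}" "\<And>\<phi>. \<phi> \<in> A \<Longrightarrow> \<phi> \<in> Z \<and> (\<forall>j\<in>J. Phi \<phi> j = L j)"
    and j: "j \<in> J" "j \<in> poly_piece a"
  shows "Theta A (cs I' j) = L j"
proof -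
  define \<phi> where "\<phi> = (SOME \<phi>. \<phi> \<in> A)"
  have \<phi>: "\<phi> \<in> A" unfolding \<phi>_def using A(1) by (rule some_in_eq[THEN iffD2])
  define i where "i = (SOME i. i \<in> J \<inter> poly_piece a \<and> cs I' j = cs I' i)"
  have i: "i \<in> J \<inter> poly_piece a \<and> cs I' j = cs I' i" unfolding i_def by (rule someI[of _ j]) (use j in simp)
  have "Theta A (cs I' j) = Phi \<phi> i" using j by (simp add: Theta_def V_def \<phi>_def i_def)
  also have "\<dots> = Phi \<phi> j"
    using A(2)[OF \<phi>] i j cs_eq_iff[OF I'_ideal, of i j] by (intro Phi_cong) auto
  also have "\<dots> = L j" using A(2)[OF \<phi>] j by blast
  finally show ?thesis .
qed

lemma Theta_coset: "\<phi> \<in> Z \<Longrightarrow> j \<in> J \<Longrightarrow> j \<in> poly_piece a \<Longrightarrow> Theta (ext_coset \<phi>) (cs I' j) = Phi \<phi> j"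
proof (rule Theta_eq)
  assume \<phi>: "\<phi> \<in> Z"
  show "ext_coset \<phi> \<noteq> {}" using ext_coset_self[OF \<phi>] by auto
  show "\<psi> \<in> Z \<and> (\<forall>j\<in>J. Phi \<psi> j = Phi \<phi> j)" if "\<psi> \<in> ext_coset \<phi>" for \<psi>
    by (rule ext_coset_mem[OF \<phi> that])
qed

lemma Theta_extensional: "Theta A \<in> extensional V"
  by (simp add: Theta_def)

lemma extensional_V_eqI:
  assumes "\<alpha> \<in> extensional V" "\<beta> \<in> extensional V"
    "\<And>j. j \<in> J \<Longrightarrow> j \<in> poly_piece a \<Longrightarrow> \<alpha> (cs I' j) = \<beta> (cs I' j)"
  shows "\<alpha> = \<beta>"
  using assms by (intro extensionalityI[OF assms(1,2)]) (auto simp: V_def)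

abbreviation Z0 where "Z0 \<equiv> Z \<inter> homogeneous_hom F1 (GF (Suc 0)) R GR 0"

abbreviation KR where "KR \<equiv> (ring_of_type_algebra :: 'k ring)"

abbreviation ext_space where "ext_space \<equiv> vector_space_on (Ext_module polyring F d R (Suc 0)) (Ext_piece F GF d R GR (Suc 0) 0)"

abbreviation VM where "VM \<equiv> vector_space_on (ideal_quot J I') (ideal_quot_piece J I' a)"

lemma ext_space_simps: "carrier ext_space = ext_coset ` Z0" "add ext_space = set_add HZ"
  "c \<odot>\<^bsub>ext_space\<^esub> A = (\<Union>\<phi>\<in>A. ext_coset (psmult (const_poly c) \<phi>))"
  by (simp_all add: vector_space_on_def Ext_piece_def quot_grading_def Ext_module_def quot_module_def HZ_simps)

lemma VM_simps: "carrier VM = V" "add VM (cs I' i) (cs I' j) = cs I' (i + j)"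
  "c \<odot>\<^bsub>VM\<^esub> (cs I' j) = cs I' (const_poly c * j)"
  by (simp_all add: vector_space_on_def ideal_quot_simps[OF I'_ideal] V_def)

lemma Hom_simps: "carrier (Hom_module KR VM (self_module KR)) = mod_hom KR VM (self_module KR) \<inter> extensional V"
  "add (Hom_module KR VM (self_module KR)) \<alpha> \<beta> = (\<lambda>v\<in>V. \<alpha> v + \<beta> v)"
  "c \<odot>\<^bsub>Hom_module KR VM (self_module KR)\<^esub> \<alpha> = (\<lambda>v\<in>V. c * \<alpha> v)"
  by (simp_all add: Hom_module_def VM_simps)

lemma mod_hom_V_iff: "\<alpha> \<in> mod_hom KR VM (self_module KR) \<longleftrightarrow>
    (\<forall>i\<in>J \<inter> poly_piece a. \<forall>j\<in>J \<inter> poly_piece a. \<alpha> (cs I' (i + j)) = \<alpha> (cs I' i) + \<alpha> (cs I' j)) \<and>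
    (\<forall>c. \<forall>j\<in>J \<inter> poly_piece a. \<alpha> (cs I' (const_poly c * j)) = c * \<alpha> (cs I' j))"
  unfolding mod_hom_def VM_simps(1) by (auto simp: V_def VM_simps(2,3))

lemma Theta_hom: "\<phi> \<in> Z \<Longrightarrow> Theta (ext_coset \<phi>) \<in> mod_hom KR VM (self_module KR)"
  unfolding mod_hom_V_iff
  by (auto simp: Theta_coset Phi_add Phi_const is_ideal_add[OF idl] is_ideal_mult[OF idl] poly_piece_add poly_piece_const)

lemma ext_isomorphism: "modules_isomorphic KR ext_space (Hom_module KR VM (self_module KR))"
  unfolding modules_isomorphic_def
proof (rule bexI[of _ Theta])
  show "Theta \<in> mod_hom KR ext_space (Hom_module KR VM (self_module KR))"
    unfolding mod_hom_def[of KR ext_space]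
  proof (intro CollectI conjI ballI Pi_I)
    fix A assume "A \<in> carrier ext_space"
    then obtain \<phi> where \<phi>: "A = ext_coset \<phi>" "\<phi> \<in> Z0" unfolding ext_space_simps by blast
    then show "Theta A \<in> carrier (Hom_module KR VM (self_module KR))"
      using Theta_hom Theta_extensional by (simp add: Hom_simps)
    { fix A' assume "A' \<in> carrier ext_space"
      then obtain \<phi>' where \<phi>': "A' = ext_coset \<phi>'" "\<phi>' \<in> Z0" unfolding ext_space_simps by blast
      show "Theta (A \<oplus>\<^bsub>ext_space\<^esub> A') = Theta A \<oplus>\<^bsub>Hom_module KR VM (self_module KR)\<^esub> Theta A'"
      proof (rule extensional_V_eqI)
        fix j assume j: "j \<in> J" "j \<in> poly_piece a"
        have set: "A \<oplus>\<^bsub>ext_space\<^esub> A' = {padd \<psi> \<psi>' | \<psi> \<psi>'. \<psi> \<in> A \<and> \<psi>' \<in> A'}"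
          unfolding ext_space_simps set_add_def set_mult_def by (auto simp: HZ_simps)
        have "Theta (A \<oplus>\<^bsub>ext_space\<^esub> A') (cs I' j) = (\<lambda>j. Phi \<phi> j + Phi \<phi>' j) j"
        proof (rule Theta_eq[OF _ _ j])
          show "A \<oplus>\<^bsub>ext_space\<^esub> A' \<noteq> {}" unfolding set using ext_coset_self \<phi> \<phi>' by blast
          fix \<psi> assume "\<psi> \<in> A \<oplus>\<^bsub>ext_space\<^esub> A'"
          then obtain \<chi> \<chi>' where "\<psi> = padd \<chi> \<chi>'" "\<chi> \<in> A" "\<chi>' \<in> A'" unfolding set by blast
          then show "\<psi> \<in> Z \<and> (\<forall>j\<in>J. Phi \<psi> j = Phi \<phi> j + Phi \<phi>' j)"
            using ext_coset_mem[of \<phi> \<chi>] ext_coset_mem[of \<phi>' \<chi>'] \<phi> \<phi>' padd_Z Phi_padd by auto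
        qed
        then show "Theta (A \<oplus>\<^bsub>ext_space\<^esub> A') (cs I' j) =
            (Theta A \<oplus>\<^bsub>Hom_module KR VM (self_module KR)\<^esub> Theta A') (cs I' j)"
          using j \<phi> \<phi>' Theta_coset by (simp add: Hom_simps V_def)
      qed (simp_all add: Theta_extensional Hom_simps) }
    fix c
    show "Theta (c \<odot>\<^bsub>ext_space\<^esub> A) = c \<odot>\<^bsub>Hom_module KR VM (self_module KR)\<^esub> Theta A"
    proof (rule extensional_V_eqI)
      fix j assume j: "j \<in> J" "j \<in> poly_piece a"
      have "Theta (c \<odot>\<^bsub>ext_space\<^esub> A) (cs I' j) = (\<lambda>j. c * Phi \<phi> j) j"
      proof (rule Theta_eq[OF _ _ j])
        show "c \<odot>\<^bsub>ext_space\<^esub> A \<noteq> {}" unfolding ext_space_simps \<phi>(1) using ext_coset_self psmult_Z \<phi>(2) by blast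
        fix \<psi> assume "\<psi> \<in> c \<odot>\<^bsub>ext_space\<^esub> A"
        then obtain \<chi> where "\<chi> \<in> ext_coset \<phi>" "\<psi> \<in> ext_coset (psmult (const_poly c) \<chi>)" unfolding ext_space_simps \<phi>(1) by blast
        then show "\<psi> \<in> Z \<and> (\<forall>j\<in>J. Phi \<psi> j = c * Phi \<phi> j)"
          using ext_coset_mem[of \<phi> \<chi>] ext_coset_mem[of "psmult (const_poly c) \<chi>" \<psi>] \<phi>(2) psmult_Z Phi_psmult by auto
      qed
      then show "Theta (c \<odot>\<^bsub>ext_space\<^esub> A) (cs I' j) = (c \<odot>\<^bsub>Hom_module KR VM (self_module KR)\<^esub> Theta A) (cs I' j)"
        using j \<phi> Theta_coset by (simp add: Hom_simps V_def)
    qed (simp_all add: Theta_extensional Hom_simps)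
  qed
  show "bij_betw Theta (carrier ext_space) (carrier (Hom_module KR VM (self_module KR)))"
    unfolding bij_betw_def
  proof
    have sub: "ext_coset \<phi> \<subseteq> ext_coset \<psi>" if \<phi>: "\<phi> \<in> Z0" and \<psi>: "\<psi> \<in> Z0" and e: "Theta (ext_coset \<phi>) = Theta (ext_coset \<psi>)" for \<phi> \<psi>
    proof -
      \<comment> \<open>The difference of the two cocycles has zero functional in degree
        \<open>a\<close>, so \<open>Phi_injective\<close> makes it a coboundary.\<close>
      define \<chi> where "\<chi> = padd \<phi> (psmult (const_poly (-1)) \<psi>)"
      have \<chi>: "\<chi> \<in> Z" using \<phi> \<psi> padd_Z psmult_Z by (simp add: \<chi>_def)
      have val: "\<chi> x = cs J (p - q)" if "x \<in> carrier F1" "\<phi> x = cs J p" "\<psi> x = cs J q" for x p q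
        using that by (simp add: \<chi>_def padd_def psmult_def R_simps single_uminus)
      have "\<chi> \<in> homogeneous_hom F1 (GF (Suc 0)) R GR 0"
        unfolding homogeneous_hom_def
      proof (intro CollectI conjI allI image_subsetI)
        show "\<chi> \<in> mod_hom polyring F1 R" by (rule Z_mod_hom[OF \<chi>])
        fix e x assume x: "x \<in> GF (Suc 0) e"
        have "\<phi> x \<in> GR e" "\<psi> x \<in> GR e" using \<phi> \<psi> x by (force simp: homogeneous_hom_def)+
        then obtain p q where p: "p \<in> poly_piece e" "\<phi> x = cs J p" "q \<in> poly_piece e" "\<psi> x = cs J q"
          by (auto simp: R_simps)
        then show "\<chi> x \<in> GR (e + 0)"
          using val[OF GF_carrier[OF x] p(2,4)] poly_piece_diff[OF p(1,3)] by (simp add: R_simps)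
      qed
      moreover have "Phi \<chi> j = 0" if j: "j \<in> J" "j \<in> poly_piece a" for j
        using Phi_padd[of \<phi> "psmult (const_poly (-1)) \<psi>" j] Phi_psmult[of \<psi> j "-1"] psmult_Z \<phi> \<psi> j
          Theta_coset[of \<phi> j] Theta_coset[of \<psi> j] e by (simp add: \<chi>_def)
      ultimately obtain g where g: "g \<in> mod_hom polyring F0 R" "\<And>x. x \<in> carrier F1 \<Longrightarrow> \<chi> x = g (d 0 x)"
        using Phi_injective[OF \<chi>] by blast
      show ?thesis
      proof (rule ext_coset_subset[OF _ _ g(1)])
        fix x assume x: "x \<in> carrier F1"
        obtain p where p: "\<phi> x = cs J p" using Z_cs[of \<phi> x] \<phi> x by blast
        obtain q where q: "\<psi> x = cs J q" using Z_cs[of \<psi> x] \<psi> x by blast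
        show "\<phi> x = g (d 0 x) \<oplus>\<^bsub>R\<^esub> \<psi> x"
          unfolding p q g(2)[OF x, symmetric] val[OF x p q] by (simp add: R_simps)
      qed (use \<phi> \<psi> in auto)
    qed
    show "inj_on Theta (carrier ext_space)"
    proof (rule inj_onI)
      fix A A' assume "A \<in> carrier ext_space" "A' \<in> carrier ext_space" and e: "Theta A = Theta A'"
      then obtain \<phi> \<phi>' where \<phi>: "A = ext_coset \<phi>" "\<phi> \<in> Z0" "A' = ext_coset \<phi>'" "\<phi>' \<in> Z0" unfolding ext_space_simps by blast
      show "A = A'" using sub[OF \<phi>(2,4)] sub[OF \<phi>(4,2)] e \<phi>(1,3) by auto
    qed
    show "Theta ` carrier ext_space = carrier (Hom_module KR VM (self_module KR))"
    proof
      show "Theta ` carrier ext_space \<subseteq> carrier (Hom_module KR VM (self_module KR))"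
        using Theta_hom Theta_extensional by (auto simp: Hom_simps ext_space_simps(1))
      show "carrier (Hom_module KR VM (self_module KR)) \<subseteq> Theta ` carrier ext_space"
      proof
        fix \<alpha> assume "\<alpha> \<in> carrier (Hom_module KR VM (self_module KR))"
        then have \<alpha>: "\<alpha> \<in> mod_hom KR VM (self_module KR)" "\<alpha> \<in> extensional V" by (auto simp: Hom_simps)
        \<comment> \<open>The functional given on degree \<open>a\<close> is extended by zero to the
          other degrees of \<open>J\<close>.\<close>
        define \<mu> where "\<mu> j = \<alpha> (cs I' (hcomp a j))" for j
        have piece: "hcomp a j \<in> J \<inter> poly_piece a" if "j \<in> J" for j
          using hideal_hcomp[OF hom that] hcomp_in_piece by blast
        have "\<exists>\<phi>\<in>Z0. \<forall>j\<in>J. Phi \<phi> j = \<mu> j"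
        proof (rule Phi_surjective)
          show "\<mu> (i + j) = \<mu> i + \<mu> j" if "i \<in> J" "j \<in> J" for i j
            using \<alpha>(1) piece[OF that(1)] piece[OF that(2)] unfolding mod_hom_V_iff by (simp add: \<mu>_def hcomp_add)
          show c: "\<mu> (const_poly c * j) = c * \<mu> j" if "j \<in> J" for c j
            using \<alpha>(1) piece[OF that] unfolding mod_hom_V_iff by (simp add: \<mu>_def hcomp_const)
          show "\<mu> j = 0" if j: "j \<in> I'" for j
          proof -
            have "cs I' (hcomp a j) = cs I' (hcomp a (const_poly 0 * j))"
              using I'_hcomp[OF j, of a] by (simp add: cs_eq_iff[OF I'_ideal])
            then have "\<mu> j = \<mu> (const_poly 0 * j)" by (simp add: \<mu>_def)
            also have "\<dots> = 0" using c[of j 0] j I'_J by auto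
            finally show ?thesis .
          qed
          show "\<mu> (hcomp a j) = \<mu> j" if "j \<in> J" for j
            by (simp add: \<mu>_def hcomp_piece[OF hcomp_in_piece])
        qed
        then obtain \<phi> where \<phi>: "\<phi> \<in> Z0" "\<And>j. j \<in> J \<Longrightarrow> Phi \<phi> j = \<mu> j" by blast
        have "Theta (ext_coset \<phi>) = \<alpha>"
        proof (rule extensional_V_eqI[OF Theta_extensional \<alpha>(2)])
          fix j assume "j \<in> J" "j \<in> poly_piece a"
          then show "Theta (ext_coset \<phi>) (cs I' j) = \<alpha> (cs I' j)"
            using \<phi> Theta_coset by (simp add: \<mu>_def hcomp_piece)
        qed
        then show "\<alpha> \<in> Theta ` carrier ext_space" unfolding ext_space_simps using \<phi>(1) by blast
      qed
    qed
  qed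
qed

end

text \<open>The free module \<open>F 0\<close> has finite rank, so \<open>J / I\<close> is finitely
  generated; each generator is killed by a power of the irrelevant ideal, and the sum of the
  exponents bounds them all.\<close>

lemma saturation_quot_bounded:
  fixes I :: "('x::finite, 'k::field) mpoly set"
  assumes I: "hideal I" and res: "graded_free_resolution (ideal_quot (saturation I) I) (ideal_quot_piece (saturation I) I) F GF d \<epsilon>"
  shows "\<exists>N. \<forall>p\<in>high N. \<forall>j\<in>saturation I. p * j \<in> I"
proof -
  let ?J = "saturation I"
  note Ii = hideal_ideal[OF I]
  note Ms = ideal_quot_simps[OF Ii]
  have "graded_free_module (F 0) (GF 0)" and eps: "\<epsilon> \<in> homogeneous_hom (F 0) (GF 0) (ideal_quot ?J I) (ideal_quot_piece ?J I) 0"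
    and surj: "\<epsilon> ` carrier (F 0) = carrier (ideal_quot ?J I)"
    using res by (simp_all add: graded_free_resolution_def)
  then obtain n b and \<delta> :: "nat \<Rightarrow> int" where b: "\<forall>j<n. b j \<in> GF 0 (\<delta> j)"
    and span: "\<forall>x\<in>carrier (F 0). \<exists>!s. s \<in> {..<n} \<rightarrow>\<^sub>E carrier polyring \<and> x = finsum (F 0) (\<lambda>j. s j \<odot>\<^bsub>F 0\<^esub> b j) {..<n}"
    and gr: "graded_module (F 0) (GF 0)"
    unfolding graded_free_module_def by (elim exE conjE)
  have mF: "module polyring (F 0)" using gr by (simp add: graded_module_def)
  have eh: "\<epsilon> \<in> mod_hom polyring (F 0) (ideal_quot ?J I)" using eps by (simp add: homogeneous_hom_def)
  have bc: "b j \<in> carrier (F 0)" if "j < n" for j using b that graded_module_piece_subset[OF gr] by blast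
  have "\<exists>m N. \<epsilon> (b j) = cs I m \<and> (\<forall>\<nu>. N \<le> mdeg \<nu> \<longrightarrow> mon \<nu> * m \<in> I)" if j: "j < n" for j
  proof -
    obtain m where "m \<in> ?J" "\<epsilon> (b j) = cs I m" using mod_hom_cs(1)[OF Ii eh bc[OF j]] by blast
    then show ?thesis using saturation_iff[OF Ii] by blast
  qed
  then obtain m N where m: "\<And>j. j < n \<Longrightarrow> \<epsilon> (b j) = cs I (m j)"
    and N: "\<And>j \<nu>. j < n \<Longrightarrow> N j \<le> mdeg \<nu> \<Longrightarrow> mon \<nu> * m j \<in> I" by metis
  define B where "B = (\<Sum>j<n. N j)"
  have NB: "N j \<le> B" if "j < n" for j unfolding B_def using that by (intro member_le_sum) auto
  show ?thesis
  proof (intro exI ballI)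
    fix p j :: "('x, 'k) mpoly" assume p: "p \<in> high B" and j: "j \<in> ?J"
    have "cs I j \<in> \<epsilon> ` carrier (F 0)" unfolding surj Ms using j by (rule imageI)
    then obtain y where y: "y \<in> carrier (F 0)" "\<epsilon> y = cs I j" by auto
    obtain s where "y = finsum (F 0) (\<lambda>j. s j \<odot>\<^bsub>F 0\<^esub> b j) {..<n}" using bspec[OF span y(1)] by (elim ex1E conjE)
    then have "cs I j = cs I (\<Sum>i<n. s i * m i)"
      using mod_hom_lin_comb[OF Ii eh mF bc m] y(2) by (simp add: lin_comb_def)
    then have diff: "j - (\<Sum>i<n. s i * m i) \<in> I" using cs_eq_iff[OF Ii] by blast
    show "p * j \<in> I"
    proof (rule high_mult_mem[OF Ii _ p])
      fix \<nu> :: "'x \<Rightarrow>\<^sub>0 nat" assume \<nu>: "B \<le> mdeg \<nu>"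
      have "mon \<nu> * (\<Sum>i<n. s i * m i) \<in> I"
        unfolding sum_distrib_left
      proof (rule is_ideal_sum[OF Ii])
        fix i assume "i \<in> {..<n}"
        then have "mon \<nu> * m i \<in> I" using N[of i \<nu>] NB[of i] \<nu> by auto
        then show "mon \<nu> * (s i * m i) \<in> I"
          using is_ideal_mult[OF Ii, of "mon \<nu> * m i" "s i"] by (simp add: mult.left_commute)
      qed
      from is_ideal_add[OF Ii is_ideal_mult[OF Ii diff, of "mon \<nu>"] this]
      show "mon \<nu> * j \<in> I" by (simp add: right_diff_distrib)
    qed
  qed
qed

theorem corollary3p14:
  fixes I :: "('x::finite, 'k::field) mpoly set"
    and a :: int
    and F :: "nat \<Rightarrow> (('x, 'k) mpoly, 'f) module"
    and GF :: "nat \<Rightarrow> int \<Rightarrow> 'f set"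
    and d :: "nat \<Rightarrow> 'f \<Rightarrow> 'f"
    and \<epsilon> :: "'f \<Rightarrow> ('x, 'k) mpoly set"
  assumes "homogeneous_ideal I"
    and "krull_dim (polyring Quot saturation I) = 1"
    and "gorenstein_ring TYPE('e) (polyring Quot saturation I)"
    and "hilbert_function (saturation I) a \<noteq> hilbert_function (saturation I) (a + 1)"
    and "\<And>b. b > a \<Longrightarrow> hilbert_function (saturation I) b = hilbert_function (saturation I) (b + 1)"
    and "graded_free_resolution (ideal_quot (saturation I) I)
           (ideal_quot_piece (saturation I) I) F GF d \<epsilon>"
  shows "modules_isomorphic (ring_of_type_algebra :: 'k ring)
           (vector_space_on
              (Ext_module polyring F d (ideal_quot UNIV (saturation I)) 1)
              (Ext_piece F GF d (ideal_quot UNIV (saturation I))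
                 (ideal_quot_piece UNIV (saturation I)) 1 0))
           (Hom_module (ring_of_type_algebra :: 'k ring)
              (vector_space_on
                 (ideal_quot (saturation I)
                    (I <+>\<^bsub>polyring\<^esub> (saturation I \<cdot>\<^bsub>polyring\<^esub> saturation I)))
                 (ideal_quot_piece (saturation I)
                    (I <+>\<^bsub>polyring\<^esub> (saturation I \<cdot>\<^bsub>polyring\<^esub> saturation I)) a))
              (self_module (ring_of_type_algebra :: 'k ring)))"
proof -
  define J where "J = saturation I"
  note A = assms[folded J_def]
  have I: "hideal I" by (rule homogeneous_ideal_hideal[OF A(1)])
  have J: "hideal J" unfolding J_def by (rule saturation_hideal[OF I])
  note Ii = hideal_ideal[OF I] and Ji = hideal_ideal[OF J]
  \<comment> \<open>If \<open>J\<close> were the whole ring, every piece of the quotient would be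
    the same zero space, and the Hilbert function could not jump at \<open>a\<close>.\<close>
  have proper: "1 \<notin> J"
  proof
    assume "1 \<in> J"
    then have UN: "J = UNIV" using is_ideal_mult[OF Ji, of 1] by auto
    have "cs J x = J" for x using cs_eq_iff[OF Ji, of x 0] UN by (simp add: cs_0)
    moreover have "J \<in> cs J ` (UNIV \<inter> poly_piece e)" for e
      by (rule image_eqI[of _ _ 0]) (simp_all add: cs_0)
    ultimately have "ideal_quot_piece UNIV J e = {J}" for e
      unfolding ideal_quot_simps[OF Ji] by auto
    then show False using A(4) by (simp add: hilbert_function_def)
  qed
  define c where "c = hilbert_function J (a + 1)"
  have const: "hilbert_function J b = c" if "b > a" for b
  proof -
    have "hilbert_function J (a + 1 + int n) = c" for n
    proof (induction n)
      case (Suc n)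
      then show ?case using A(5)[of "a + 1 + int n"] by (simp add: algebra_simps)
    qed (simp add: c_def)
    from this[of "nat (b - a - 1)"] that show ?thesis by simp
  qed
  interpret sh: stable_hilbert J a c
  proof
    show "hideal J" by (rule J)
    show "saturated J" unfolding J_def by (rule saturation_saturated[OF Ii])
    show "pvs.reldim c (J \<inter> poly_piece b) (poly_piece b)" if "b > a" for b
      using hf_reldim_exists[OF Ji, of b] hilbert_function_eq[OF Ji proper] const[OF that] by metis
    show "\<not> pvs.reldim c (J \<inter> poly_piece a) (poly_piece a)"
      using hilbert_function_eq[OF Ji proper] A(4) c_def by metis
    have "noetherian_ring (polyring Quot J)" using A(3) by (simp add: gorenstein_ring_def)
    then show "\<And>\<F>. \<F> \<noteq> {} \<Longrightarrow> (\<And>A. A \<in> \<F> \<Longrightarrow> is_ideal A \<and> J \<subseteq> A) \<Longrightarrow> \<exists>A\<in>\<F>. \<forall>B\<in>\<F>. A \<subseteq> B \<longrightarrow> B = A"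
      using noetherian_quot_maximal Ji by blast
  qed
  obtain f0 t0 where f0: "t0 \<ge> 1" "f0 \<in> poly_piece (int t0)" "\<And>p. f0 * p \<in> J \<Longrightarrow> p \<in> J"
    using sh.exists_nzd by blast
  obtain N where N: "\<And>p j. p \<in> high N \<Longrightarrow> j \<in> J \<Longrightarrow> p * j \<in> I"
    using saturation_quot_bounded[OF I assms(6)] unfolding J_def by blast
  \<comment> \<open>The power raises the degree to at least \<open>N\<close>, so that
    \<open>f\<close> kills \<open>J / I\<close>; \<open>Suc\<close> keeps the degree positive when
    \<open>N\<close> is zero.\<close>
  define f where "f = f0 ^ Suc N"
  define t where "t = Suc N * t0"
  have t: "t \<ge> 1" "N \<le> t"
  proof -
    have "Suc N * 1 \<le> t" unfolding t_def by (rule mult_le_mono2[OF f0(1)])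
    then show "t \<ge> 1" "N \<le> t" by simp_all
  qed
  have f: "f \<in> poly_piece (int t)" using poly_piece_power[OF f0(2), of "Suc N"] by (simp only: f_def t_def of_nat_mult)
  have nzd: "p \<in> J" if "f * p \<in> J" for p
  proof -
    have "f0 ^ n * p \<in> J \<Longrightarrow> p \<in> J" for n
    proof (induction n)
      case (Suc n)
      then have "f0 * (f0 ^ n * p) \<in> J" by (simp add: mult.assoc)
      then show ?case using Suc f0(3) by blast
    qed simp
    then show ?thesis using that unfolding f_def by blast
  qed
  have f_high: "f \<in> high 1" "f \<in> high N"
    using f t by (auto simp: high_def poly_piece_iff)
  note top = sh.nzd_top(1)[OF t(1) f nzd]
  obtain \<sigma> where \<sigma>: "\<sigma> \<in> poly_piece (a + int t)" "\<sigma> \<notin> adjoin J f" using sh.nzd_top(2)[OF t(1) f nzd] by blast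
  have Ci: "is_ideal (adjoin J f)" by (rule adjoin_ideal[OF Ji])
  note high = high_subset_if_pieces[OF Ci top]
  note \<sigma>_socle = top_piece_socle[OF Ci top \<sigma>(1)]
  interpret ec: ext_computation J f t a \<sigma> I F GF d \<epsilon>
  proof
    show "\<exists>c. s - const_poly c * \<sigma> \<in> adjoin J f" if "\<And>q. q \<in> high 1 \<Longrightarrow> q * s \<in> adjoin J f" for s
      using gorenstein_socle_one_dimensional[OF J proper A(3) f_high(1) nzd high that \<sigma>(2) \<sigma>_socle] .
    show "I \<subseteq> J" unfolding J_def by (rule saturation_subset[OF Ii])
    show "f * j \<in> I" if "j \<in> J" for j using N f_high(2) that by blast
  qed (use J f top \<sigma> I nzd A(6) in blast)+
  show ?thesis
    using ec.ext_isomorphism unfolding ec.I'_def J_def[symmetric] One_nat_def .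
qed

end
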